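(* Let $N,m,L$ be positive integers with $N,L\ge 2$ and $m\ge N$, let $$D=D_N\oplus mD_L=\{a+mb : 0\le a\le N-1,\ 0\le b\le L-1\},$$ where $D_n=\{0,1,\dots,n-1\}$, and let $\rho=\frac{1}{NL}$. Let $T(\rho,D)\subset\mathbb{R}$ be the self-similar set generated by $(\rho,D)$, i.e. the unique nonempty compact set $T$ with $T=\bigcup_{\delta\in D}\rho(T+\delta)$. Then $T(\rho,D)$ is a spectral set if and only if $T(\rho,D)$ is a translation tile of $\mathbb{R}$.
   Context: The symbol $\oplus$ denotes a direct sum of sets (each element has a unique representation as a sum), so $\#D=NL$. A Lebesgue measurable set $\Omega\subset\mathbb{R}$ is a spectral set if it has positive and finite Lebesgue measure and there is a countable set $\Lambda\subset\mathbb{R}$ such that $\{e^{2\pi i\lambda x}:\lambda\in\Lambda\}$ is an orthonormal basis of $L^2(\mu)$, where $\mu$ is the normalized Lebesgue measure restricted to $\Omega$. A set $T\subset\mathbb{R}$ is a translation tile of $\mathbb{R}$ if there is a discrete set $\Gamma\subset\mathbb{R}$ such that $\bigcup_{\gamma\in\Gamma}(T+\gamma)=\mathbb{R}$ up to a Lebesgue null set and $(T+\gamma)\cap(T+\gamma')$ has Lebesgue measure zero for distinct $\gamma,\gamma'\in\Gamma$. *)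

theory Defs
  imports "HOL-Analysis.Analysis"
begin

section \<open>Orthonormal bases of \<open>L\<^sup>2\<close> and spectral sets\<close>

text \<open>Elements of \<open>L\<^sup>2(M)\<close> are represented by measurable functions; functions agreeing
  almost everywhere are not identified, the norm and inner product only depend on the class.\<close>

definition L2_functions :: "'a measure \<Rightarrow> ('a \<Rightarrow> complex) set" where
  "L2_functions M =
     {f \<in> borel_measurable M. integrable M (\<lambda>x. (cmod (f x))\<^sup>2)}"

definition L2_inner :: "'a measure \<Rightarrow> ('a \<Rightarrow> complex) \<Rightarrow> ('a \<Rightarrow> complex) \<Rightarrow> complex" where
  "L2_inner M f g = (\<integral>x. f x * cnj (g x) \<partial>M)"

definition L2_norm :: "'a measure \<Rightarrow> ('a \<Rightarrow> complex) \<Rightarrow> real" where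
  "L2_norm M f = sqrt (\<integral>x. (cmod (f x))\<^sup>2 \<partial>M)"

text \<open>An orthonormal system whose finite complex linear combinations are dense.\<close>

definition L2_orthonormal_basis :: "'a measure \<Rightarrow> ('a \<Rightarrow> complex) set \<Rightarrow> bool" where
  "L2_orthonormal_basis M B \<longleftrightarrow>
     B \<subseteq> L2_functions M \<and>
     (\<forall>f\<in>B. \<forall>g\<in>B. L2_inner M f g = (if f = g then 1 else 0)) \<and>
     (\<forall>f\<in>L2_functions M. \<forall>\<epsilon>>0. \<exists>F c. finite F \<and> F \<subseteq> B \<and>
        L2_norm M (\<lambda>x. f x - (\<Sum>e\<in>F. c e * e x)) < \<epsilon>)"

text \<open>\<open>uniform_measure lebesgue \<Omega>\<close> is Lebesgue measure restricted to \<open>\<Omega>\<close> and divided by the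
  measure of \<open>\<Omega>\<close>.\<close>

definition spectral_set :: "real set \<Rightarrow> bool" where
  "spectral_set \<Omega> \<longleftrightarrow>
     \<Omega> \<in> sets lebesgue \<and> 0 < emeasure lebesgue \<Omega> \<and> emeasure lebesgue \<Omega> < \<infinity> \<and>
     (\<exists>\<Lambda>. countable \<Lambda> \<and>
        L2_orthonormal_basis (uniform_measure lebesgue \<Omega>)
          {(\<lambda>x. exp (2 * complex_of_real pi * \<i> * complex_of_real (l * x))) | l. l \<in> \<Lambda>})"

section \<open>Translation tiles\<close>

definition translation_tile :: "real set \<Rightarrow> bool" where
  "translation_tile T \<longleftrightarrow>
     (\<exists>\<Gamma>. discrete \<Gamma> \<and>
        UNIV - (\<Union>\<gamma>\<in>\<Gamma>. (\<lambda>x. x + \<gamma>) ` T) \<in> null_sets lebesgue \<and>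
        (\<forall>\<gamma>\<in>\<Gamma>. \<forall>\<gamma>'\<in>\<Gamma>. \<gamma> \<noteq> \<gamma>' \<longrightarrow>
           (\<lambda>x. x + \<gamma>) ` T \<inter> (\<lambda>x. x + \<gamma>') ` T \<in> null_sets lebesgue))"

section \<open>Self-similar sets\<close>

definition is_self_similar_set :: "real \<Rightarrow> real set \<Rightarrow> real set \<Rightarrow> bool" where
  "is_self_similar_set \<rho> D T \<longleftrightarrow>
     T \<noteq> {} \<and> compact T \<and> T = (\<Union>\<delta>\<in>D. (\<lambda>x. \<rho> * (x + \<delta>)) ` T)"

text \<open>The description is proper for \<open>0 < \<rho> < 1\<close> and finite nonempty \<open>D\<close>; see
  \<open>is_self_similar_set_self_similar_set\<close> below.\<close>

definition self_similar_set :: "real \<Rightarrow> real set \<Rightarrow> real set" where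
  "self_similar_set \<rho> D = (THE T. is_self_similar_set \<rho> D T)"

lemma self_similar_set_subset:
  assumes r: "0 < \<rho>" "\<rho> < 1"
    and S: "is_self_similar_set \<rho> D S" and T: "is_self_similar_set \<rho> D T"
  shows "S \<subseteq> T"
proof
  fix s assume s: "s \<in> S"
  have S': "compact S" "S = (\<Union>\<delta>\<in>D. (\<lambda>x. \<rho> * (x + \<delta>)) ` S)"
    and T': "compact T" "T \<noteq> {}" "T = (\<Union>\<delta>\<in>D. (\<lambda>x. \<rho> * (x + \<delta>)) ` T)"
    using S T by (auto simp only: is_self_similar_set_def)
  have "bounded (S \<union> T)" using S' T' by (simp add: compact_imp_bounded)
  then obtain C where C: "\<And>x. x \<in> S \<union> T \<Longrightarrow> norm x \<le> C"
    unfolding bounded_iff by blast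
  have *: "\<forall>s\<in>S. \<exists>t\<in>T. \<bar>s - t\<bar> \<le> \<rho> ^ n * (2 * C)" for n
  proof (induction n)
    case 0
    obtain t where t: "t \<in> T" using T' by auto
    have "\<bar>s - t\<bar> \<le> 2 * C" if "s \<in> S" for s
      using C[of s] C[of t] t that by auto
    then show ?case using t by auto
  next
    case (Suc n)
    show ?case
    proof
      fix s assume "s \<in> S"
      then obtain d s' where d: "d \<in> D" "s' \<in> S" "s = \<rho> * (s' + d)" using S'(2) by blast
      then obtain t' where t': "t' \<in> T" "\<bar>s' - t'\<bar> \<le> \<rho> ^ n * (2 * C)" using Suc by blast
      have "\<rho> * (t' + d) \<in> T" using T'(3) t'(1) d(1) by blast
      moreover have "\<bar>s - \<rho> * (t' + d)\<bar> = \<rho> * \<bar>s' - t'\<bar>"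
      proof -
        have "s - \<rho> * (t' + d) = \<rho> * (s' - t')" using d(3) by (simp add: algebra_simps)
        then show ?thesis using r by (simp add: abs_mult)
      qed
      moreover have "\<rho> * \<bar>s' - t'\<bar> \<le> \<rho> ^ Suc n * (2 * C)"
        using mult_left_mono[OF t'(2), of \<rho>] r by (simp add: mult.assoc)
      ultimately show "\<exists>t\<in>T. \<bar>s - t\<bar> \<le> \<rho> ^ Suc n * (2 * C)" by (intro bexI) auto
    qed
  qed
  have "s \<in> closure T"
    unfolding closure_approachable
  proof (intro allI impI)
    fix e :: real assume "e > 0"
    have "(\<lambda>n. \<rho> ^ n * (2 * C)) \<longlonglongrightarrow> 0 * (2 * C)"
      using r by (intro tendsto_intros LIMSEQ_power_zero) auto
    then have "\<forall>\<^sub>F n in sequentially. \<rho> ^ n * (2 * C) < e"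
      using \<open>e > 0\<close> by (auto intro: order_tendstoD(2))
    then obtain n where n: "\<rho> ^ n * (2 * C) < e"
      by (auto simp: eventually_sequentially)
    obtain t where t: "t \<in> T" "\<bar>s - t\<bar> \<le> \<rho> ^ n * (2 * C)" using *[of n] s by blast
    then have "dist t s < e" using n by (simp add: dist_real_def abs_minus_commute)
    then show "\<exists>y\<in>T. dist y s < e" using t(1) by blast
  qed
  then show "s \<in> T" using T'(1) by (simp add: compact_imp_closed)
qed

lemma ex1_self_similar_set:
  assumes r: "0 < \<rho>" "\<rho> < 1" and D: "finite D" "D \<noteq> {}"
  shows "\<exists>!T. is_self_similar_set \<rho> D T"
proof -
  define F where "F T = (\<Union>\<delta>\<in>D. (\<lambda>x. \<rho> * (x + \<delta>)) ` T)" for T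
  obtain M where M: "M \<ge> 0" "\<And>d. d \<in> D \<Longrightarrow> \<bar>d\<bar> \<le> M"
    using finite_imp_bounded[OF D(1)] unfolding bounded_pos by (metis less_imp_le real_norm_def)
  define R where "R = \<rho> * M / (1 - \<rho>)"
  have R: "R \<ge> 0" "\<rho> * (R + M) = R" using r M by (auto simp: R_def field_simps)
  define K where "K n = (F ^^ n) {-R..R}" for n
  have K0: "K 0 = {-R..R}" and KS: "K (Suc n) = F (K n)" for n by (auto simp: K_def)
  have mono: "F A \<subseteq> F B" if "A \<subseteq> B" for A B using that by (auto simp: F_def)
  have "F {-R..R} \<subseteq> {-R..R}"
  proof
    fix y assume "y \<in> F {-R..R}"
    then obtain d x where dx: "d \<in> D" "x \<in> {-R..R}" "y = \<rho> * (x + d)" by (auto simp: F_def)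
    have "\<bar>x + d\<bar> \<le> R + M" using dx M(2)[of d] by auto
    then have "\<bar>y\<bar> \<le> \<rho> * (R + M)" using r by (simp add: dx(3) abs_mult)
    then show "y \<in> {-R..R}" using R by auto
  qed
  then have step: "K (Suc n) \<subseteq> K n" for n
    by (induction n) (use K0 KS mono in auto)
  then have anti: "K n \<subseteq> K m" if "m \<le> n" for m n
    using that by (rule lift_Suc_antimono_le)
  have comp: "compact (K n)" for n
  proof (induction n)
    case (Suc n)
    show ?case unfolding KS F_def
      by (intro compact_UN D compact_continuous_image Suc continuous_intros)
  qed (simp add: K0)
  have ne: "K n \<noteq> {}" for n
    by (induction n) (use R D in \<open>auto simp: K0 KS F_def\<close>)
  define T where "T = (\<Inter>n. K n)"
  have "T \<noteq> {}"
    unfolding T_def using comp ne anti by (intro compact_nest) auto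
  moreover have "compact T"
    unfolding T_def using comp by (intro compact_Inter) auto
  moreover have "T = F T"
  proof
    show "F T \<subseteq> T"
    proof -
      have "F T \<subseteq> K (Suc n)" for n unfolding KS by (rule mono) (auto simp: T_def)
      then show ?thesis using step unfolding T_def by blast
    qed
    show "T \<subseteq> F T"
    proof
      fix x assume x: "x \<in> T"
      have "\<exists>d\<in>D. x / \<rho> - d \<in> K n" for n
      proof -
        have "x \<in> F (K n)" using x unfolding T_def by (metis INT_E KS UNIV_I)
        then obtain d y where "d \<in> D" "y \<in> K n" "x = \<rho> * (y + d)" by (auto simp: F_def)
        moreover from this have "x / \<rho> - d = y" using r by simp
        ultimately show ?thesis by metis
      qed
      then obtain d where d: "\<And>n. d n \<in> D" "\<And>n. x / \<rho> - d n \<in> K n" by metis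
      have "\<exists>a\<in>D. infinite {n \<in> UNIV. d n = a}"
        using d(1) D(1) by (intro pigeonhole_infinite_rel) auto
      then obtain a where a: "a \<in> D" "infinite {n. d n = a}" by auto
      have "x / \<rho> - a \<in> K n" for n
      proof -
        obtain m where "m \<ge> n" "d m = a" using a(2) unfolding infinite_nat_iff_unbounded_le by auto
        then show ?thesis using d(2)[of m] anti by blast
      qed
      then have "x / \<rho> - a \<in> T" by (auto simp: T_def)
      moreover have "x = \<rho> * ((x / \<rho> - a) + a)" using r by simp
      ultimately show "x \<in> F T" using a(1) unfolding F_def by blast
    qed
  qed
  ultimately have "is_self_similar_set \<rho> D T"
    unfolding is_self_similar_set_def F_def by blast
  then show ?thesis using self_similar_set_subset[OF r] by blast
qed

lemma is_self_similar_set_self_similar_set: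
  assumes "0 < \<rho>" "\<rho> < 1" "finite D" "D \<noteq> {}"
  shows "is_self_similar_set \<rho> D (self_similar_set \<rho> D)"
  unfolding self_similar_set_def by (rule theI') (rule ex1_self_similar_set[OF assms])

section \<open>The digit set\<close>

definition digit_set :: "nat \<Rightarrow> nat \<Rightarrow> nat \<Rightarrow> real set" where
  "digit_set N m L = {real a + real m * real b | a b. a < N \<and> b < L}"

text \<open>For \<open>m \<ge> N\<close> the sum of \<open>{0,\<dots>,N - 1}\<close> and \<open>m{0,\<dots>,L - 1}\<close> is direct.\<close>

lemma digit_set_direct:
  assumes "N \<le> m"
  shows "inj_on (\<lambda>(a, b). real a + real m * real b) ({..<N} \<times> {..<L})"
proof (rule inj_onI, clarsimp)
  fix a b a' b' assume "a < N" "a' < N" "real a + real m * real b = real a' + real m * real b'"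
  then have lt: "a < m" "a' < m" and eq: "a + m * b = a' + m * b'"
    using assms by (simp_all flip: of_nat_mult of_nat_add)
  have "(a + m * b) mod m = (a' + m * b') mod m" "(a + m * b) div m = (a' + m * b') div m"
    using eq by simp_all
  then show "a = a' \<and> b = b'" using lt by simp
qed

lemma card_digit_set:
  assumes "N \<le> m"
  shows "card (digit_set N m L) = N * L"
proof -
  have "digit_set N m L = (\<lambda>(a, b). real a + real m * real b) ` ({..<N} \<times> {..<L})"
    by (auto simp: digit_set_def)
  then show ?thesis using card_image[OF digit_set_direct[OF assms]] by simp
qed

end

theory Submission
  imports Defs
begin

text \<open>Let \<open>b = N L\<close> and let \<open>T\<close> be the self-similar set. If \<open>T\<close> is spectral or a tile, it has
  positive measure. Then its Fourier transform vanishes at all nonzero integers, by the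
  Riemann-Lebesgue lemma and \<open>b\<close>-invariance, so every nonzero integer is \<open>b\<^sup>i\<close> times a zero of the
  mask of the digits. This zero condition forces \<open>m h = N b\<^sup>J t\<close> with
  \<open>gcd(t, L) = gcd(h, N) = gcd(h, t) = 1\<close>. Consequently \<open>h T = S + t N F\<close>, where \<open>S\<close> is the
  self-similar set of the digits \<open>h {0..<N} + t N {0..<L}\<close>, a coprime complete residue system
  modulo \<open>b\<close>, and \<open>F = {c\<^sub>0 + c\<^sub>1 b + \<dots> + c\<^sub>J\<^sub>-\<^sub>1 b\<^sup>J\<^sup>-\<^sup>1 | c\<^sub>i < L}\<close>. Such an \<open>S\<close> tiles the line by
  the integers (Groechenig-Haas). As \<open>t N F\<close> tiles the integers and admits a finite spectrum \<open>B\<close>, the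
  set \<open>h T\<close> both tiles and has the spectrum \<open>\<int> + B\<close>.\<close>

section \<open>The exponential of period 1\<close>

text \<open>The mask of the digits is a product of two geometric sums, one in \<open>y\<close> and
  one in \<open>m y\<close>. At \<open>y = n / b^(i+1)\<close> the first can vanish only if
  \<open>N y\<close> is an integer, hence only if \<open>L\<close> divides \<open>n\<close>. So the
  information on \<open>m\<close> comes from the \<open>n\<close> not divisible by \<open>L\<close>,
  where the second factor must vanish. It says that \<open>m / N\<close> is \<open>b^J\<close> times
  the reduced fraction \<open>t / h\<close>. Dilating by \<open>h\<close> removes the denominator;
  the power \<open>b^J\<close>, a mere shift of digit places, leaves the finite factor
  \<open>F\<close>. Each coprimality has its own task: \<open>h\<close> with \<open>N\<close> and
  \<open>t\<close> with \<open>L\<close> make the digits of \<open>S\<close> a complete residue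
  system, \<open>t\<close> with \<open>L\<close> also makes \<open>t N F\<close> tile the integers,
  and \<open>h\<close> with \<open>t N\<close> excludes a common divisor of the digits, which would
  make integer translates of \<open>S\<close> overlap. For almost every \<open>y\<close> the coset
  \<open>y + \<int>\<close> meets \<open>S\<close> once, so it meets \<open>h T\<close> in a
  translate of \<open>t N F\<close>. Tiling and spectrality of \<open>h T\<close> thus reduce to
  those of a finite set of integers.\<close>

definition unit_exp :: "real \<Rightarrow> complex" where
  "unit_exp x = cis (2 * pi * x)"

lemma unit_exp_0 [simp]: "unit_exp 0 = 1"
  by (simp add: unit_exp_def)

lemma norm_unit_exp [simp]: "norm (unit_exp x) = 1"
  by (simp add: unit_exp_def)

lemma unit_exp_neq_0 [simp]: "unit_exp x \<noteq> 0"
  by (simp add: unit_exp_def)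

lemma unit_exp_add: "unit_exp (x + y) = unit_exp x * unit_exp y"
  by (simp add: unit_exp_def cis_mult distrib_left)

lemma cnj_unit_exp [simp]: "cnj (unit_exp x) = unit_exp (- x)"
  by (simp add: unit_exp_def cis_cnj)

lemma unit_exp_diff: "unit_exp (x - y) = unit_exp x * cnj (unit_exp y)"
  using unit_exp_add[of x "- y"] by simp

lemma unit_exp_eq_1_iff: "unit_exp x = 1 \<longleftrightarrow> x \<in> \<int>"
proof
  assume "unit_exp x = 1"
  then have "cos (2 * pi * x) = 1" by (simp add: unit_exp_def complex_eq_iff)
  then obtain n :: int where "2 * pi * x = of_int n * 2 * pi"
    unfolding cos_one_2pi_int by blast
  then have "x = of_int n" by simp
  then show "x \<in> \<int>" by simp
qed (simp add: unit_exp_def)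

lemma unit_exp_Ints [simp]: "x \<in> \<int> \<Longrightarrow> unit_exp x = 1"
  by (simp add: unit_exp_eq_1_iff)

lemma unit_exp_add_Ints: "y \<in> \<int> \<Longrightarrow> unit_exp (x + y) = unit_exp x"
  by (simp add: unit_exp_add)

lemma unit_exp_eq_iff: "unit_exp x = unit_exp y \<longleftrightarrow> x - y \<in> \<int>"
proof -
  have "unit_exp (x - y) = 1 \<longleftrightarrow> unit_exp x = unit_exp y"
    using unit_exp_add[of "x - y" y] by auto
  then show ?thesis by (simp add: unit_exp_eq_1_iff)
qed

lemma unit_exp_power: "unit_exp x ^ n = unit_exp (real n * x)"
  by (simp add: unit_exp_def Complex.DeMoivre mult.left_commute)

lemma continuous_on_unit_exp [continuous_intros]:
  "continuous_on A f \<Longrightarrow> continuous_on A (\<lambda>x. unit_exp (f x))"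
  unfolding unit_exp_def by (intro continuous_intros)

lemma measurable_unit_exp [measurable]: "unit_exp \<in> borel_measurable borel"
  by (intro borel_measurable_continuous_onI continuous_intros)

lemma exp_eq_unit_exp:
  "exp (2 * complex_of_real pi * \<i> * complex_of_real x) = unit_exp x"
  by (simp add: unit_exp_def cis_conv_exp mult_ac)

lemma sum_unit_exp_eq_0_iff:
  assumes "n > 0"
  shows "(\<Sum>k<n. unit_exp (real k * x)) = 0 \<longleftrightarrow> real n * x \<in> \<int> \<and> x \<notin> \<int>"
proof (cases "x \<in> \<int>")
  case True
  then have "(\<Sum>k<n. unit_exp (real k * x)) = (\<Sum>k<n. 1)"
    by (intro sum.cong refl unit_exp_Ints) auto
  then show ?thesis using True assms by simp
next
  case False
  then have ne: "unit_exp x \<noteq> 1" by (simp add: unit_exp_eq_1_iff)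
  have "(\<Sum>k<n. unit_exp (real k * x)) = (unit_exp x ^ n - 1) / (unit_exp x - 1)"
    using ne by (simp add: geometric_sum flip: unit_exp_power)
  then show ?thesis using ne False by (simp add: unit_exp_power unit_exp_eq_1_iff)
qed

lemma sum_unit_exp_div:
  assumes "n > 0"
  shows "(\<Sum>k<n. unit_exp (real_of_int a * real k / real n)) = (if int n dvd a then of_nat n else 0)"
proof -
  have *: "real_of_int a / real n \<in> \<int> \<longleftrightarrow> int n dvd a"
    using assms of_int_div_of_int_in_Ints_iff[of a "int n", where 'a = real] by simp
  have eq: "(\<Sum>k<n. unit_exp (real_of_int a * real k / real n))
      = (\<Sum>k<n. unit_exp (real k * (real_of_int a / real n)))"
    by (simp add: mult_ac)
  show ?thesis
  proof (cases "int n dvd a")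
    case True
    then have "real k * (real_of_int a / real n) \<in> \<int>" for k using * by (intro Ints_mult) auto
    then show ?thesis using True eq by simp
  next
    case False
    then show ?thesis using eq * sum_unit_exp_eq_0_iff[OF assms, of "real_of_int a / real n"] assms
      by simp
  qed
qed

section \<open>The arithmetic of the digits\<close>

text \<open>The gcds grow with \<open>j\<close> and are bounded by \<open>m\<close>, so they stall
  somewhere. Where they do, \<open>b ^ j div gcd (b ^ j) m\<close> gets multiplied by
  \<open>b\<close> and becomes divisible by \<open>L\<close>; this is why the exponent
  \<open>J\<close> below exists.\<close>

lemma ex_stable_gcd_power:
  fixes b m :: nat
  assumes "m > 0"
  obtains j where "gcd (b ^ Suc j) m = gcd (b ^ j) m"
proof -
  have "\<exists>j. gcd (b ^ Suc j) m = gcd (b ^ j) m"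
  proof (rule ccontr)
    assume *: "\<not> ?thesis"
    have "gcd (b ^ j) m \<ge> Suc j" for j
    proof (induction j)
      case (Suc j)
      have "gcd (b ^ j) m dvd gcd (b ^ Suc j) m" by (intro gcd_mono) (auto simp: )
      then have "gcd (b ^ j) m \<le> gcd (b ^ Suc j) m" using assms by (intro dvd_imp_le) auto
      then show ?case using Suc * by (metis Suc_leI le_neq_implies_less order_trans Suc_le_mono)
    qed (use assms in auto)
    from this[of m] have "Suc m \<le> gcd (b ^ m) m" .
    moreover have "gcd (b ^ m) m \<le> m" using assms by (intro dvd_imp_le) auto
    ultimately show False by simp
  qed
  then show ?thesis using that by blast
qed

text \<open>\<open>b ^ j div gcd (b ^ j) m\<close> is the least \<open>h > 0\<close> such that \<open>m * h\<close> is divisible by \<open>b ^ j\<close>; the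
  exponent \<open>J\<close> is the last \<open>j\<close> for which it is not divisible by \<open>L\<close>.\<close>

lemma digit_factorization:
  fixes N L m :: nat
  assumes N: "N \<ge> 2" and L: "L \<ge> 2" and m: "m > 0"
    and zeros: "\<And>n. \<not> L dvd n \<Longrightarrow>
      \<exists>j. (N * L) ^ j * N dvd m * n \<and> \<not> (N * L) ^ Suc j dvd m * n"
  obtains J t h where "m * h = N * (N * L) ^ J * t" "h > 0" "t > 0"
    "coprime t L" "coprime h N" "coprime h t"
proof -
  define b where "b = N * L"
  have b: "b > 0" using N L by (simp add: b_def)
  define q where "q j = b ^ j div gcd (b ^ j) m" for j
  have q_dvd: "q j dvd x \<longleftrightarrow> b ^ j dvd m * x" for j x
  proof -
    have "b ^ j dvd m * x \<longleftrightarrow> gcd (b ^ j) m * q j dvd gcd (b ^ j) m * (m div gcd (b ^ j) m * x)"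
      by (simp add: q_def mult.assoc[symmetric])
    also have "\<dots> \<longleftrightarrow> q j dvd m div gcd (b ^ j) m * x" using m by simp
    also have "\<dots> \<longleftrightarrow> q j dvd x"
      unfolding q_def using m by (intro coprime_dvd_mult_right_iff div_gcd_coprime) auto
    finally show ?thesis by simp
  qed
  have q0: "q 0 = 1" by (simp add: q_def)
  have "\<exists>j. L dvd q (Suc j)"
  proof -
    obtain j where j: "gcd (b ^ Suc j) m = gcd (b ^ j) m" using ex_stable_gcd_power[OF m] .
    have "q (Suc j) = b * q j" unfolding q_def j by (simp add: div_mult_swap)
    then have "L dvd q (Suc j)" by (simp add: b_def)
    then show ?thesis by blast
  qed
  define J where "J = (LEAST j. L dvd q (Suc j))"
  have J1: "L dvd q (Suc J)" unfolding J_def by (rule LeastI_ex) fact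
  have J2: "\<not> L dvd q J"
  proof (cases J)
    case 0
    then show ?thesis using q0 L by simp
  next
    case (Suc j)
    then show ?thesis using not_less_Least[of j "\<lambda>j. L dvd q (Suc j)"] J_def by auto
  qed
  have "N dvd m" using zeros[of 1] L dvd_mult_right by fastforce
  then obtain \<tau> where \<tau>: "m = N * \<tau>" by blast
  have \<tau>0: "\<tau> > 0" using m \<tau> by auto
  \<comment> \<open>The zero condition enters with \<open>n = q J\<close>, which \<open>L\<close>
    does not divide. Its exponent \<open>j\<close> is at least \<open>J\<close>, because
    \<open>b ^ J\<close> divides \<open>m * q J\<close> and \<open>b ^ Suc j\<close> does not; this
    gains the extra factor \<open>N\<close>.\<close>
  have bJ: "b ^ J dvd \<tau> * q J"
  proof -
    obtain j where j: "b ^ j * N dvd m * q J" "\<not> b ^ Suc j dvd m * q J"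
      using zeros[OF J2] unfolding b_def by blast
    have "b ^ J dvd m * q J" using q_dvd[of J "q J"] by simp
    then have "J \<le> j" using j(2) by (meson dvd_trans le_imp_power_dvd not_less_eq_eq)
    then have "b ^ J dvd b ^ j" by (rule le_imp_power_dvd)
    then have "b ^ J * N dvd b ^ j * N" by (rule mult_dvd_mono) simp
    then have "b ^ J * N dvd m * q J" using j(1) by (rule dvd_trans)
    also have "m * q J = \<tau> * q J * N" using \<tau> by (simp add: mult_ac)
    finally show ?thesis using N by simp
  qed
  \<comment> \<open>\<open>t / h\<close> is \<open>\<tau> / b ^ J\<close> in lowest terms.\<close>
  define g where "g = gcd (b ^ J) \<tau>"
  have g: "g > 0" using \<tau>0 by (simp add: g_def)
  define h where "h = b ^ J div g"
  define t where "t = \<tau> div g"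
  have hg: "b ^ J = g * h" and tg: "\<tau> = g * t" by (simp_all add: h_def t_def g_def)
  have cop: "coprime h t" unfolding h_def t_def g_def using \<tau>0 by (intro div_gcd_coprime) auto
  have ht: "h > 0" "t > 0" using hg tg b \<tau>0 by (metis gr0I mult_is_0 power_not_zero neq0_conv)+
  have "h dvd q J"
  proof -
    have "g * h dvd g * (t * q J)" using bJ hg tg by (simp add: mult_ac)
    then have "h dvd t * q J" using g by simp
    then show ?thesis using cop by (simp add: coprime_dvd_mult_right_iff)
  qed
  \<comment> \<open>With \<open>d = gcd h (N * t)\<close>, the definition of \<open>q\<close> gives
    \<open>h = d * q J\<close>; as \<open>h\<close> divides \<open>q J\<close>, only
    \<open>d = 1\<close> remains.\<close>
  have copN: "coprime h (N * t)"
  proof -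
    let ?d = "gcd h (N * t)"
    have eq: "gcd (b ^ J) m = g * ?d"
      unfolding hg \<tau> tg by (simp add: gcd_mult_distrib_nat mult_ac)
    have "b ^ J = gcd (b ^ J) m * q J" by (simp add: q_def)
    then have "g * h = g * (?d * q J)" using hg eq by (simp add: mult_ac)
    then have *: "h = ?d * q J" using g by simp
    then have "?d * q J dvd q J" using \<open>h dvd q J\<close> by simp
    then have "?d = 1" using * ht by (metis dvd_mult_cancel2 mult_is_0 neq0_conv nat_dvd_1_iff_1 mult.commute)
    then show ?thesis by (simp add: coprime_iff_gcd_eq_1)
  qed
  \<comment> \<open>Here the choice of \<open>J\<close> enters through
    \<open>L dvd q (Suc J)\<close>. For \<open>d = gcd t L\<close> the factor
    \<open>h * (L div d)\<close> already makes the product with \<open>m\<close> divisible by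
    \<open>b ^ Suc J\<close>, so \<open>L\<close> divides it. Hence \<open>d\<close> divides
    \<open>h\<close>, which is coprime to \<open>t\<close>.\<close>
  have "coprime t L"
  proof -
    let ?d = "gcd t L"
    have "b ^ Suc J dvd m * (h * (L div ?d))"
    proof -
      have "m * (h * (L div ?d)) = b ^ J * (N * (t * (L div ?d)))"
        unfolding \<tau> tg hg by (simp add: mult_ac)
      also have "t * (L div ?d) = L * (t div ?d)"
        by (metis div_mult_swap dvd_div_mult gcd_dvd1 gcd_dvd2 mult.commute)
      finally have "m * (h * (L div ?d)) = b ^ Suc J * (t div ?d)" by (simp add: b_def mult_ac)
      then show ?thesis by simp
    qed
    then have "q (Suc J) dvd h * (L div ?d)" by (simp add: q_dvd)
    then have "L dvd h * (L div ?d)" using J1 dvd_trans by blast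
    moreover obtain k where k: "L = ?d * k" using gcd_dvd2 by blast
    moreover have "k > 0" "?d > 0" using k L by (auto intro: gr0I)
    ultimately have "?d * k dvd h * k" by (metis nonzero_mult_div_cancel_left neq0_conv)
    then have "?d dvd h" using \<open>k > 0\<close> by simp
    then show ?thesis using cop by (metis coprime_common_divisor gcd_dvd1 gcd_nat.refl coprime_iff_gcd_eq_1 is_unit_gcd)
  qed
  moreover have "m * h = N * (N * L) ^ J * t" unfolding \<tau> tg b_def[symmetric] hg by (simp add: mult_ac)
  moreover have "coprime h N" using copN by simp
  ultimately show ?thesis using that ht cop by blast
qed

section \<open>Fourier transform and overlaps of self-similar sets\<close>

definition fourier :: "real set \<Rightarrow> real \<Rightarrow> complex" where
  "fourier S \<xi> = (\<integral>x. indicat_real S x *\<^sub>R unit_exp (\<xi> * x) \<partial>lborel)"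

definition overlap :: "real set \<Rightarrow> real \<Rightarrow> real" where
  "overlap S s = (\<integral>x. indicat_real S x * indicat_real S (x - s) \<partial>lborel)"

lemma integrable_indicator_compact:
  fixes S :: "real set"
  assumes "compact S"
  shows "integrable lborel (indicat_real S)"
  using borel_integrable_compact[OF assms, of "\<lambda>_. 1 :: real"] by simp

lemma borel_compact:
  fixes S :: "real set"
  shows "compact S \<Longrightarrow> S \<in> sets borel"
  by (simp add: compact_imp_closed)

lemma integrable_unit_exp_compact:
  assumes "compact S"
  shows "integrable lborel (\<lambda>x. indicat_real S x *\<^sub>R unit_exp (\<xi> * x))"
  by (rule borel_integrable_compact[OF assms]) (intro continuous_intros)

lemma fourier_0: "fourier S 0 = measure lborel S"
  by (simp add: fourier_def scaleR_conv_of_real)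

lemma integrable_affine_compact:
  fixes S :: "real set"
  assumes "compact S" "c \<noteq> 0"
  shows "integrable lborel (\<lambda>x. indicat_real S (c * x - d))"
  using lborel_integrable_real_affine[OF integrable_indicator_compact[OF assms(1)] assms(2), of "- d"]
  by simp

lemma integral_affine_compact:
  fixes S :: "real set"
  assumes "compact S" "c > 0"
  shows "(\<integral>x. indicat_real S (c * x - d) \<partial>lborel) = measure lborel S / c"
  using lborel_integral_real_affine[of c "indicat_real S" "- d"] assms
  by (simp add: field_simps)

text \<open>Both sides have the same integral, and the left-hand side is dominated by the right-hand side.\<close>

lemma AE_indicator_self_similar:
  assumes S: "is_self_similar_set (1 / real b) D S" and b: "b > 0" and D: "finite D" "card D \<le> b"
  shows "AE x in lborel. indicat_real S x = (\<Sum>d\<in>D. indicat_real S (real b * x - d))"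
proof -
  have comp: "compact S" and eq: "S = (\<Union>\<delta>\<in>D. (\<lambda>x. (1 / real b) * (x + \<delta>)) ` S)"
    using S by (auto simp only: is_self_similar_set_def)
  note [measurable] = borel_compact[OF comp]
  define g where "g x = (\<Sum>d\<in>D. indicat_real S (real b * x - d)) - indicat_real S x" for x
  have nonneg: "g x \<ge> 0" for x
  proof (cases "x \<in> S")
    case True
    then obtain d y where dy: "d \<in> D" "y \<in> S" "x = (1 / real b) * (y + d)" using eq by blast
    then have "indicat_real S (real b * x - d) = 1" using b by (simp add: indicator_def)
    moreover have "indicat_real S (real b * x - d) \<le> (\<Sum>d\<in>D. indicat_real S (real b * x - d))"
      using dy D by (intro member_le_sum) auto
    ultimately show ?thesis using True by (simp add: g_def)
  qed (simp add: g_def sum_nonneg)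
  have int: "integrable lborel g" unfolding g_def
    using b comp
    by (intro Bochner_Integration.integrable_diff Bochner_Integration.integrable_sum
          integrable_affine_compact integrable_indicator_compact) auto
  have "(\<integral>x. g x \<partial>lborel) = (\<Sum>d\<in>D. measure lborel S / b) - measure lborel S"
    unfolding g_def using b comp
    by (subst Bochner_Integration.integral_diff Bochner_Integration.integral_sum;
        (intro Bochner_Integration.integrable_sum integrable_affine_compact integrable_indicator_compact)?;
        simp add: integral_affine_compact)+
  also have "\<dots> = (real (card D) / real b - 1) * measure lborel S"
    by (simp add: field_simps)
  also have "\<dots> \<le> 0"
    using b D by (intro mult_nonpos_nonneg) (auto simp: field_simps)
  finally have "(\<integral>x. g x \<partial>lborel) \<le> 0" .
  moreover have "(\<integral>x. g x \<partial>lborel) \<ge> 0" using nonneg by (intro integral_nonneg_AE) auto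
  ultimately have "AE x in lborel. g x = 0"
    using integral_nonneg_eq_0_iff_AE[OF int] nonneg by (simp add: order_antisym)
  then show ?thesis by eventually_elim (simp add: g_def)
qed

lemma fourier_self_similar:
  assumes S: "is_self_similar_set (1 / real b) D S" and b: "b > 0" and D: "finite D" "card D \<le> b"
  shows "fourier S (real b * \<xi>) = (\<Sum>d\<in>D. unit_exp (\<xi> * d)) / real b * fourier S \<xi>"
proof -
  have comp: "compact S"
    using S by (auto simp only: is_self_similar_set_def)
  note [measurable] = borel_compact[OF comp]
  let ?f = "\<lambda>d x. unit_exp (\<xi> * d) * (indicat_real S (- d + real b * x) *\<^sub>R unit_exp (\<xi> * (- d + real b * x)))"
  have split: "unit_exp (real b * \<xi> * x) = unit_exp (\<xi> * d) * unit_exp (\<xi> * (- d + real b * x))" for x d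
    by (simp add: algebra_simps flip: unit_exp_add)
  have int: "integrable lborel (?f d)" for d
    using lborel_integrable_real_affine[OF integrable_unit_exp_compact[OF comp, of \<xi>], of "real b" "- d"] b
    by (intro integrable_mult_right) auto
  have "fourier S (real b * \<xi>) = (\<integral>x. (\<Sum>d\<in>D. ?f d x) \<partial>lborel)"
    unfolding fourier_def
  proof (rule integral_cong_AE)
    show "AE x in lborel. indicat_real S x *\<^sub>R unit_exp (real b * \<xi> * x) = (\<Sum>d\<in>D. ?f d x)"
      using AE_indicator_self_similar[OF assms]
    proof eventually_elim
      case (elim x)
      have "indicat_real S (real b * x - d) *\<^sub>R unit_exp (real b * \<xi> * x) = ?f d x" for d
        by (subst split[of x d]) simp
      then show ?case by (simp only: elim scaleR_sum_left)
    qed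
  qed measurable
  also have "\<dots> = (\<Sum>d\<in>D. \<integral>x. ?f d x \<partial>lborel)"
    using int by (intro Bochner_Integration.integral_sum)
  also have "\<dots> = (\<Sum>d\<in>D. unit_exp (\<xi> * d) * (fourier S \<xi> / real b))"
  proof (intro sum.cong refl)
    fix d
    have "fourier S \<xi> = real b *\<^sub>R (\<integral>x. indicat_real S (- d + real b * x) *\<^sub>R unit_exp (\<xi> * (- d + real b * x)) \<partial>lborel)"
      unfolding fourier_def using b by (subst lborel_integral_real_affine[of "real b" _ "- d"]) auto
    then show "(\<integral>x. ?f d x \<partial>lborel) = unit_exp (\<xi> * d) * (fourier S \<xi> / real b)"
      using b by (simp add: scaleR_conv_of_real)
  qed
  also have "\<dots> = (\<Sum>d\<in>D. unit_exp (\<xi> * d)) / real b * fourier S \<xi>"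
    by (simp add: sum_divide_distrib sum_distrib_right)
  finally show ?thesis .
qed

text \<open>The indicator identity is inserted into both factors of the autocorrelation. For integer
  digits and integer \<open>s\<close> all shifts on the right are integers again, so the overlaps of
  integer translates satisfy a closed linear relation.\<close>

lemma overlap_self_similar:
  assumes S: "is_self_similar_set (1 / real b) D S" and b: "b > 0" and D: "finite D" "card D \<le> b"
  shows "real b * overlap S s = (\<Sum>d\<in>D. \<Sum>d'\<in>D. overlap S (real b * s + d' - d))"
proof -
  have comp: "compact S"
    using S by (auto simp only: is_self_similar_set_def)
  note [measurable] = borel_compact[OF comp]
  let ?g = "\<lambda>t x. indicat_real S x * indicat_real S (x - t)"
  let ?f = "\<lambda>d d' x. ?g (real b * s + d' - d) (- d + real b * x)"
  have g: "integrable lborel (?g t)" for t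
    by (rule Bochner_Integration.integrable_bound[OF integrable_indicator_compact[OF comp]])
       (auto simp: indicator_def)
  have int: "integrable lborel (?f d d')" for d d'
    using lborel_integrable_real_affine[OF g[of "real b * s + d' - d"], of "real b" "- d"] b by auto
  have AE1: "AE x in lborel. indicat_real S x = (\<Sum>d\<in>D. indicat_real S (real b * x - d))"
    by (rule AE_indicator_self_similar[OF assms])
  have AE2: "AE x in lborel. indicat_real S (- s + 1 * x) = (\<Sum>d\<in>D. indicat_real S (real b * (- s + 1 * x) - d))"
    by (rule AE_borel_affine[OF _ _ AE1]) auto
  have "overlap S s = (\<integral>x. (\<Sum>d\<in>D. \<Sum>d'\<in>D. ?f d d' x) \<partial>lborel)"
    unfolding overlap_def
  proof (rule integral_cong_AE)
    show "AE x in lborel. indicat_real S x * indicat_real S (x - s) = (\<Sum>d\<in>D. \<Sum>d'\<in>D. ?f d d' x)"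
      using AE1 AE2
    proof eventually_elim
      case (elim x)
      have "indicat_real S x * indicat_real S (x - s) =
         (\<Sum>d\<in>D. indicat_real S (real b * x - d)) * (\<Sum>d\<in>D. indicat_real S (real b * (- s + 1 * x) - d))"
        using elim by simp
      also have "\<dots> = (\<Sum>d\<in>D. \<Sum>d'\<in>D. ?f d d' x)"
        by (simp add: sum_product algebra_simps)
      finally show ?case .
    qed
  qed measurable
  also have "\<dots> = (\<Sum>d\<in>D. \<Sum>d'\<in>D. \<integral>x. ?f d d' x \<partial>lborel)"
    using int by (simp add: Bochner_Integration.integral_sum)
  also have "\<dots> = (\<Sum>d\<in>D. \<Sum>d'\<in>D. overlap S (real b * s + d' - d) / real b)"
  proof (intro sum.cong refl)
    fix d d'
    have "overlap S (real b * s + d' - d) = real b *\<^sub>R (\<integral>x. ?f d d' x \<partial>lborel)"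
      unfolding overlap_def using b by (subst lborel_integral_real_affine[of "real b" _ "- d"]) auto
    then show "(\<integral>x. ?f d d' x \<partial>lborel) = overlap S (real b * s + d' - d) / real b"
      using b by simp
  qed
  also have "\<dots> = (\<Sum>d\<in>D. \<Sum>d'\<in>D. overlap S (real b * s + d' - d)) / real b"
    by (simp add: sum_divide_distrib)
  finally show ?thesis using b by simp
qed

lemma overlap_nonneg: "overlap S s \<ge> 0"
  unfolding overlap_def by (intro integral_nonneg_AE) auto

lemma overlap_eq_measure:
  assumes "compact S"
  shows "overlap S s = measure lborel (S \<inter> (+) s ` S)"
proof -
  have [measurable]: "S \<in> sets borel" "(+) s ` S \<in> sets borel"
    using assms compact_translation[OF assms, of s] by (auto intro: borel_compact)
  have "overlap S s = (\<integral>x. indicat_real (S \<inter> (+) s ` S) x \<partial>lborel)"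
    unfolding overlap_def
    by (intro Bochner_Integration.integral_cong) (auto simp: indicator_def image_iff algebra_simps)
  then show ?thesis by simp
qed

text \<open>Shifting \<open>S\<close> by half a period of the exponential changes the sign of the Fourier transform.\<close>

lemma fourier_tendsto_0_at_top:
  assumes comp: "compact S"
  shows "(fourier S \<longlongrightarrow> 0) at_top"
proof (rule tendstoI)
  fix \<epsilon> :: real assume \<epsilon>: "\<epsilon> > 0"
  note [measurable] = borel_compact[OF comp]
  \<comment> \<open>For small \<open>s\<close> both \<open>S\<close> and its shift by
    \<open>s\<close> lie in \<open>U\<close>, so their symmetric difference has measure at most
    twice that of \<open>U - S\<close>. This bounds \<open>2 * fourier S \<xi>\<close>.\<close>
  obtain U where U: "open U" "S \<subseteq> U" "emeasure lborel (U - S) < ennreal \<epsilon>"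
    using outer_regular_lborel[of S \<epsilon>] \<epsilon> by (auto simp: borel_compact comp)
  have [measurable]: "U \<in> sets borel" using U by auto
  have finU: "emeasure lborel U < \<infinity>"
  proof -
    have "emeasure lborel U \<le> emeasure lborel S + emeasure lborel (U - S)"
      using emeasure_subadditive[of S lborel "U - S"] U(2) by (simp add: Un_absorb1)
    also have "\<dots> < \<infinity>"
      using order.strict_trans[OF U(3) ennreal_less_top] emeasure_compact_finite[OF comp]
      by (auto simp: ennreal_add_less_top)
    finally show ?thesis .
  qed
  have mU: "measure lborel U < measure lborel S + \<epsilon>"
  proof -
    have "measure lborel (U - S) = measure lborel U - measure lborel S"
      using finU U(2) by (intro measure_Diff) auto
    moreover have "measure lborel (U - S) < \<epsilon>"
      using U(3) \<epsilon> by (simp add: measure_def enn2real_less_iff less_le_trans top.not_eq_extremum)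
    ultimately show ?thesis by simp
  qed
  obtain \<delta> where \<delta>: "\<delta> > 0" "\<And>x s. x \<in> S \<Longrightarrow> \<bar>s\<bar> < \<delta> \<Longrightarrow> x + s \<in> U"
  proof (cases "S = {}")
    case False
    obtain e where "e > 0" "(\<Union>x\<in>S. ball x e) \<subseteq> U"
      using compact_subset_open_imp_ball_epsilon_subset[OF comp U(1,2)] by auto
    then show ?thesis using that[of e] by (force simp: dist_real_def)
  qed (use that[of 1] in auto)
  have "norm (fourier S \<xi>) < \<epsilon>" if \<xi>: "\<xi> > 1 / \<delta>" for \<xi>
  proof -
    define s where "s = 1 / (2 * \<xi>)"
    have \<xi>0: "\<xi> > 0" using \<xi> \<delta> by (auto intro: less_trans[of 0 "1/\<delta>"])
    have s: "\<bar>s\<bar> < \<delta>" using \<xi> \<xi>0 \<delta> by (simp add: s_def field_simps)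
    have half: "unit_exp (\<xi> * (x - s)) = - unit_exp (\<xi> * x)" for x
    proof -
      have "\<xi> * (x - s) = \<xi> * x - 1 / 2" using \<xi>0 by (simp add: s_def field_simps)
      moreover have "unit_exp (- (1 / 2)) = -1"
        by (simp add: unit_exp_def complex_eq_iff)
      ultimately show ?thesis using unit_exp_add[of "\<xi> * x" "- (1/2)"] by simp
    qed
    have i1: "integrable lborel (\<lambda>x. indicat_real S (x - s) *\<^sub>R unit_exp (\<xi> * x))"
      using lborel_integrable_real_affine[OF integrable_unit_exp_compact[OF comp, of \<xi>], of 1 "- s"]
      by (simp add: half)
    have i2: "integrable lborel (indicat_real S)" "integrable lborel (indicat_real U)"
      using integrable_indicator_compact[OF comp] finU by auto
    have i3: "integrable lborel (\<lambda>x. indicat_real S (x - s))"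
      "(\<integral>x. indicat_real S (x - s) \<partial>lborel) = measure lborel S"
      using integrable_affine_compact[OF comp, of 1 s] integral_affine_compact[OF comp, of 1 s] by auto
    have "fourier S \<xi> = - (\<integral>x. indicat_real S (x - s) *\<^sub>R unit_exp (\<xi> * x) \<partial>lborel)"
      unfolding fourier_def by (subst lborel_integral_real_affine[of 1 _ "- s"]) (simp_all add: half)
    then have "2 * fourier S \<xi> = (\<integral>x. indicat_real S x *\<^sub>R unit_exp (\<xi> * x) \<partial>lborel)
       - (\<integral>x. indicat_real S (x - s) *\<^sub>R unit_exp (\<xi> * x) \<partial>lborel)"
      unfolding fourier_def by simp
    also have "\<dots> = (\<integral>x. indicat_real S x *\<^sub>R unit_exp (\<xi> * x) - indicat_real S (x - s) *\<^sub>R unit_exp (\<xi> * x) \<partial>lborel)"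
      using i1 integrable_unit_exp_compact[OF comp, of \<xi>] by (simp add: Bochner_Integration.integral_diff)
    finally have eq: "2 * fourier S \<xi> = (\<integral>x. indicat_real S x *\<^sub>R unit_exp (\<xi> * x) - indicat_real S (x - s) *\<^sub>R unit_exp (\<xi> * x) \<partial>lborel)" .
    have "norm (2 * fourier S \<xi>) \<le> (\<integral>x. 2 * indicat_real U x - indicat_real S x - indicat_real S (x - s) \<partial>lborel)"
      unfolding eq
    proof (rule order_trans[OF integral_norm_bound integral_mono])
      fix x
      have "x - s \<in> S \<Longrightarrow> x \<in> U" "x \<in> S \<Longrightarrow> x \<in> U" using \<delta>(2)[of "x - s" s] s U(2) by auto
      then show "norm (indicat_real S x *\<^sub>R unit_exp (\<xi> * x) - indicat_real S (x - s) *\<^sub>R unit_exp (\<xi> * x))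
         \<le> 2 * indicat_real U x - indicat_real S x - indicat_real S (x - s)"
        by (auto simp: indicator_def)
    qed (use i1 i2 i3 integrable_unit_exp_compact[OF comp, of \<xi>] in auto)
    also have "\<dots> = 2 * measure lborel U - 2 * measure lborel S"
      using i2 i3 by (simp add: Bochner_Integration.integral_diff)
    finally show ?thesis using mU by (simp add: norm_mult)
  qed
  then show "\<forall>\<^sub>F x in at_top. dist (fourier S x) 0 < \<epsilon>"
    by (intro eventually_mono[OF eventually_gt_at_top[of "1 / \<delta>"]]) auto
qed

lemma fourier_tendsto_measure:
  assumes comp: "compact S" and b: "b > (1 :: nat)"
  shows "(\<lambda>k. fourier S (\<xi> / real b ^ k)) \<longlonglongrightarrow> measure lborel S"
proof -
  note [measurable] = borel_compact[OF comp]
  have lim: "(\<lambda>k. \<xi> / real b ^ k * x) \<longlonglongrightarrow> 0" for x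
  proof -
    have "(\<lambda>k. \<xi> * x * (1 / real b) ^ k) \<longlonglongrightarrow> \<xi> * x * 0"
      using b by (intro tendsto_intros LIMSEQ_power_zero) auto
    then show ?thesis by (simp add: power_one_over field_simps)
  qed
  have "(\<lambda>k. fourier S (\<xi> / real b ^ k)) \<longlonglongrightarrow> (\<integral>x. indicat_real S x *\<^sub>R (1 :: complex) \<partial>lborel)"
    unfolding fourier_def
  proof (rule integral_dominated_convergence[where w = "indicat_real S"])
    show "AE x in lborel. (\<lambda>k. indicat_real S x *\<^sub>R unit_exp (\<xi> / real b ^ k * x)) \<longlonglongrightarrow> indicat_real S x *\<^sub>R 1"
    proof (intro AE_I2 tendsto_intros)
      fix x
      have "(\<lambda>k. unit_exp (\<xi> / real b ^ k * x)) \<longlonglongrightarrow> unit_exp 0"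
        using lim[of x] by (intro continuous_on_tendsto_compose[of UNIV unit_exp] continuous_intros) auto
      then show "(\<lambda>k. unit_exp (\<xi> / real b ^ k * x)) \<longlonglongrightarrow> 1" by simp
    qed
  qed (use integrable_indicator_compact[OF comp] in auto)
  also have "(\<integral>x. indicat_real S x *\<^sub>R (1 :: complex) \<partial>lborel) = measure lborel S"
    by (simp add: scaleR_conv_of_real)
  finally show ?thesis .
qed

section \<open>Zeros of the Fourier transform and of the mask\<close>

lemma fourier_integer_eq_0:
  assumes S: "is_self_similar_set (1 / real b) D S" and b: "b > 1" and D: "finite D" "card D = b" "D \<subseteq> \<int>"
    and n: "n \<noteq> 0" "n \<in> \<int>"
  shows "fourier S n = 0"
proof -
  have comp: "compact S" using S by (auto simp only: is_self_similar_set_def)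
  have "fourier S m = 0" if m: "m > 0" "m \<in> \<int>" for m
  proof -
    have "fourier S (real b ^ k * m) = fourier S m" for k
    proof (induction k)
      case (Suc k)
      \<comment> \<open>At integer frequencies all exponentials are 1 and \<open>card D = b\<close>,
        so multiplying the frequency by \<open>b\<close> does not change the transform.\<close>
      have "(\<Sum>d\<in>D. unit_exp (real b ^ k * m * d)) = (\<Sum>d\<in>D. 1)"
        using D(3) m by (intro sum.cong refl unit_exp_Ints Ints_mult Ints_power) auto
      then show ?case
        using fourier_self_similar[OF S _ D(1), of "real b ^ k * m"] D(2) b Suc
        by (simp add: mult_ac)
    qed simp
    moreover have "(\<lambda>k. fourier S (real b ^ k * m)) \<longlonglongrightarrow> 0"
    proof (rule filterlim_compose[OF fourier_tendsto_0_at_top[OF comp]])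
      show "filterlim (\<lambda>k. real b ^ k * m) at_top sequentially"
        using b m by (intro filterlim_at_top_mult_tendsto_pos[OF tendsto_const])
          (auto intro!: filterlim_at_infinity_imp_filterlim_at_top filterlim_realpow_sequentially_gt1)
    qed
    ultimately show ?thesis by (simp add: LIMSEQ_const_iff)
  qed
  moreover have "fourier S (- m) = cnj (fourier S m)" for m
    unfolding fourier_def Bochner_Integration.integral_cnj[symmetric]
    by (intro Bochner_Integration.integral_cong) auto
  ultimately have "fourier S n = 0 \<or> cnj (fourier S n) = 0"
    using n by (metis Ints_minus neg_0_less_iff_less linorder_neqE_linordered_idom)
  then show ?thesis by simp
qed

text \<open>If no mask value vanished, the zero of the transform at \<open>n\<close> would propagate
  to all \<open>n / b ^ k\<close>, where the transform tends to
  \<open>measure lborel S > 0\<close>.\<close>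

lemma ex_mask_eq_0:
  assumes S: "is_self_similar_set (1 / real b) D S" and b: "b > 1" and D: "finite D" "card D = b" "D \<subseteq> \<int>"
    and pos: "measure lborel S > 0" and n: "n \<noteq> 0" "n \<in> \<int>"
  obtains i where "(\<Sum>d\<in>D. unit_exp (n / real b ^ Suc i * d)) = 0"
proof -
  have comp: "compact S" using S by (auto simp only: is_self_similar_set_def)
  have "\<exists>i. (\<Sum>d\<in>D. unit_exp (n / real b ^ Suc i * d)) = 0"
  proof (rule ccontr)
    assume *: "\<not> ?thesis"
    have "fourier S (n / real b ^ k) = 0" for k
    proof (induction k)
      case 0
      show ?case using fourier_integer_eq_0[OF S b D n] by simp
    next
      case (Suc k)
      have "fourier S (real b * (n / real b ^ Suc k)) = 0" using Suc b by simp
      then show ?case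
        using fourier_self_similar[OF S _ D(1), of "n / real b ^ Suc k"] D(2) b * by auto
    qed
    then have "(\<lambda>k. 0 :: complex) \<longlonglongrightarrow> measure lborel S"
      using fourier_tendsto_measure[OF comp b, of n] by simp
    then show False using pos by (simp add: LIMSEQ_const_iff)
  qed
  then show ?thesis using that by blast
qed

section \<open>Integer translates for complete residue systems\<close>

definition mask :: "nat \<Rightarrow> int set \<Rightarrow> real \<Rightarrow> complex" where
  "mask b D x = (\<Sum>d\<in>D. unit_exp (x * of_int d)) / of_nat b"

definition trig_sum :: "int \<Rightarrow> (int \<Rightarrow> real) \<Rightarrow> real \<Rightarrow> complex" where
  "trig_sum K v x = (\<Sum>n\<in>{-K..K}. of_real (v n) * unit_exp (x * of_int n))"

lemma mask_mult_cnj: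
  "mask b D x * cnj (mask b D x) = (\<Sum>d\<in>D. \<Sum>d'\<in>D. unit_exp (x * of_int (d - d'))) / (of_nat b)\<^sup>2"
  by (simp add: mask_def sum_product power2_eq_square flip: unit_exp_add) (simp add: algebra_simps)

text \<open>Summing over the \<open>b\<close> preimages of a point keeps only the frequencies
  congruent to some \<open>r\<close>; here they are renamed as \<open>int b * n + r\<close>. Since
  \<open>v\<close> vanishes outside \<open>{-K..K}\<close>, a surplus in \<open>K'\<close> is
  harmless, and one \<open>K'\<close> can serve all \<open>r\<close>.\<close>

lemma sum_residue_class:
  fixes v :: "int \<Rightarrow> real"
  assumes b: "b > 0" and supp: "\<And>n. \<bar>n\<bar> > K \<Longrightarrow> v n = 0" and K': "K + \<bar>r\<bar> \<le> K'"
  shows "(\<Sum>n\<in>{-K..K}. of_real (v n) * unit_exp (x / real b * of_int (n - r)) * (if int b dvd n - r then of_nat b else 0))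
    = of_nat b * (\<Sum>n\<in>{-K'..K'}. of_real (v (int b * n + r)) * unit_exp (x * of_int n))"
proof -
  let ?h = "\<lambda>n. of_real (v n) * unit_exp (x / real b * of_int (n - r))"
  let ?A = "{n\<in>{-K..K}. int b dvd n - r}" and ?B = "(\<lambda>n. int b * n + r) ` {-K'..K'}"
  have "(\<Sum>n\<in>{-K..K}. ?h n * (if int b dvd n - r then of_nat b else 0)) = (\<Sum>n\<in>?A. ?h n * of_nat b)"
    by (subst sum.inter_filter) (auto intro: sum.cong)
  also have "\<dots> = (\<Sum>n\<in>?B. ?h n * of_nat b)"
  proof (rule sum.mono_neutral_left)
    show "?A \<subseteq> ?B"
    proof
      fix n assume n: "n \<in> ?A"
      then obtain k where k: "n - r = int b * k" by auto
      have "\<bar>k\<bar> \<le> \<bar>int b * k\<bar>" using b by (simp add: abs_mult mult_le_cancel_right1)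
      also have "\<dots> \<le> K + \<bar>r\<bar>" using n k by auto
      finally have "k \<in> {-K'..K'}" using K' by auto
      then show "n \<in> ?B" using k by (auto intro!: image_eqI[of _ _ k])
    qed
    show "\<forall>n\<in>?B - ?A. ?h n * of_nat b = 0"
    proof
      fix n assume "n \<in> ?B - ?A"
      then have "v n = 0" by (intro supp) auto
      then show "?h n * of_nat b = 0" by simp
    qed
  qed auto
  also have "\<dots> = (\<Sum>n\<in>{-K'..K'}. ?h (int b * n + r) * of_nat b)"
    using b by (subst sum.reindex) (auto simp: inj_on_def)
  also have "\<dots> = of_nat b * (\<Sum>n\<in>{-K'..K'}. of_real (v (int b * n + r)) * unit_exp (x * of_int n))"
    using b by (simp add: sum_distrib_left mult_ac)
  finally show ?thesis by simp
qed

text \<open>The relation \<open>rel\<close>, read on the Fourier side, is invariance under the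
  transfer operator with weights \<open>|mask|^2\<close>: after expanding the weight as a double sum
  over digits, the sum over \<open>j\<close> kills every frequency not congruent to
  \<open>d' - d\<close>, and what remains agrees with \<open>rel\<close> coefficient by
  coefficient.\<close>

lemma trig_sum_mask:
  assumes b: "b > 0" and D: "finite D" and supp: "\<And>n. \<bar>n\<bar> > K \<Longrightarrow> v n = 0"
    and rel: "\<And>n. real b * v n = (\<Sum>d\<in>D. \<Sum>d'\<in>D. v (int b * n + d' - d))"
  shows "(\<Sum>j<b. of_real ((cmod (mask b D ((x + real j) / real b)))\<^sup>2) * trig_sum K v ((x + real j) / real b))
    = trig_sum K v x"
proof -
  define R where "R = (\<Sum>d\<in>D. \<bar>d\<bar>)"
  have R: "\<bar>d\<bar> \<le> R" if "d \<in> D" for d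
    unfolding R_def using that D by (intro member_le_sum) auto
  define K' where "K' = \<bar>K\<bar> + 2 * R"
  let ?y = "\<lambda>j. (x + real j) / real b"
  let ?e = "\<lambda>d d' n j. of_real (v n) * unit_exp (?y j * of_int (n - (d' - d)))"
  have expand: "of_real ((cmod (mask b D (?y j)))\<^sup>2) * trig_sum K v (?y j)
      = (\<Sum>d\<in>D. \<Sum>d'\<in>D. \<Sum>n\<in>{-K..K}. ?e d d' n j) / (of_nat b)\<^sup>2" for j
  proof -
    have "of_real ((cmod (mask b D (?y j)))\<^sup>2) * trig_sum K v (?y j)
      = (\<Sum>d\<in>D. \<Sum>d'\<in>D. unit_exp (?y j * of_int (d - d'))) * trig_sum K v (?y j) / (of_nat b)\<^sup>2"
      by (simp only: complex_norm_square mask_mult_cnj times_divide_eq_left)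
    also have "(\<Sum>d\<in>D. \<Sum>d'\<in>D. unit_exp (?y j * of_int (d - d'))) * trig_sum K v (?y j)
      = (\<Sum>d\<in>D. \<Sum>d'\<in>D. \<Sum>n\<in>{-K..K}. ?e d d' n j)"
      unfolding sum_distrib_right
    proof (intro sum.cong refl, unfold trig_sum_def sum_distrib_left, intro sum.cong refl)
      fix d d' n
      have "?y j * of_int (n - (d' - d)) = ?y j * of_int (d - d') + ?y j * of_int n"
        by (simp add: algebra_simps diff_divide_distrib add_divide_distrib)
      then show "unit_exp (?y j * of_int (d - d')) * (of_real (v n) * unit_exp (?y j * of_int n)) = ?e d d' n j"
        by (simp add: unit_exp_add)
    qed
    finally show ?thesis .
  qed
  have inner: "(\<Sum>j<b. ?e d d' n j) = of_real (v n) * unit_exp (x / real b * of_int (n - (d' - d)))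
      * (if int b dvd n - (d' - d) then of_nat b else 0)" for d d' n
  proof -
    have "?e d d' n j = of_real (v n) * unit_exp (x / real b * of_int (n - (d' - d)))
       * unit_exp (of_int (n - (d' - d)) * real j / real b)" for j
      unfolding mult.assoc unit_exp_add[symmetric] by (simp add: algebra_simps add_divide_distrib diff_divide_distrib)
    then show ?thesis using sum_unit_exp_div[OF b] by (simp only: sum_distrib_left[symmetric])
  qed
  have "(\<Sum>j<b. of_real ((cmod (mask b D (?y j)))\<^sup>2) * trig_sum K v (?y j))
     = (\<Sum>j<b. \<Sum>d\<in>D. \<Sum>d'\<in>D. \<Sum>n\<in>{-K..K}. ?e d d' n j) / (of_nat b)\<^sup>2"
    by (simp only: expand sum_divide_distrib)
  also have "(\<Sum>j<b. \<Sum>d\<in>D. \<Sum>d'\<in>D. \<Sum>n\<in>{-K..K}. ?e d d' n j)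
     = (\<Sum>d\<in>D. \<Sum>d'\<in>D. \<Sum>n\<in>{-K..K}. \<Sum>j<b. ?e d d' n j)"
    by (subst sum.swap, rule sum.cong[OF refl], subst sum.swap, rule sum.cong[OF refl], subst sum.swap, rule refl)
  also have "\<dots> = (\<Sum>d\<in>D. \<Sum>d'\<in>D. of_nat b * (\<Sum>n\<in>{-K'..K'}. of_real (v (int b * n + (d' - d))) * unit_exp (x * of_int n)))"
  proof (intro sum.cong refl)
    fix d d' assume "d \<in> D" "d' \<in> D"
    then have "K + \<bar>d' - d\<bar> \<le> K'" using R[of d] R[of d'] unfolding K'_def by linarith
    from sum_residue_class[OF b supp this, where x = x]
    show "(\<Sum>n\<in>{-K..K}. \<Sum>j<b. ?e d d' n j)
      = of_nat b * (\<Sum>n\<in>{-K'..K'}. of_real (v (int b * n + (d' - d))) * unit_exp (x * of_int n))"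
      unfolding inner .
  qed
  also have "\<dots> = of_nat b * (\<Sum>n\<in>{-K'..K'}. of_real (\<Sum>d\<in>D. \<Sum>d'\<in>D. v (int b * n + d' - d)) * unit_exp (x * of_int n))"
    by (simp add: sum_distrib_left sum_distrib_right sum.swap[of _ "{-K'..K'}"] add_diff_eq)
  also have "\<dots> = (of_nat b)\<^sup>2 * (\<Sum>n\<in>{-K'..K'}. of_real (v n) * unit_exp (x * of_int n))"
    unfolding rel[symmetric] by (simp add: sum_distrib_left power2_eq_square mult_ac)
  also have "(\<Sum>n\<in>{-K'..K'}. of_real (v n) * unit_exp (x * of_int n)) = trig_sum K v x"
    unfolding trig_sum_def
  proof (rule sum.mono_neutral_right)
    have "R \<ge> 0" by (simp add: R_def sum_nonneg)
    then show "{-K..K} \<subseteq> {-K'..K'}" by (auto simp: K'_def)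
    show "\<forall>n\<in>{-K'..K'} - {-K..K}. of_real (v n) * unit_exp (x * of_int n) = 0"
      using supp by auto
  qed auto
  finally show ?thesis using b by simp
qed

text \<open>The constant 1 is the trigonometric sum of the sequence concentrated at 0. This sequence
  satisfies the relation because the digits are incongruent modulo \<open>b\<close>:
  \<open>int b * n + d' - d\<close> vanishes only for \<open>d' = d\<close> and
  \<open>n = 0\<close>.\<close>

lemma sum_mask_eq_1:
  assumes b: "b > 0" and D: "finite D" "card D = b" "inj_on (\<lambda>d. d mod int b) D"
  shows "(\<Sum>j<b. (cmod (mask b D ((x + real j) / real b)))\<^sup>2) = 1"
proof -
  define v :: "int \<Rightarrow> real" where "v n = (if n = 0 then 1 else 0)" for n
  have rel: "real b * v n = (\<Sum>d\<in>D. \<Sum>d'\<in>D. v (int b * n + d' - d))" for n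
  proof -
    have "(\<Sum>d'\<in>D. v (int b * n + d' - d)) = v n" if d: "d \<in> D" for d
    proof -
      have "v (int b * n + d' - d) = (if d' = d then v n else 0)" if d': "d' \<in> D" for d'
      proof (cases "int b * n + d' - d = 0")
        case True
        then have "d mod int b = (int b * n + d') mod int b" by simp
        then have "d = d'" using D(3) d d' by (auto simp: inj_on_def)
        then show ?thesis using True b by (auto simp: v_def)
      next
        case False
        then show ?thesis by (auto simp: v_def)
      qed
      then have "(\<Sum>d'\<in>D. v (int b * n + d' - d)) = (\<Sum>d'\<in>D. if d' = d then v n else 0)"
        by (intro sum.cong) auto
      then show ?thesis using d D by simp
    qed
    then show ?thesis using D by simp
  qed
  have "complex_of_real (\<Sum>j<b. (cmod (mask b D ((x + real j) / real b)))\<^sup>2) = 1"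
    using trig_sum_mask[OF b D(1), of 0 v x] rel by (simp add: trig_sum_def v_def)
  then show ?thesis using of_real_eq_1_iff by blast
qed

text \<open>Equality in the triangle inequality. Bounding all terms except those of \<open>0\<close>
  and \<open>d\<close> trivially leaves \<open>norm (1 + unit_exp (y * of_int d)) \<ge> 2\<close>,
  which forces a number of modulus 1 to be 1.\<close>

lemma norm_sum_unit_exp_eq_card:
  assumes "finite D" "norm (\<Sum>d\<in>D. unit_exp (y * of_int d)) = card D" "0 \<in> D" "d \<in> D"
  shows "y * of_int d \<in> \<int>"
proof (cases "d = 0")
  case False
  have "(\<Sum>d\<in>D. unit_exp (y * of_int d)) = unit_exp (y * of_int d) + (1 + (\<Sum>d\<in>D - {d} - {0}. unit_exp (y * of_int d)))"
    using assms False by (simp add: sum.remove[of D d] sum.remove[of "D - {d}" 0])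
  then have "real (card D) \<le> norm (1 + unit_exp (y * of_int d)) + norm (\<Sum>d\<in>D - {d} - {0}. unit_exp (y * of_int d))"
    using assms(2) norm_triangle_ineq[of "1 + unit_exp (y * of_int d)" "\<Sum>d\<in>D - {d} - {0}. unit_exp (y * of_int d)"]
    by (simp add: add_ac)
  also have "norm (\<Sum>d\<in>D - {d} - {0}. unit_exp (y * of_int d)) \<le> (\<Sum>d\<in>D - {d} - {0}. 1)"
    by (rule sum_norm_le) simp
  also have "(\<Sum>d\<in>D - {d} - {0}. 1 :: real) = real (card D) - 2"
  proof -
    have "card {d, 0} \<le> card D" using assms by (intro card_mono) auto
    then show ?thesis using assms False by (simp add: of_nat_diff)
  qed
  finally have "norm (1 + unit_exp (y * of_int d)) \<ge> 2" by simp
  then have "(norm (1 + unit_exp (y * of_int d)))\<^sup>2 \<ge> 2\<^sup>2" by (rule power_mono) simp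
  moreover have "(norm (1 + unit_exp (y * of_int d)))\<^sup>2 = 2 + 2 * Re (unit_exp (y * of_int d))"
  proof -
    have "(Re (unit_exp (y * of_int d)))\<^sup>2 + (Im (unit_exp (y * of_int d)))\<^sup>2 = 1"
      using norm_unit_exp[of "y * of_int d"] by (simp add: cmod_power2[symmetric])
    then show ?thesis by (simp add: cmod_power2 power2_sum)
  qed
  ultimately have "Re (unit_exp (y * of_int d)) \<ge> 1" by simp
  then have re: "Re (unit_exp (y * of_int d)) = 1"
    using complex_Re_le_cmod[of "unit_exp (y * of_int d)"] by simp
  then have "(Im (unit_exp (y * of_int d)))\<^sup>2 = 0"
    using cmod_power2[of "unit_exp (y * of_int d)"] by simp
  then have "unit_exp (y * of_int d) = 1" using re by (simp add: complex_eq_iff)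
  then show ?thesis by (simp add: unit_exp_eq_1_iff)
qed simp

lemma Re_trig_sum: "Re (trig_sum K v x) = (\<Sum>n\<in>{-K..K}. v n * cos (2 * pi * (x * of_int n)))"
  by (simp add: trig_sum_def unit_exp_def)

text \<open>Twice the real part is the sum of the \<open>v n * (z^n + z^(-n))\<close> with
  \<open>z = unit_exp x\<close>. Multiplied by \<open>z^K\<close>, the level equation becomes
  polynomial in \<open>z\<close>, and \<open>x0\<close> shows that the polynomial is not
  zero.\<close>

lemma finite_level_set_trig_sum:
  assumes "Re (trig_sum K v x0) \<noteq> c" "K \<ge> 0"
  shows "finite {x\<in>{0..<1}. Re (trig_sum K v x) = c}"
proof -
  define P :: "complex poly" where "P = (\<Sum>n\<in>{-K..K}. smult (of_real (v n)) (monom 1 (nat (K + n)) + monom 1 (nat (K - n))))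
      - monom (of_real (2 * c)) (nat K)"
  have P: "poly P (unit_exp x) = unit_exp (of_int K * x) * of_real (2 * (Re (trig_sum K v x) - c))" for x
  proof -
    have pow: "unit_exp x ^ nat m = unit_exp (of_int m * x)" if "m \<ge> 0" for m
      using that by (simp add: unit_exp_power)
    have "poly P (unit_exp x) = (\<Sum>n\<in>{-K..K}. of_real (v n) * (unit_exp (of_int K * x) * (unit_exp (x * of_int n) + unit_exp (- (x * of_int n)))))
        - of_real (2 * c) * unit_exp (of_int K * x)"
      unfolding P_def using assms(2)
      by (simp add: poly_sum poly_monom pow) (simp add: algebra_simps unit_exp_add unit_exp_diff)
    also have "(\<Sum>n\<in>{-K..K}. of_real (v n) * (unit_exp (of_int K * x) * (unit_exp (x * of_int n) + unit_exp (- (x * of_int n)))))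
       = unit_exp (of_int K * x) * of_real (2 * Re (trig_sum K v x))"
    proof -
      have "unit_exp y + unit_exp (- y) = of_real (2 * cos (2 * pi * y))" for y
        by (simp add: unit_exp_def complex_eq_iff)
      then show ?thesis
        by (simp add: Re_trig_sum sum_distrib_left mult_ac)
    qed
    finally show ?thesis by (simp add: algebra_simps)
  qed
  have "P \<noteq> 0" using P[of x0] assms by auto
  then have "finite {z. poly P z = 0}" by (rule poly_roots_finite)
  moreover have "unit_exp ` {x\<in>{0..<1}. Re (trig_sum K v x) = c} \<subseteq> {z. poly P z = 0}"
    by (auto simp: P)
  moreover have "inj_on unit_exp {x\<in>{0..<1}. Re (trig_sum K v x) = c}"
  proof (rule inj_onI)
    fix x y assume xy: "x \<in> {x\<in>{0..<1}. Re (trig_sum K v x) = c}" "y \<in> {x\<in>{0..<1}. Re (trig_sum K v x) = c}"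
      and "unit_exp x = unit_exp y"
    then have "x - y \<in> \<int>" by (simp add: unit_exp_eq_iff)
    moreover have "\<bar>x - y\<bar> < 1" using xy by auto
    ultimately show "x = y" by (metis Ints_nonzero_abs_less1 eq_iff_diff_eq_0)
  qed
  ultimately show ?thesis by (meson finite_imageD finite_subset)
qed

text \<open>A nonnegative solution of the relation for the overlaps of the integer translates of a
  self-similar set: the associated trigonometric polynomial is invariant under a transfer
  operator, whose weights sum to \<open>1\<close>. The set of its minimizers modulo \<open>1\<close> is finite and closed
  under preimages of positive weight, which forces weight \<open>1\<close> at each minimizer; by the coprimality
  of the digits only \<open>0\<close> remains. As \<open>0\<close> is also the maximizer, the polynomial is constant.\<close>

lemma overlap_relation_trivial:
  fixes v :: "int \<Rightarrow> real"
  assumes b: "b > 0" and D: "finite D" "card D = b" "inj_on (\<lambda>d. d mod int b) D" "0 \<in> D"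
    and cop: "\<And>y :: real. (\<And>d. d \<in> D \<Longrightarrow> y * of_int d \<in> \<int>) \<Longrightarrow> y \<in> \<int>"
    and nonneg: "\<And>n. v n \<ge> 0" and supp: "\<And>n. \<bar>n\<bar> > K \<Longrightarrow> v n = 0"
    and rel: "\<And>n. real b * v n = (\<Sum>d\<in>D. \<Sum>d'\<in>D. v (int b * n + d' - d))"
    and n: "n \<noteq> 0"
  shows "v n = 0"
proof (cases "\<bar>n\<bar> > K")
  case False
  then have K: "K \<ge> 0" by simp
  define q where "q x = Re (trig_sum K v x)" for x
  define w where "w x = (cmod (mask b D x))\<^sup>2" for x
  have q: "q x = (\<Sum>n\<in>{-K..K}. v n * cos (2 * pi * (x * of_int n)))" for x
    by (simp add: q_def Re_trig_sum)
  have q_step: "(\<Sum>j<b. w ((x + real j) / real b) * q ((x + real j) / real b)) = q x" for x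
    using arg_cong[OF trig_sum_mask[OF b D(1) supp rel, where x = x], where f = Re]
    unfolding q_def w_def by (simp del: of_real_power)
  have w_sum: "(\<Sum>j<b. w ((x + real j) / real b)) = 1" for x
    unfolding w_def by (rule sum_mask_eq_1[OF b D(1-3)])
  have w_nonneg: "w x \<ge> 0" for x by (simp add: w_def)
  have w_le_1: "w x \<le> 1" for x
  proof -
    have "norm (\<Sum>d\<in>D. unit_exp (x * of_int d)) \<le> (\<Sum>d\<in>D. 1)" by (rule sum_norm_le) simp
    then have "cmod (mask b D x) \<le> 1" using b D by (simp add: mask_def norm_divide)
    then show ?thesis by (simp add: w_def power_le_one)
  qed
  have w_eq_1: "y \<in> \<int>" if "w y = 1" for y
  proof -
    have "cmod (mask b D y) = 1" using that power2_eq_imp_eq[of "cmod (mask b D y)" 1] by (simp add: w_def)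
    then have "norm (\<Sum>d\<in>D. unit_exp (y * of_int d)) = card D" using b D by (simp add: mask_def norm_divide)
    from norm_sum_unit_exp_eq_card[OF D(1) this D(4)] show ?thesis by (rule cop)
  qed
  have q_periodic: "q (x + of_int m) = q x" for x m
    unfolding q_def trig_sum_def
    by (intro arg_cong[where f = Re] sum.cong refl)
       (simp add: distrib_right unit_exp_add)
  have cont: "continuous_on {0..1} q" unfolding q by (intro continuous_intros)
  obtain x0 where x0: "x0 \<in> {0..1}" "\<And>x. x \<in> {0..1} \<Longrightarrow> q x0 \<le> q x"
    using continuous_attains_inf[OF _ _ cont] by auto
  have min: "q x0 \<le> q x" for x
  proof -
    have "q x = q (frac x)" using q_periodic[of "frac x" "\<lfloor>x\<rfloor>"] by (simp add: frac_def)
    then show ?thesis using x0(2)[of "frac x"] frac_lt_1[of x] by (simp add: less_imp_le)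
  qed
  define Z where "Z = {x\<in>{0..<1}. q x = q x0}"
  have "q 0 = q x0"
  proof (rule ccontr)
    assume neq: "q 0 \<noteq> q x0"
    then have fin: "finite Z" unfolding Z_def q_def using K by (intro finite_level_set_trig_sum) (auto simp: q_def)
    have "frac x0 \<in> Z"
      using q_periodic[of "frac x0" "\<lfloor>x0\<rfloor>"] by (simp add: Z_def frac_def frac_lt_1 frac_ge_0) (use frac_lt_1 in \<open>simp add: frac_def\<close>)
    have step: "w ((x + real j) / real b) = 0 \<or> (x + real j) / real b \<in> Z" if x: "x \<in> Z" and j: "j < b" for x j
    proof -
      let ?y = "\<lambda>j. (x + real j) / real b"
      \<comment> \<open>\<open>q x\<close> is a convex combination of the values at the preimages;
        as it is the minimum, each preimage of positive weight is a minimizer too.\<close>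
      have "(\<Sum>j<b. w (?y j) * (q (?y j) - q x0)) = q x - q x0"
        using q_step[of x] w_sum[of x] by (simp add: right_diff_distrib sum_subtractf flip: sum_distrib_right)
      also have "\<dots> = 0" using x by (simp add: Z_def)
      finally have "w (?y j) * (q (?y j) - q x0) = 0"
        using min w_nonneg j by (subst (asm) sum_nonneg_eq_0_iff) auto
      moreover have "?y j \<in> {0..<1}"
      proof -
        have "x < 1" "0 \<le> x" using x by (auto simp: Z_def)
        moreover have "real j \<le> real b - 1" using j by linarith
        ultimately show ?thesis using b by (auto simp: field_simps)
      qed
      ultimately show ?thesis by (auto simp: Z_def)
    qed
    let ?A = "Z \<times> {..<b}" and ?f = "\<lambda>(x, j). (x + real j) / real b"
    have inj: "inj_on ?f ?A"
    proof (rule inj_onI, clarify)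
      fix x j x' j' assume x: "x \<in> Z" "x' \<in> Z" "(x + real j) / real b = (x' + real j') / real b"
      then have eq: "x + real j = x' + real j'" using b by simp
      then have "\<bar>real j - real j'\<bar> < 1" using x by (auto simp: Z_def)
      then have "j = j'" by linarith
      then show "x = x' \<and> j = j'" using eq by simp
    qed
    \<comment> \<open>Double counting: the total weight \<open>card Z\<close> falls on pairwise
      distinct preimages, and only on those in \<open>Z\<close>. So \<open>card Z\<close> is at most
      the sum of \<open>w\<close> over \<open>Z\<close>, and \<open>w \<le> 1\<close> forces
      equality at each point.\<close>
    have "real (card Z) = (\<Sum>x\<in>Z. \<Sum>j<b. w ((x + real j) / real b))"
      by (simp add: w_sum)
    also have "\<dots> = (\<Sum>y\<in>?f ` ?A. w y)"
      by (subst sum.reindex[OF inj]) (simp add: sum.cartesian_product case_prod_unfold)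
    also have "\<dots> = (\<Sum>y\<in>?f ` ?A \<inter> Z. w y)"
      using fin step by (intro sum.mono_neutral_right) auto
    also have "\<dots> \<le> (\<Sum>y\<in>Z. w y)"
      using fin w_nonneg by (intro sum_mono2) auto
    finally have "(\<Sum>y\<in>Z. 1 - w y) \<le> 0" by (simp add: sum_subtractf)
    then have "(\<Sum>y\<in>Z. 1 - w y) = 0" using w_le_1 by (intro antisym sum_nonneg) auto
    then have "\<forall>y\<in>Z. 1 - w y = 0" using fin w_le_1 by (subst (asm) sum_nonneg_eq_0_iff) auto
    then have "w (frac x0) = 1" using \<open>frac x0 \<in> Z\<close> by auto
    then have "frac x0 \<in> \<int>" by (rule w_eq_1)
    then have "frac x0 = 0" using frac_lt_1[of x0] frac_ge_0[of x0] by (metis Ints_nonzero_abs_less1 abs_of_nonneg)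
    with \<open>frac x0 \<in> Z\<close> have "0 \<in> Z" by (simp only:)
    then show False using neq by (simp add: Z_def)
  qed
  \<comment> \<open>At \<open>1 / (2 n)\<close> the cosine of frequency \<open>n\<close> is -1,
    while all other terms \<open>v k * (1 - cos ...)\<close> are nonnegative.\<close>
  then have "q 0 \<le> q (1 / (2 * of_int n))" using min by simp
  then have "(\<Sum>k\<in>{-K..K}. v k * (1 - cos (2 * pi * (1 / (2 * of_int n) * of_int k)))) \<le> 0"
    unfolding q by (simp add: right_diff_distrib sum_subtractf)
  moreover have "v n * (1 - cos (2 * pi * (1 / (2 * of_int n) * of_int n)))
     \<le> (\<Sum>k\<in>{-K..K}. v k * (1 - cos (2 * pi * (1 / (2 * of_int n) * of_int k))))"
    using False nonneg by (intro member_le_sum) auto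
  moreover have "cos (2 * pi * (1 / (2 * of_int n) * of_int n)) = -1" using n by simp
  ultimately have "v n * 2 \<le> 0" by simp
  then show ?thesis using nonneg[of n] by simp
qed (simp add: supp)

section \<open>Tiling by integer translates\<close>

text \<open>Compactness leaves only finitely many integer overlaps nonzero, so
  \<open>overlap_relation_trivial\<close> applies to the relation of
  \<open>overlap_self_similar\<close> read at integers.\<close>

lemma null_inter_int_translate:
  assumes S: "is_self_similar_set (1 / real b) (of_int ` D) S" and b: "b > 0"
    and D: "finite D" "card D = b" "inj_on (\<lambda>d. d mod int b) D" "0 \<in> D"
    and cop: "\<And>y :: real. (\<And>d. d \<in> D \<Longrightarrow> y * of_int d \<in> \<int>) \<Longrightarrow> y \<in> \<int>"
    and n: "n \<noteq> (0 :: int)"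
  shows "S \<inter> (+) (of_int n) ` S \<in> null_sets lborel"
proof -
  have comp: "compact S" using S by (auto simp only: is_self_similar_set_def)
  obtain R where R: "\<And>x. x \<in> S \<Longrightarrow> \<bar>x\<bar> \<le> R"
    using compact_imp_bounded[OF comp] unfolding bounded_iff by auto
  define K where "K = \<lceil>2 * R\<rceil>"
  define v where "v k = overlap S (of_int k)" for k :: int
  have inj: "inj_on (of_int :: int \<Rightarrow> real) D" by (auto simp: inj_on_def)
  have card: "card (of_int ` D :: real set) \<le> b" using D(2) card_image[OF inj] by simp
  have "v n = 0"
  proof (rule overlap_relation_trivial[OF b D cop _ _ _ n])
    show "v k \<ge> 0" for k by (simp add: v_def overlap_nonneg)
    show "v k = 0" if "\<bar>k\<bar> > K" for k
    proof -
      have "S \<inter> (+) (of_int k) ` S = {}"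
      proof (rule ccontr)
        assume "\<not> ?thesis"
        then obtain x where x: "x \<in> S" "of_int k + x \<in> S" by auto
        have "\<bar>of_int k :: real\<bar> \<le> \<bar>of_int k + x\<bar> + \<bar>x\<bar>" by simp
        also have "\<dots> \<le> 2 * R" using R[OF x(1)] R[OF x(2)] by simp
        also have "\<dots> \<le> of_int K" by (simp add: K_def)
        finally show False using that by linarith
      qed
      then show ?thesis by (simp add: v_def overlap_eq_measure[OF comp])
    qed
    show "real b * v k = (\<Sum>d\<in>D. \<Sum>d'\<in>D. v (int b * k + d' - d))" for k
      using overlap_self_similar[OF S b _ card, of "of_int k"] D(1)
      by (simp add: sum.reindex[OF inj] v_def)
  qed auto
  then have "measure lborel (S \<inter> (+) (of_int n) ` S) = 0"
    by (simp add: v_def overlap_eq_measure[OF comp])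
  moreover have c: "compact (S \<inter> (+) (of_int n) ` S)"
    using comp by (intro compact_Int compact_translation)
  then have "emeasure lborel (S \<inter> (+) (of_int n) ` S) < \<infinity>"
    by (rule emeasure_compact_finite)
  ultimately show ?thesis
    using borel_compact[OF c] by (auto simp: null_sets_def emeasure_eq_ennreal_measure)
qed

text \<open>The set \<open>W\<close> of all \<open>s + n\<close> is closed, being the sum of a
  compact and a closed set, and complete residues make it stable under
  \<open>w \<mapsto> (w + n) / b\<close>. Hence it contains all \<open>(w0 + n) / b^k\<close>, and
  these approximate every real number.\<close>

lemma int_translates_cover:
  assumes S: "is_self_similar_set (1 / real b) (of_int ` D) S" and b: "b > 1"
    and D: "\<And>n. \<exists>d\<in>D. n mod int b = d mod int b"
  obtains s n where "s \<in> S" "x = s + of_int n"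
proof -
  have comp: "compact S" and ne: "S \<noteq> {}"
    and eq: "S = (\<Union>\<delta>\<in>of_int ` D. (\<lambda>x. 1 / real b * (x + \<delta>)) ` S)"
    using S by (auto simp only: is_self_similar_set_def)
  define W where "W = (\<Union>s\<in>S. \<Union>n\<in>\<int>. {s + n})"
  have W: "w \<in> W \<longleftrightarrow> (\<exists>s\<in>S. \<exists>n. w = s + of_int n)" for w
    unfolding W_def Ints_def by auto
  have "closed W"
    unfolding W_def by (rule compact_closed_sums[OF comp]) simp
  have step: "(w + of_int n) / real b \<in> W" if w_in: "w \<in> W" for w n
  proof -
    obtain s k where w: "s \<in> S" "w = s + of_int k" using w_in by (auto simp: W)
    obtain d where d: "d \<in> D" "(k + n) mod int b = d mod int b" using D by blast
    then obtain k' where k': "k + n = d + int b * k'" by (metis mod_eqE add.commute diff_add_cancel mult.commute)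
    have "1 / real b * (s + of_int d) \<in> S" using eq w(1) d(1) by blast
    moreover have "(w + of_int n) / real b = 1 / real b * (s + of_int d) + of_int k'"
    proof -
      have "(of_int (k + n) :: real) = of_int (d + int b * k')" by (simp only: k')
      then have "w + of_int n = s + of_int d + real b * of_int k'" using w(2) by simp
      then show ?thesis using b by (simp add: field_simps)
    qed
    ultimately show ?thesis unfolding W by (intro bexI exI)
  qed
  obtain w0 where "w0 \<in> W" using ne by (auto simp: W)
  have pow: "(w + of_int n) / real b ^ k \<in> W" if "w \<in> W" for w n k
    using that
  proof (induction k arbitrary: w n)
    case 0
    then obtain s k where "s \<in> S" "w = s + of_int k" by (auto simp: W)
    then have "w + of_int n = s + of_int (k + n)" by simp
    then show ?case using \<open>s \<in> S\<close> unfolding W power_0 div_by_1 by blast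
  next
    case (Suc k)
    from step[OF Suc.IH[OF Suc.prems, of n], of 0] show ?case by (simp add: field_simps)
  qed
  have lim: "(\<lambda>k. (w0 + of_int \<lfloor>real b ^ k * x\<rfloor>) / real b ^ k) \<longlonglongrightarrow> x"
  proof (rule LIM_zero_cancel, rule Lim_null_comparison)
    show "\<forall>\<^sub>F k in sequentially. norm ((w0 + of_int \<lfloor>real b ^ k * x\<rfloor>) / real b ^ k - x) \<le> (\<bar>w0\<bar> + 1) * (1 / real b) ^ k"
    proof (intro always_eventually allI)
      fix k
      have "\<bar>w0 + of_int \<lfloor>real b ^ k * x\<rfloor> - real b ^ k * x\<bar> \<le> \<bar>w0\<bar> + 1" by linarith
      then have "\<bar>w0 + of_int \<lfloor>real b ^ k * x\<rfloor> - real b ^ k * x\<bar> / real b ^ k \<le> (\<bar>w0\<bar> + 1) / real b ^ k"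
        by (rule divide_right_mono) simp
      moreover have "(w0 + of_int \<lfloor>real b ^ k * x\<rfloor>) / real b ^ k - x
         = (w0 + of_int \<lfloor>real b ^ k * x\<rfloor> - real b ^ k * x) / real b ^ k"
        using b by (simp add: field_simps)
      ultimately show "norm ((w0 + of_int \<lfloor>real b ^ k * x\<rfloor>) / real b ^ k - x) \<le> (\<bar>w0\<bar> + 1) * (1 / real b) ^ k"
        by (simp add: abs_divide power_one_over field_simps)
    qed
    have "(\<lambda>k. (\<bar>w0\<bar> + 1) * (1 / real b) ^ k) \<longlonglongrightarrow> (\<bar>w0\<bar> + 1) * 0"
      using b by (intro tendsto_intros LIMSEQ_power_zero) auto
    then show "(\<lambda>k. (\<bar>w0\<bar> + 1) * (1 / real b) ^ k) \<longlonglongrightarrow> 0" by simp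
  qed
  have "x \<in> W"
    using pow[OF \<open>w0 \<in> W\<close>] by (intro closed_sequentially[OF \<open>closed W\<close> _ lim]) auto
  then show ?thesis using that by (auto simp: W)
qed

section \<open>Digit expansions of finite level\<close>

primrec level_sums :: "nat \<Rightarrow> nat \<Rightarrow> nat \<Rightarrow> int set" where
  "level_sums L b 0 = {0}"
| "level_sums L b (Suc J) = (\<lambda>(c, f). int c + int b * f) ` ({..<L} \<times> level_sums L b J)"

text \<open>The complement of the finite factor: digits below \<open>N\<close> in the
  \<open>J\<close> lowest places and an arbitrary integer above them. Divided by \<open>h\<close>,
  these become the translations of the tile.\<close>

primrec level_gaps :: "nat \<Rightarrow> nat \<Rightarrow> nat \<Rightarrow> int set" where
  "level_gaps N b 0 = UNIV"
| "level_gaps N b (Suc J) = (\<lambda>(a, g). int a + int b * g) ` ({..<N} \<times> level_gaps N b J)"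

text \<open>The sums of \<open>d_i / (L b^i)\<close> over \<open>i < J\<close> with
  \<open>d_i < L\<close>. Place by place, the \<open>d / L\<close> are the frequencies of the
  discrete Fourier transform on the digits below \<open>L\<close>.\<close>

primrec level_freqs :: "nat \<Rightarrow> nat \<Rightarrow> nat \<Rightarrow> real set" where
  "level_freqs L b 0 = {0}"
| "level_freqs L b (Suc J) = (\<lambda>(d, \<beta>). real d / real L + \<beta> / real b) ` ({..<L} \<times> level_freqs L b J)"

lemma finite_level_sums: "finite (level_sums L b J)"
  by (induction J) auto

lemma finite_level_freqs: "finite (level_freqs L b J)"
  by (induction J) auto

lemma zero_in_level_freqs: "L > 0 \<Longrightarrow> 0 \<in> level_freqs L b J"
  by (induction J) (auto intro!: image_eqI[of _ _ "(0, 0)"])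

text \<open>The similarity of \<open>S\<close> adds a digit at the lowest place, as the recursion
  does, whereas \<open>digit_set\<close> contributes its digit at place \<open>J\<close>; comparing
  the two requires both forms.\<close>

lemma level_sums_Suc_right:
  "level_sums L b (Suc J) = (\<lambda>(f, c). f + int b ^ J * int c) ` (level_sums L b J \<times> {..<L})"
proof (induction J)
  case 0
  show ?case by (force simp: image_iff)
next
  case (Suc J)
  have "level_sums L b (Suc (Suc J)) = (\<lambda>(c, f). int c + int b * f) ` ({..<L} \<times> level_sums L b (Suc J))"
    by simp
  also have "\<dots> = (\<lambda>(c, f, c'). int c + int b * (f + int b ^ J * int c')) ` ({..<L} \<times> level_sums L b J \<times> {..<L})"
    unfolding Suc.IH by (force simp: image_iff)
  also have "\<dots> = (\<lambda>(f, c). f + int b ^ Suc J * int c) ` (level_sums L b (Suc J) \<times> {..<L})"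
    unfolding level_sums.simps by (force simp: image_iff algebra_simps)
  finally show ?case .
qed

lemma mod_lt_eq:
  fixes a a' n :: nat and k k' :: int
  assumes "a < n" "a' < n" "int a + int n * k = int a' + int n * k'"
  shows "a = a' \<and> k = k'"
proof -
  have "int a mod int n = int a' mod int n" by (metis assms(3) mod_mult_self2)
  then have "a = a'" using assms(1,2) by (simp flip: of_nat_mod)
  then show ?thesis using assms by simp
qed

section \<open>The finite factor tiles the integers\<close>

context
  fixes N L b :: nat and t :: int
  assumes N: "N > 0" and L: "L > 0" and b: "b = N * L" and t: "coprime t (int L)"
begin

text \<open>Division by \<open>N\<close> gives \<open>a\<close>. The quotient \<open>q\<close> is
  \<open>t * c + L * k\<close> because \<open>t\<close> is invertible modulo \<open>L\<close>:
  \<open>c\<close> is \<open>u * q\<close> reduced modulo \<open>L\<close> with \<open>u\<close> an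
  inverse of \<open>t\<close>, and \<open>k\<close> collects the multiples of
  \<open>L\<close>.\<close>

lemma digit_decomposition:
  obtains a c k where "a < N" "c < L" "n = int a + t * int N * int c + int b * k"
proof -
  define q where "q = n div int N"
  obtain u v where uv: "u * t + v * int L = 1"
    using bezout_int[of t "int L"] t by (auto simp: coprime_iff_gcd_eq_1)
  define c where "c = nat (u * q mod int L)"
  have c: "int c = u * q mod int L" "c < L" using L by (auto simp: c_def nat_less_iff)
  define k where "k = t * (u * q div int L) + v * q"
  have "q = (u * t + v * int L) * q" by (simp add: uv)
  also have "\<dots> = t * (int c + int L * (u * q div int L)) + v * int L * q"
    unfolding c(1) mod_mult_div_eq by (simp add: algebra_simps)
  also have "\<dots> = t * int c + int L * k" by (simp add: k_def algebra_simps)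
  finally have k: "q = t * int c + int L * k" .
  have "n = int (nat (n mod int N)) + int N * q" using N by (simp add: q_def)
  also have "\<dots> = int (nat (n mod int N)) + t * int N * int c + int b * k"
    by (subst k) (simp add: b algebra_simps)
  finally show ?thesis using that[of "nat (n mod int N)" c k] c N by (simp add: nat_less_iff)
qed

lemma digit_decomposition_unique:
  assumes "a < N" "a' < N" "c < L" "c' < L"
    and "int a + t * int N * int c + int b * k = int a' + t * int N * int c' + int b * k'"
  shows "a = a' \<and> c = c' \<and> k = k'"
proof -
  have "int a + int N * (t * int c + int L * k) = int a' + int N * (t * int c' + int L * k')"
    using assms(5) by (simp add: b algebra_simps)
  from mod_lt_eq[OF assms(1,2) this] have *: "a = a'" "t * int c + int L * k = t * int c' + int L * k'"
    by auto
  then have "t * (int c - int c') = int L * (k' - k)" by (simp add: algebra_simps)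
  then have "int L dvd t * (int c - int c')" by simp
  then have "int L dvd int c - int c'" using t by (simp add: coprime_dvd_mult_right_iff coprime_commute)
  then have "int c mod int L = int c' mod int L" by (simp add: mod_eq_dvd_iff)
  then have "c = c'" using assms by simp
  then show ?thesis using * L by simp
qed

text \<open>One digit decomposition per level: \<open>a\<close> becomes the lowest digit of the gap,
  \<open>c\<close> that of the sum, and \<open>k\<close> is left to the level below.\<close>

lemma level_sums_gaps_cover:
  "\<exists>f\<in>level_sums L b J. \<exists>g\<in>level_gaps N b J. n = t * int N * f + g"
proof (induction J arbitrary: n)
  case (Suc J)
  obtain a c k where n: "a < N" "c < L" "n = int a + t * int N * int c + int b * k"
    using digit_decomposition .
  obtain f g where fg: "f \<in> level_sums L b J" "g \<in> level_gaps N b J" "k = t * int N * f + g"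
    using Suc by blast
  have "n = t * int N * (int c + int b * f) + (int a + int b * g)"
    by (simp add: n(3) fg(3) algebra_simps)
  then show ?case using n fg by force
qed auto

lemma level_sums_gaps_unique:
  assumes "f \<in> level_sums L b J" "f' \<in> level_sums L b J" "g \<in> level_gaps N b J" "g' \<in> level_gaps N b J"
    and "t * int N * f + g = t * int N * f' + g'"
  shows "f = f' \<and> g = g'"
  using assms
proof (induction J arbitrary: f f' g g')
  case (Suc J)
  obtain c f1 c' f1' where f: "c < L" "c' < L" "f1 \<in> level_sums L b J" "f1' \<in> level_sums L b J"
    "f = int c + int b * f1" "f' = int c' + int b * f1'"
    using Suc.prems(1,2) by auto
  obtain a g1 a' g1' where g: "a < N" "a' < N" "g1 \<in> level_gaps N b J" "g1' \<in> level_gaps N b J"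
    "g = int a + int b * g1" "g' = int a' + int b * g1'"
    using Suc.prems(3,4) by auto
  have "int a + t * int N * int c + int b * (t * int N * f1 + g1)
     = int a' + t * int N * int c' + int b * (t * int N * f1' + g1')"
    using Suc.prems(5) by (simp add: f g algebra_simps)
  from digit_decomposition_unique[OF g(1,2) f(1,2) this] Suc.IH[OF f(3,4) g(3,4)]
  show ?case by (simp add: f g)
qed auto

end

section \<open>The finite factor and its frequencies are dual\<close>

context
  fixes N L b :: nat
  assumes N: "N > 0" and L: "L > 0" and b: "b = N * L"
begin

lemma level_freqs_bounds: "\<beta> \<in> level_freqs L b J \<Longrightarrow> 0 \<le> \<beta> \<and> \<beta> < 1"
proof (induction J arbitrary: \<beta>)
  case (Suc J)
  obtain d \<beta>1 where d: "d < L" "\<beta>1 \<in> level_freqs L b J" "\<beta> = real d / real L + \<beta>1 / real b"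
    using Suc.prems by auto
  have \<beta>1: "0 \<le> \<beta>1" "\<beta>1 < 1" using Suc.IH[OF d(2)] by auto
  have "\<beta>1 / real b < 1 / real L"
  proof -
    have "\<beta>1 / real b < 1 / real b" using \<beta>1 N L b by (simp add: divide_strict_right_mono)
    also have "\<dots> \<le> 1 / real L" using N L b by (simp add: field_simps)
    finally show ?thesis .
  qed
  moreover have "real d / real L + 1 / real L \<le> 1"
    using d(1) L by (simp add: field_simps)
  ultimately show ?case using \<beta>1 by (simp add: d(3))
qed auto

lemma inj_on_level_freqs:
  "inj_on (\<lambda>(d, \<beta>). real d / real L + \<beta> / real b) ({..<L} \<times> level_freqs L b J)"
proof (rule inj_onI, clarify)
  fix d \<beta> d' \<beta>'
  assume \<beta>: "\<beta> \<in> level_freqs L b J" "\<beta>' \<in> level_freqs L b J"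
    and eq: "real d / real L + \<beta> / real b = real d' / real L + \<beta>' / real b"
  have "real N * (real d - real d') = \<beta>' - \<beta>" using eq N L by (simp add: b field_simps)
  moreover have "\<bar>\<beta>' - \<beta>\<bar> < 1" using level_freqs_bounds[OF \<beta>(1)] level_freqs_bounds[OF \<beta>(2)] by auto
  ultimately have "real N * \<bar>real d - real d'\<bar> < 1" by (metis abs_mult abs_of_nat)
  moreover have "1 * \<bar>real d - real d'\<bar> \<le> real N * \<bar>real d - real d'\<bar>"
    using N by (intro mult_right_mono) auto
  ultimately have "\<bar>real d - real d'\<bar> < 1" by simp
  then have "d = d'" by linarith
  then show "d = d' \<and> \<beta> = \<beta>'" using eq N L b by simp
qed

lemma inj_on_level_sums:
  "inj_on (\<lambda>(c, f). int c + int b * f) ({..<L} \<times> level_sums L b J)"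
proof (rule inj_onI, clarify)
  fix c f c' f' assume "c < L" "c' < L" "int c + int b * f = int c' + int b * f'"
  moreover from this have "c < b" "c' < b" using N b by (auto intro: less_le_trans)
  ultimately show "c = c' \<and> f = f'" using mod_lt_eq by blast
qed

text \<open>Since \<open>b / L\<close> is an integer, the sum factors over the digit places. At the
  lowest place where \<open>f\<close> and \<open>f'\<close> differ, the factor is a full sum of
  powers of a nontrivial \<open>L\<close>-th root of unity.\<close>

lemma sum_level_freqs_eq_0:
  assumes "f \<in> level_sums L b J" "f' \<in> level_sums L b J" "f \<noteq> f'"
  shows "(\<Sum>\<beta>\<in>level_freqs L b J. unit_exp (\<beta> * of_int (f - f'))) = 0"
  using assms
proof (induction J arbitrary: f f')
  case (Suc J)
  obtain c f1 c' f1' where f: "c < L" "c' < L" "f1 \<in> level_sums L b J" "f1' \<in> level_sums L b J"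
    "f = int c + int b * f1" "f' = int c' + int b * f1'"
    using Suc.prems(1,2) by auto
  let ?y = "f - f'"
  have "(\<Sum>\<beta>\<in>level_freqs L b (Suc J). unit_exp (\<beta> * of_int ?y))
     = (\<Sum>d<L. \<Sum>\<beta>\<in>level_freqs L b J. unit_exp ((real d / real L + \<beta> / real b) * of_int ?y))"
    unfolding level_freqs.simps
    by (subst sum.reindex[OF inj_on_level_freqs]) (simp add: sum.cartesian_product case_prod_unfold)
  also have "\<dots> = (\<Sum>d<L. \<Sum>\<beta>\<in>level_freqs L b J. unit_exp (of_int (int c - int c') * real d / real L) * unit_exp (\<beta> / real b * of_int ?y))"
  proof (intro sum.cong refl)
    fix d \<beta>
    have "(real d / real L + \<beta> / real b) * of_int ?y
      = of_int (int c - int c') * real d / real L + \<beta> / real b * of_int ?y + of_int (int d * int N * (f1 - f1'))"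
      using N L by (simp add: f b field_simps)
    then show "unit_exp ((real d / real L + \<beta> / real b) * of_int ?y)
      = unit_exp (of_int (int c - int c') * real d / real L) * unit_exp (\<beta> / real b * of_int ?y)"
      by (simp only: unit_exp_add unit_exp_Ints[OF Ints_of_int] mult_1_right)
  qed
  also have "\<dots> = (\<Sum>d<L. unit_exp (of_int (int c - int c') * real d / real L))
       * (\<Sum>\<beta>\<in>level_freqs L b J. unit_exp (\<beta> / real b * of_int ?y))"
    by (simp only: sum_product)
  also have "\<dots> = 0"
  proof (cases "c = c'")
    case True
    then have "f1 \<noteq> f1'" using Suc.prems f by auto
    moreover have "\<beta> / real b * of_int ?y = \<beta> * of_int (f1 - f1')" for \<beta>
      using True N L by (simp add: f b field_simps)
    ultimately show ?thesis using Suc.IH[OF f(3,4)] by simp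
  next
    case False
    then have "\<not> int L dvd int c - int c'"
      using f(1,2) by (metis mod_eq_dvd_iff mod_less of_nat_mod of_nat_eq_iff)
    then show ?thesis using sum_unit_exp_div[OF L, of "int c - int c'"] by simp
  qed
  finally show ?case .
qed simp

text \<open>The dual orthogonality. The factor of the digit \<open>c\<close> involves the whole
  difference of the frequencies, so the case split starts with the inner frequencies: only if these
  agree does the difference reduce to \<open>(d - d') / L\<close>.\<close>

lemma sum_level_sums_eq_0:
  assumes "\<beta> \<in> level_freqs L b J" "\<beta>' \<in> level_freqs L b J" "\<beta> \<noteq> \<beta>'"
  shows "(\<Sum>f\<in>level_sums L b J. unit_exp ((\<beta> - \<beta>') * of_int f)) = 0"
  using assms
proof (induction J arbitrary: \<beta> \<beta>')
  case (Suc J)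
  obtain d \<beta>1 d' \<beta>1' where d: "d < L" "d' < L" "\<beta>1 \<in> level_freqs L b J" "\<beta>1' \<in> level_freqs L b J"
    "\<beta> = real d / real L + \<beta>1 / real b" "\<beta>' = real d' / real L + \<beta>1' / real b"
    using Suc.prems(1,2) by auto
  let ?x = "\<beta> - \<beta>'"
  have "(\<Sum>f\<in>level_sums L b (Suc J). unit_exp (?x * of_int f))
     = (\<Sum>c<L. \<Sum>f\<in>level_sums L b J. unit_exp (?x * of_int (int c + int b * f)))"
    unfolding level_sums.simps
    by (subst sum.reindex[OF inj_on_level_sums]) (simp add: sum.cartesian_product case_prod_unfold)
  also have "\<dots> = (\<Sum>c<L. \<Sum>f\<in>level_sums L b J. unit_exp (?x * real c) * unit_exp ((\<beta>1 - \<beta>1') * of_int f))"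
  proof (intro sum.cong refl)
    fix c f
    have "?x * of_int (int c + int b * f)
      = ?x * real c + (\<beta>1 - \<beta>1') * of_int f + of_int ((int d - int d') * int N * f)"
      using N L by (simp add: d b field_simps)
    then show "unit_exp (?x * of_int (int c + int b * f)) = unit_exp (?x * real c) * unit_exp ((\<beta>1 - \<beta>1') * of_int f)"
      by (simp only: unit_exp_add unit_exp_Ints[OF Ints_of_int] mult_1_right)
  qed
  also have "\<dots> = (\<Sum>c<L. unit_exp (?x * real c)) * (\<Sum>f\<in>level_sums L b J. unit_exp ((\<beta>1 - \<beta>1') * of_int f))"
    by (simp only: sum_product)
  also have "\<dots> = 0"
  proof (cases "\<beta>1 = \<beta>1'")
    case True
    then have "d \<noteq> d'" using Suc.prems d by auto
    then have "\<not> int L dvd int d - int d'"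
      using d(1,2) by (metis mod_eq_dvd_iff mod_less of_nat_mod of_nat_eq_iff)
    moreover have "?x * real c = of_int (int d - int d') * real c / real L" for c
      using True by (simp add: d diff_divide_distrib left_diff_distrib)
    ultimately show ?thesis using sum_unit_exp_div[OF L, of "int d - int d'"] by simp
  next
    case False
    then show ?thesis using Suc.IH[OF d(3,4)] by simp
  qed
  finally show ?case .
qed simp

end

section \<open>Decomposition of the self-similar set\<close>

lemma discrete_of_int_divide:
  assumes "h > 0"
  shows "discrete ((\<lambda>g. of_int g / real h) ` G)"
proof (rule uniform_discrete_imp_discrete, unfold uniform_discrete_def, intro exI[of _ "1 / real h"] conjI ballI impI)
  fix x y assume "x \<in> (\<lambda>g. of_int g / real h) ` G" "y \<in> (\<lambda>g. of_int g / real h) ` G" "dist x y < 1 / real h"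
  then obtain g g' where g: "x = of_int g / real h" "y = of_int g' / real h" "\<bar>of_int g - of_int g'\<bar> / real h < 1 / real h"
    using assms by (auto simp: dist_real_def simp flip: diff_divide_distrib)
  then have "\<bar>real_of_int g - of_int g'\<bar> < 1" using assms by (simp add: divide_less_cancel)
  then have "g = g'" by linarith
  then show "x = y" by (simp add: g)
qed (use assms in auto)

section \<open>The digits of \<open>S\<close> as a residue system\<close>

definition residue_digits :: "nat \<Rightarrow> nat \<Rightarrow> nat \<Rightarrow> nat \<Rightarrow> int set" where
  "residue_digits h t N L = (\<lambda>(a, c). int h * int a + int t * int N * int c) ` ({..<N} \<times> {..<L})"

lemma finite_residue_digits: "finite (residue_digits h t N L)"
  by (simp add: residue_digits_def)

lemma zero_in_residue_digits: "N > 0 \<Longrightarrow> L > 0 \<Longrightarrow> 0 \<in> residue_digits h t N L"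
  by (auto simp: residue_digits_def intro!: image_eqI[of _ _ "(0, 0)"])

lemma inj_on_residue_digits:
  assumes "N > 0" "L > 0" "coprime t L" "coprime h N"
  shows "inj_on (\<lambda>x. (case x of (a, c) \<Rightarrow> int h * int a + int t * int N * int c) mod int (N * L)) ({..<N} \<times> {..<L})"
proof (rule inj_onI, clarify)
  fix a c a' c' assume lt: "a < N" "a' < N" "c < L" "c' < L"
    and eq: "(int h * int a + int t * int N * int c) mod int (N * L) = (int h * int a' + int t * int N * int c') mod int (N * L)"
  from eq have "int (N * L) dvd (int h * int a + int t * int N * int c) - (int h * int a' + int t * int N * int c')"
    by (simp add: mod_eq_dvd_iff)
  then obtain k where "(int h * int a + int t * int N * int c) - (int h * int a' + int t * int N * int c') = int (N * L) * k"
    by (rule dvdE)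
  then have k: "int h * (int a - int a') + int t * int N * (int c - int c') = int (N * L) * k"
    by (simp add: algebra_simps)
  then have "int h * (int a - int a') = int N * (int L * k - int t * (int c - int c'))"
    by (simp add: algebra_simps)
  then have "int N dvd int h * (int a - int a')" by simp
  then have "int N dvd int a - int a'"
    using assms(4) by (simp add: coprime_dvd_mult_right_iff coprime_commute)
  then have "int a mod int N = int a' mod int N" by (simp add: mod_eq_dvd_iff)
  then have a: "a = a'" using lt by (simp flip: of_nat_mod)
  then have "int N * (int t * (int c - int c')) = int N * (int L * k)" using k by (simp add: mult_ac)
  then have "int t * (int c - int c') = int L * k" using assms by simp
  then have "int L dvd int t * (int c - int c')" by simp
  then have "int L dvd int c - int c'"
    using assms(3) by (simp add: coprime_dvd_mult_right_iff coprime_commute)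
  then have "int c mod int L = int c' mod int L" by (simp add: mod_eq_dvd_iff)
  then have "c = c'" using lt by (simp flip: of_nat_mod)
  then show "a = a' \<and> c = c'" using a by simp
qed

lemma residue_digits_complete:
  assumes "N > 0" "L > 0" "coprime t L" "coprime h N"
  shows "card (residue_digits h t N L) = N * L"
    and "inj_on (\<lambda>d. d mod int (N * L)) (residue_digits h t N L)"
    and "\<exists>d\<in>residue_digits h t N L. n mod int (N * L) = d mod int (N * L)"
proof -
  let ?f = "\<lambda>(a, c). int h * int a + int t * int N * int c" and ?g = "\<lambda>d. d mod int (N * L)"
  have inj: "inj_on (?g \<circ> ?f) ({..<N} \<times> {..<L})"
    using inj_on_residue_digits[OF assms] by (simp add: o_def)
  show card: "card (residue_digits h t N L) = N * L"
    unfolding residue_digits_def using inj_on_imageI2[OF inj] by (simp add: card_image)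
  show inj': "inj_on ?g (residue_digits h t N L)"
    unfolding residue_digits_def using inj_on_imageI[OF inj] .
  have "?g ` residue_digits h t N L = {0..<int (N * L)}"
  proof (rule card_subset_eq)
    show "card (?g ` residue_digits h t N L) = card {0..<int (N * L)}"
      using card_image[OF inj'] card by (simp del: of_nat_mult)
  qed (use assms in auto)
  moreover have "?g n \<in> {0..<int (N * L)}" using assms by simp
  ultimately show "\<exists>d\<in>residue_digits h t N L. n mod int (N * L) = d mod int (N * L)" by blast
qed

text \<open>Both \<open>h\<close> and \<open>t * N\<close> occur as digits, for
  \<open>(a, c)\<close> equal to \<open>(1, 0)\<close> and \<open>(0, 1)\<close>; they are coprime,
  so Bezout recovers \<open>y\<close> itself.\<close>

lemma residue_digits_coprime:
  assumes "N \<ge> 2" "L \<ge> 2" "coprime h N" "coprime h t"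
    and y: "\<And>d. d \<in> residue_digits h t N L \<Longrightarrow> y * of_int d \<in> \<int>"
  shows "(y :: real) \<in> \<int>"
proof -
  have "int h \<in> residue_digits h t N L" "int t * int N \<in> residue_digits h t N L"
    using assms(1,2) unfolding residue_digits_def
    by (auto intro: image_eqI[of _ _ "(1, 0)"] image_eqI[of _ _ "(0, 1)"])
  then have yh: "y * of_int (int h) \<in> \<int>" "y * of_int (int t * int N) \<in> \<int>" using y by blast+
  have "coprime (int h) (int t * int N)" using assms(3,4) by simp
  then obtain u v where uv: "u * int h + v * (int t * int N) = 1"
    using bezout_int[of "int h" "int t * int N"] by (auto simp: coprime_iff_gcd_eq_1)
  have "y = y * of_int (u * int h + v * (int t * int N))" by (simp add: uv)
  also have "\<dots> = of_int u * (y * of_int (int h)) + of_int v * (y * of_int (int t * int N))"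
    by (simp add: algebra_simps)
  also have "\<dots> \<in> \<int>" by (intro Ints_add Ints_mult yh Ints_of_int)
  finally show ?thesis .
qed

section \<open>The set \<open>S + t N F\<close> and its dilate\<close>

definition block_union :: "nat \<Rightarrow> nat \<Rightarrow> nat \<Rightarrow> nat \<Rightarrow> real set \<Rightarrow> real set" where
  "block_union t N L J S = (\<Union>f\<in>level_sums L (N * L) J. (+) (of_int (int t * int N * f)) ` S)"

lemma compact_block_union: "compact S \<Longrightarrow> compact (block_union t N L J S)"
  unfolding block_union_def using finite_level_sums
  by (intro compact_UN compact_translation) auto

text \<open>The factor \<open>(N * L) ^ J\<close> in \<open>m * h\<close> shifts the second digit sum \<open>J\<close> places to the left; its
  leading \<open>J\<close> digits become the integer translations \<open>level_sums\<close>.\<close>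

lemma self_similar_block_union:
  assumes N: "N \<ge> 2" and L: "L \<ge> 2" and h: "h > 0" and eq: "m * h = N * (N * L) ^ J * t"
    and S: "is_self_similar_set (1 / (real N * real L)) (of_int ` residue_digits h t N L) S"
  shows "is_self_similar_set (1 / (real N * real L)) (digit_set N m L) ((\<lambda>x. x / real h) ` block_union t N L J S)"
proof -
  define b where "b = N * L"
  have b: "b > 0" "real N * real L = real b" using N L by (auto simp: b_def)
  have S': "S \<noteq> {}" "compact S" "S = (\<Union>\<delta>\<in>of_int ` residue_digits h t N L. (\<lambda>x. 1 / real b * (x + \<delta>)) ` S)"
    using S unfolding b by (auto simp only: is_self_similar_set_def)
  define \<tau> where "\<tau> = real t * real N"
  let ?U = "(\<lambda>x. x / real h) ` block_union t N L J S"
  \<comment> \<open>The common expansion of both sides. Splitting \<open>S\<close> once supplies the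
    lowest digit of \<open>f\<close>; applying the maps of \<open>digit_set\<close> supplies the
    highest one.\<close>
  define M where "M = {(u + real h * real a + \<tau> * of_int f) / (real b * real h) | u a f.
      u \<in> S \<and> a < N \<and> f \<in> level_sums L b (Suc J)}"
  have eq': "real h * real m = \<tau> * real b ^ J"
  proof -
    have "real (m * h) = real (N * (N * L) ^ J * t)" by (simp only: eq)
    then show ?thesis by (simp add: b_def \<tau>_def mult_ac)
  qed
  have U: "x \<in> ?U \<longleftrightarrow> (\<exists>u\<in>S. \<exists>f\<in>level_sums L b J. x = (\<tau> * of_int f + u) / real h)" for x
    by (auto simp: block_union_def b_def \<tau>_def)
  have S_iff: "x \<in> S \<longleftrightarrow> (\<exists>u\<in>S. \<exists>a<N. \<exists>c<L. x = (u + real h * real a + \<tau> * real c) / real b)" for x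
    by (subst S'(3)) (auto simp: residue_digits_def \<tau>_def add.assoc Bex_def Ball_def; blast)
  have "?U = M"
  proof (intro set_eqI iffI)
    fix x assume "x \<in> ?U"
    then obtain u0 f where u0: "u0 \<in> S" "f \<in> level_sums L b J" "x = (\<tau> * of_int f + u0) / real h"
      unfolding U by blast
    then obtain u a c where *: "u \<in> S" "a < N" "c < L" "f \<in> level_sums L b J"
      "x = (\<tau> * of_int f + (u + real h * real a + \<tau> * real c) / real b) / real h"
      using S_iff[of u0] by blast
    then have "x = (u + real h * real a + \<tau> * of_int (int c + int b * f)) / (real b * real h)"
      using b h by (simp add: field_simps)
    moreover have "int c + int b * f \<in> level_sums L b (Suc J)" using * by force
    ultimately show "x \<in> M" unfolding M_def using * by blast
  next
    fix x assume "x \<in> M"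
    then obtain u a f where *: "u \<in> S" "a < N" "f \<in> level_sums L b (Suc J)"
      "x = (u + real h * real a + \<tau> * of_int f) / (real b * real h)" by (auto simp: M_def)
    then obtain c f' where f: "c < L" "f' \<in> level_sums L b J" "f = int c + int b * f'" by auto
    have "(u + real h * real a + \<tau> * real c) / real b \<in> S" using * f by (subst S_iff) blast
    moreover have "x = (\<tau> * of_int f' + (u + real h * real a + \<tau> * real c) / real b) / real h"
      using b h by (simp add: *(4) f(3) field_simps)
    ultimately show "x \<in> ?U" unfolding U using f by blast
  qed
  also have "M = (\<Union>\<delta>\<in>digit_set N m L. (\<lambda>x. 1 / real b * (x + \<delta>)) ` ?U)"
  proof (intro set_eqI iffI)
    fix x assume "x \<in> M"
    then obtain u a f where *: "u \<in> S" "a < N" "f \<in> level_sums L b (Suc J)"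
      "x = (u + real h * real a + \<tau> * of_int f) / (real b * real h)" by (auto simp: M_def)
    then obtain c f' where f: "c < L" "f' \<in> level_sums L b J" "f = f' + int b ^ J * int c"
      unfolding level_sums_Suc_right by auto
    have "(\<tau> * of_int f' + u) / real h \<in> ?U" unfolding U using * f by blast
    moreover have "real a + real m * real c \<in> digit_set N m L" using * f by (auto simp: digit_set_def)
    moreover have "x = 1 / real b * ((\<tau> * of_int f' + u) / real h + (real a + real m * real c))"
    proof -
      have "real h * ((\<tau> * of_int f' + u) / real h + (real a + real m * real c))
        = u + real h * real a + (\<tau> * of_int f' + real h * real m * real c)"
        using h by (simp add: field_simps)
      also have "\<dots> = u + real h * real a + \<tau> * of_int f" unfolding eq' by (simp add: f(3) algebra_simps)
      finally have "(\<tau> * of_int f' + u) / real h + (real a + real m * real c)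
          = (u + real h * real a + \<tau> * of_int f) / real h"
        using h by (simp only: eq_divide_eq mult.commute[of _ "real h"]) simp
      then show ?thesis by (simp only: *(4)) simp
    qed
    ultimately show "x \<in> (\<Union>\<delta>\<in>digit_set N m L. (\<lambda>x. 1 / real b * (x + \<delta>)) ` ?U)" by blast
  next
    fix x assume "x \<in> (\<Union>\<delta>\<in>digit_set N m L. (\<lambda>x. 1 / real b * (x + \<delta>)) ` ?U)"
    then obtain \<delta> y where y: "\<delta> \<in> digit_set N m L" "y \<in> ?U" "x = 1 / real b * (y + \<delta>)" by blast
    obtain u f where u: "u \<in> S" "f \<in> level_sums L b J" "y = (\<tau> * of_int f + u) / real h"
      using y(2) unfolding U by blast
    obtain a c where a: "a < N" "c < L" "\<delta> = real a + real m * real c"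
      using y(1) by (auto simp: digit_set_def)
    have "f + int b ^ J * int c \<in> level_sums L b (Suc J)"
      unfolding level_sums_Suc_right using u a by force
    moreover have "x = (u + real h * real a + \<tau> * of_int (f + int b ^ J * int c)) / (real b * real h)"
    proof -
      have "real h * (y + \<delta>) = u + real h * real a + (\<tau> * of_int f + real h * real m * real c)"
        using h by (simp add: u(3) a(3) field_simps)
      also have "\<dots> = u + real h * real a + \<tau> * of_int (f + int b ^ J * int c)"
        unfolding eq' by (simp add: algebra_simps)
      finally have "y + \<delta> = (u + real h * real a + \<tau> * of_int (f + int b ^ J * int c)) / real h"
        using h by (simp only: eq_divide_eq mult.commute[of _ "real h"]) simp
      then show ?thesis by (simp only: y(3)) simp
    qed
    ultimately show "x \<in> M" unfolding M_def using u a by blast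
  qed
  finally have "?U = (\<Union>\<delta>\<in>digit_set N m L. (\<lambda>x. 1 / real b * (x + \<delta>)) ` ?U)" .
  moreover have "?U \<noteq> {}"
  proof -
    obtain u where u: "u \<in> S" using S' by blast
    have "level_sums L b J \<noteq> {}" using L by (induction J) (auto simp: lessThan_empty_iff)
    then show ?thesis using u unfolding ex_in_conv[symmetric] U by blast
  qed
  moreover have "compact ?U"
    using compact_block_union[OF S'(2)] h by (intro compact_continuous_image continuous_intros) auto
  ultimately show ?thesis unfolding is_self_similar_set_def b by blast
qed

text \<open>The gaps complement \<open>t N F\<close> in the integers, so after scaling by
  \<open>h\<close> the translates are exactly the integer translates of \<open>S\<close>, each
  occurring once.\<close>

lemma translation_tile_block_union:
  assumes N: "N > 0" and L: "L > 0" and h: "h > 0" and t: "coprime t L"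
    and cover: "\<And>x. \<exists>s\<in>S. \<exists>n. x = s + of_int n"
    and null: "\<And>n. n \<noteq> 0 \<Longrightarrow> S \<inter> (+) (of_int n) ` S \<in> null_sets lborel"
  shows "translation_tile ((\<lambda>x. x / real h) ` block_union t N L J S)"
proof -
  define \<Gamma> where "\<Gamma> = (\<lambda>g. of_int g / real h) ` level_gaps N (N * L) J"
  let ?U = "(\<lambda>x. x / real h) ` block_union t N L J S"
  have t': "coprime (int t) (int L)" using t by simp
  have U: "x \<in> ?U \<longleftrightarrow> (\<exists>u\<in>S. \<exists>f\<in>level_sums L (N * L) J. x = (of_int (int t * int N * f) + u) / real h)" for x
    by (auto simp: block_union_def)
  have "(\<Union>\<gamma>\<in>\<Gamma>. (\<lambda>x. x + \<gamma>) ` ?U) = UNIV"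
  proof (intro set_eqI iffI)
    fix x :: real
    obtain s n where s: "s \<in> S" "real h * x = s + of_int n" using cover by blast
    obtain f g where fg: "f \<in> level_sums L (N * L) J" "g \<in> level_gaps N (N * L) J" "n = int t * int N * f + g"
      using level_sums_gaps_cover[OF N L refl t', of J n] by blast
    have "(of_int (int t * int N * f) + s) / real h \<in> ?U" unfolding U using s fg by blast
    moreover have "of_int g / real h \<in> \<Gamma>" using fg by (auto simp: \<Gamma>_def)
    moreover have "x = (of_int (int t * int N * f) + s) / real h + of_int g / real h"
      using s h by (simp add: fg(3) field_simps)
    ultimately show "x \<in> (\<Union>\<gamma>\<in>\<Gamma>. (\<lambda>x. x + \<gamma>) ` ?U)" by blast
  qed simp
  moreover have "(\<lambda>x. x + \<gamma>) ` ?U \<inter> (\<lambda>x. x + \<gamma>') ` ?U \<in> null_sets lebesgue"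
    if "\<gamma> \<in> \<Gamma>" "\<gamma>' \<in> \<Gamma>" "\<gamma> \<noteq> \<gamma>'" for \<gamma> \<gamma>'
  proof -
    obtain g g' where g: "g \<in> level_gaps N (N * L) J" "g' \<in> level_gaps N (N * L) J" "g \<noteq> g'"
      "\<gamma> = of_int g / real h" "\<gamma>' = of_int g' / real h"
      using \<open>\<gamma> \<in> \<Gamma>\<close> \<open>\<gamma>' \<in> \<Gamma>\<close> \<open>\<gamma> \<noteq> \<gamma>'\<close> by (auto simp: \<Gamma>_def)
    \<comment> \<open>All overlaps of two distinct integer translates of \<open>S\<close>: a
      countable union of null sets that serves every pair of tiles.\<close>
    define A where "A = (\<Union>k. (+) (of_int k) ` (\<Union>n\<in>-{0}. S \<inter> (+) (of_int n) ` S))"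
    have "A \<in> null_sets lebesgue"
      unfolding A_def
    proof (intro null_sets_UN)
      fix k :: int
      have "(\<Union>n\<in>-{0}. S \<inter> (+) (of_int n) ` S) \<in> null_sets lebesgue"
        using null by (intro null_sets_UN' null_sets_completionI) auto
      then show "(+) (of_int k) ` (\<Union>n\<in>-{0}. S \<inter> (+) (of_int n) ` S) \<in> null_sets lebesgue"
        unfolding negligible_iff_null_sets[symmetric] by (rule negligible_translation)
    qed
    then have null': "(\<lambda>x. x / real h) ` A \<in> null_sets lebesgue"
      unfolding negligible_iff_null_sets[symmetric]
      by (intro negligible_differentiable_image_negligible) (auto simp: divide_inverse intro!: bounded_linear_imp_differentiable_on bounded_linear_mult_left)
    have "(\<lambda>x. x + \<gamma>) ` ?U \<inter> (\<lambda>x. x + \<gamma>') ` ?U \<subseteq> (\<lambda>x. x / real h) ` A"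
    proof
      fix x assume x: "x \<in> (\<lambda>x. x + \<gamma>) ` ?U \<inter> (\<lambda>x. x + \<gamma>') ` ?U"
      then obtain y y' where y: "y \<in> ?U" "x = y + \<gamma>" "y' \<in> ?U" "x = y' + \<gamma>'" by blast
      have "x - \<gamma> = y" "x - \<gamma>' = y'" using y(2,4) by linarith+
      then have "x - \<gamma> \<in> ?U" "x - \<gamma>' \<in> ?U" using y(1,3) by (simp_all only:)
      then obtain u f u' f' where u: "u \<in> S" "u' \<in> S" "f \<in> level_sums L (N * L) J" "f' \<in> level_sums L (N * L) J"
        "x - \<gamma> = (of_int (int t * int N * f) + u) / real h" "x - \<gamma>' = (of_int (int t * int N * f') + u') / real h"
        unfolding U by blast
      define k where "k = int t * int N * f + g"
      define k' where "k' = int t * int N * f' + g'"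
      have "k \<noteq> k'" using level_sums_gaps_unique[OF N L refl t' u(3,4) g(1,2)] g(3) by (auto simp: k_def k'_def)
      have x: "real h * x = of_int k + u" "real h * x = of_int k' + u'"
        using u(5,6) h by (simp_all add: g k_def k'_def field_simps)
      then have "u = of_int (k' - k) + u'" by simp
      then have "u \<in> S \<inter> (+) (of_int (k' - k)) ` S" using u by blast
      then have "u \<in> (\<Union>n\<in>-{0}. S \<inter> (+) (of_int n) ` S)"
        using \<open>k \<noteq> k'\<close> by (intro UN_I[of "k' - k"]) auto
      then have "of_int k + u \<in> (+) (of_int k) ` (\<Union>n\<in>-{0}. S \<inter> (+) (of_int n) ` S)" by (rule imageI)
      then have "real h * x \<in> A" unfolding A_def x(1) by (rule UN_I[OF UNIV_I])
      then show "x \<in> (\<lambda>x. x / real h) ` A" using h by (intro image_eqI[of _ _ "real h * x"]) auto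
    qed
    with null' show ?thesis unfolding negligible_iff_null_sets[symmetric] by (rule negligible_subset)
  qed
  moreover have "discrete \<Gamma>" unfolding \<Gamma>_def using h by (rule discrete_of_int_divide)
  ultimately show ?thesis unfolding translation_tile_def by (intro exI[of _ \<Gamma>]) auto
qed

section \<open>Approximation by trigonometric polynomials\<close>

inductive_set trig_polys :: "(real \<Rightarrow> complex) set" where
  unit_exp: "(\<lambda>x. unit_exp (of_int n * x)) \<in> trig_polys"
| scale: "p \<in> trig_polys \<Longrightarrow> (\<lambda>x. c * p x) \<in> trig_polys"
| add: "p \<in> trig_polys \<Longrightarrow> q \<in> trig_polys \<Longrightarrow> (\<lambda>x. p x + q x) \<in> trig_polys"

lemma trig_polys_sum:
  assumes "p \<in> trig_polys"
  obtains A :: "int set" and c where "finite A" "p = (\<lambda>x. \<Sum>n\<in>A. c n * unit_exp (of_int n * x))"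
proof -
  have "\<exists>A c. finite A \<and> p = (\<lambda>x. \<Sum>n\<in>A. c n * unit_exp (of_int n * x))"
    using assms
  proof induction
    case (unit_exp n)
    show ?case by (intro exI[of _ "{n}"] exI[of _ "\<lambda>_. 1"]) simp
  next
    case (scale p c)
    then obtain A d where "finite A" "p = (\<lambda>x. \<Sum>n\<in>A. d n * unit_exp (of_int n * x))" by blast
    then show ?case
      by (intro exI[of _ A] exI[of _ "\<lambda>n. c * d n"]) (simp add: sum_distrib_left mult.assoc)
  next
    case (add p q)
    then obtain A c B d where *: "finite A" "p = (\<lambda>x. \<Sum>n\<in>A. c n * unit_exp (of_int n * x))"
      "finite B" "q = (\<lambda>x. \<Sum>n\<in>B. d n * unit_exp (of_int n * x))" by blast
    let ?e = "\<lambda>n. (if n \<in> A then c n else 0) + (if n \<in> B then d n else 0)"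
    have "(\<Sum>n\<in>A \<union> B. ?e n * unit_exp (of_int n * x)) = p x + q x" for x
    proof -
      have "(\<Sum>n\<in>A \<union> B. (if n \<in> A then c n else 0) * unit_exp (of_int n * x)) = p x"
        unfolding *(2) using *(1,3) by (intro sum.mono_neutral_cong_right) auto
      moreover have "(\<Sum>n\<in>A \<union> B. (if n \<in> B then d n else 0) * unit_exp (of_int n * x)) = q x"
        unfolding *(4) using *(1,3) by (intro sum.mono_neutral_cong_right) auto
      ultimately show ?thesis by (simp only: distrib_right sum.distrib)
    qed
    then show ?case using *(1,3) by (intro exI[of _ "A \<union> B"] exI[of _ ?e]) simp
  qed
  then show ?thesis using that by blast
qed

lemma trig_polys_const: "(\<lambda>x. c) \<in> trig_polys"
  using trig_polys.scale[OF trig_polys.unit_exp[of 0], of c] by simp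

lemma trig_polys_mult:
  assumes "p \<in> trig_polys" "q \<in> trig_polys"
  shows "(\<lambda>x. p x * q x) \<in> trig_polys"
  using assms(1)
proof induction
  case (unit_exp n)
  show ?case using assms(2)
  proof induction
    case (unit_exp m)
    show ?case using trig_polys.unit_exp[of "n + m"] by (simp add: unit_exp_add distrib_right)
  next
    case (scale q c)
    then show ?case using trig_polys.scale[of _ c] by (simp add: mult.left_commute)
  next
    case (add q r)
    then show ?case using trig_polys.add by (simp add: distrib_left)
  qed
next
  case (scale p c)
  then show ?case using trig_polys.scale[of _ c] by (simp add: mult.assoc)
next
  case (add p r)
  then show ?case using trig_polys.add by (simp add: distrib_right)
qed

lemma continuous_on_trig_polys: "p \<in> trig_polys \<Longrightarrow> continuous_on A p"
  by (induction rule: trig_polys.induct) (auto intro!: continuous_intros)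

lemma trig_polys_add_int: "p \<in> trig_polys \<Longrightarrow> p (x + of_int k) = p x"
  by (induction rule: trig_polys.induct) (simp_all add: distrib_left unit_exp_add)

text \<open>A real-linear \<open>f\<close> is determined by \<open>f 1\<close> and
  \<open>f \<i>\<close>, and on the unit circle \<open>Re z\<close> and \<open>Im z\<close> are
  combinations of \<open>z\<close> and \<open>1 / z\<close>. Sums and products then preserve
  trigonometric polynomials.\<close>

lemma real_polynomial_function_trig_polys:
  assumes "real_polynomial_function (f :: complex \<Rightarrow> real)"
  shows "(\<lambda>x. of_real (f (unit_exp x))) \<in> trig_polys"
  using assms
proof induction
  case (linear f)
  have eq: "of_real (f (unit_exp x))
     = (of_real (f 1) / 2 + of_real (f \<i>) / (2 * \<i>)) * unit_exp (of_int 1 * x)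
     + (of_real (f 1) / 2 - of_real (f \<i>) / (2 * \<i>)) * unit_exp (of_int (- 1) * x)" for x
  proof -
    have lin: "linear f" using linear by (rule bounded_linear.linear)
    have "f z = Re z * f 1 + Im z * f \<i>" for z
    proof -
      have "f z = f (Re z *\<^sub>R 1 + Im z *\<^sub>R \<i>)" by (rule arg_cong[of _ _ f]) (simp add: complex_eq_iff)
      then show ?thesis by (simp add: linear_add[OF lin] linear_scale[OF lin])
    qed
    from this[of "unit_exp x"] show ?thesis by (simp add: unit_exp_def complex_eq_iff)
  qed
  show ?case unfolding eq by (intro trig_polys.intros)
next
  case (const c)
  show ?case by (rule trig_polys_const)
next
  case (add f g)
  then show ?case using trig_polys.add by fastforce
next
  case (mult f g)
  then show ?case using trig_polys_mult by fastforce
qed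

lemma trig_polys_uniform_approx:
  fixes g :: "real \<Rightarrow> complex"
  assumes g: "continuous_on {0..1} g" "g 0 = g 1" and e: "e > 0"
  obtains p where "p \<in> trig_polys" "\<And>x. x \<in> {0..1} \<Longrightarrow> norm (g x - p x) < e"
proof -
  define G where "G = g \<circ> (\<lambda>z. Arg2pi z / (2 * pi))"
  \<comment> \<open>Continuity of \<open>G\<close>, delicate at the branch cut of
    \<open>Arg2pi\<close>, is read off from the constant homotopy of the loop \<open>g\<close> to
    itself.\<close>
  have "homotopic_loops UNIV g g"
    using g by (simp add: homotopic_loops_refl path_def pathstart_def pathfinish_def)
  then have "homotopic_with_canon (\<lambda>h. True) (sphere 0 1) UNIV G G"
    unfolding G_def by (rule homotopic_loops_imp_homotopic_circlemaps)
  then have "continuous_on (sphere 0 1) G" by (rule homotopic_with_imp_continuous[THEN conjunct1])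
  then obtain P where P: "polynomial_function P" "\<And>z. z \<in> sphere 0 1 \<Longrightarrow> norm (G z - P z) < e"
    using Stone_Weierstrass_polynomial_function[of "sphere 0 1" G e] e by auto
  have G: "G (unit_exp x) = g x" if "x \<in> {0..1}" for x
  proof (cases "x = 1")
    case True
    have "Arg2pi 1 = 0" using Arg2pi_unique[of 1 0 1] by simp
    then show ?thesis using True g by (simp add: G_def)
  next
    case False
    then have "Arg2pi (unit_exp x) = 2 * pi * x"
      using that by (intro Arg2pi_unique[of 1]) (auto simp: unit_exp_def cis_conv_exp)
    then show ?thesis by (simp add: G_def)
  qed
  define p where "p x = P (unit_exp x)" for x
  have "p = (\<lambda>x. of_real ((Re \<circ> P) (unit_exp x)) + \<i> * of_real ((Im \<circ> P) (unit_exp x)))"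
    by (auto simp: p_def fun_eq_iff complex_eq_iff)
  also have "\<dots> \<in> trig_polys"
  proof -
    have "real_polynomial_function (Re \<circ> P)" "real_polynomial_function (Im \<circ> P)"
      using P(1) bounded_linear_Re bounded_linear_Im unfolding polynomial_function_def by blast+
    then show ?thesis by (intro trig_polys.intros real_polynomial_function_trig_polys)
  qed
  finally have "p \<in> trig_polys" .
  moreover have "norm (g x - p x) < e" if "x \<in> {0..1}" for x
    using P(2)[of "unit_exp x"] G[OF that] by (simp add: p_def)
  ultimately show ?thesis using that by blast
qed

section \<open>Density in square mean on the unit interval\<close>

text \<open>Integrability is demanded explicitly because the integral of a non-integrable function
  is 0 by convention.\<close>

definition trig_approximable :: "(real \<Rightarrow> complex) \<Rightarrow> bool" where
  "trig_approximable f \<longleftrightarrow> (\<forall>e>0. \<exists>p\<in>trig_polys.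
     integrable (restrict_space lborel {0..1}) (\<lambda>x. (cmod (f x - p x))\<^sup>2) \<and>
     (\<integral>x. (cmod (f x - p x))\<^sup>2 \<partial>restrict_space lborel {0..1}) < e)"

lemma finite_measure_unit_interval: "finite_measure (restrict_space lborel {0..1 :: real})"
  by (rule finite_measureI) (simp add: space_restrict_space emeasure_restrict_space)

lemma measure_unit_interval: "measure (restrict_space lborel {0..1 :: real}) {0..1} = 1"
  by (simp add: measure_restrict_space)

lemma integral_const_unit_interval: "(\<integral>x. (c :: real) \<partial>restrict_space lborel {0..1 :: real}) = c"
  using measure_unit_interval by (simp add: space_restrict_space)

text \<open>This closure under dominated limits carries approximability from continuous periodic
  functions to continuous, bounded measurable and finally square integrable ones.\<close>

lemma trig_approximable_limit:
  assumes f: "f \<in> borel_measurable (restrict_space lborel {0..1})"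
    and fn: "\<And>n. fn n \<in> borel_measurable (restrict_space lborel {0..1})" "\<And>n. trig_approximable (fn n)"
    and lim: "AE x in restrict_space lborel {0..1}. (\<lambda>n. fn n x) \<longlonglongrightarrow> f x"
    and w: "integrable (restrict_space lborel {0..1}) w" "\<And>n. AE x in restrict_space lborel {0..1}. (cmod (f x - fn n x))\<^sup>2 \<le> w x"
  shows "trig_approximable f"
  unfolding trig_approximable_def
proof (intro allI impI)
  fix e :: real assume e: "e > 0"
  let ?U = "restrict_space lborel {0..1 :: real}"
  note [measurable] = f fn(1)
  have "(\<lambda>n. \<integral>x. (cmod (f x - fn n x))\<^sup>2 \<partial>?U) \<longlonglongrightarrow> (\<integral>x. 0 \<partial>?U)"
  proof (rule integral_dominated_convergence[where w = w])
    show "AE x in ?U. (\<lambda>n. (cmod (f x - fn n x))\<^sup>2) \<longlonglongrightarrow> 0"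
      using lim
    proof eventually_elim
      case (elim x)
      then have "(\<lambda>n. (cmod (f x - fn n x))\<^sup>2) \<longlonglongrightarrow> (cmod (f x - f x))\<^sup>2" by (intro tendsto_intros)
      then show ?case by simp
    qed
  qed (use w in auto)
  \<comment> \<open>Two errors below \<open>e / 4\<close> suffice, each being doubled by
    \<open>(a + b)^2 \<le> 2 a^2 + 2 b^2\<close>.\<close>
  then have "\<forall>\<^sub>F n in sequentially. (\<integral>x. (cmod (f x - fn n x))\<^sup>2 \<partial>?U) < e / 4"
    using e by (intro order_tendstoD(2)) auto
  then obtain n where n: "(\<integral>x. (cmod (f x - fn n x))\<^sup>2 \<partial>?U) < e / 4"
    by (auto simp: eventually_sequentially)
  obtain p where p: "p \<in> trig_polys" "integrable ?U (\<lambda>x. (cmod (fn n x - p x))\<^sup>2)"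
    "(\<integral>x. (cmod (fn n x - p x))\<^sup>2 \<partial>?U) < e / 4"
    using fn(2)[of n] e unfolding trig_approximable_def by (meson divide_pos_pos zero_less_numeral)
  have [measurable]: "p \<in> borel_measurable borel"
    using continuous_on_trig_polys[OF p(1)] by (rule borel_measurable_continuous_onI)
  have [measurable]: "p \<in> borel_measurable ?U" by (intro measurable_restrict_space1) simp
  have int: "integrable ?U (\<lambda>x. (cmod (f x - fn n x))\<^sup>2)"
    by (rule Bochner_Integration.integrable_bound[OF w(1)]) (use w(2)[of n] in auto)
  have le: "(cmod (f x - p x))\<^sup>2 \<le> 2 * (cmod (f x - fn n x))\<^sup>2 + 2 * (cmod (fn n x - p x))\<^sup>2" for x
  proof -
    have "cmod (f x - p x) \<le> cmod (f x - fn n x) + cmod (fn n x - p x)"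
      using norm_triangle_ineq[of "f x - fn n x" "fn n x - p x"] by simp
    then have "(cmod (f x - p x))\<^sup>2 \<le> (cmod (f x - fn n x) + cmod (fn n x - p x))\<^sup>2"
      by (rule power_mono) simp
    also have "\<dots> \<le> 2 * (cmod (f x - fn n x))\<^sup>2 + 2 * (cmod (fn n x - p x))\<^sup>2"
      using sum_squares_bound[of "cmod (f x - fn n x)" "cmod (fn n x - p x)"] by (simp add: power2_sum)
    finally show ?thesis .
  qed
  have int2: "integrable ?U (\<lambda>x. 2 * (cmod (f x - fn n x))\<^sup>2 + 2 * (cmod (fn n x - p x))\<^sup>2)"
    using int p(2) by auto
  have int3: "integrable ?U (\<lambda>x. (cmod (f x - p x))\<^sup>2)"
    by (rule Bochner_Integration.integrable_bound[OF int2]) (use le in auto)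
  have "(\<integral>x. (cmod (f x - p x))\<^sup>2 \<partial>?U) \<le> (\<integral>x. 2 * (cmod (f x - fn n x))\<^sup>2 + 2 * (cmod (fn n x - p x))\<^sup>2 \<partial>?U)"
    using int2 int3 le by (intro integral_mono) auto
  also have "\<dots> < e" using int p n by simp
  finally show "\<exists>p\<in>trig_polys. integrable ?U (\<lambda>x. (cmod (f x - p x))\<^sup>2) \<and> (\<integral>x. (cmod (f x - p x))\<^sup>2 \<partial>?U) < e"
    using p(1) int3 by blast
qed

lemma trig_approximable_continuous_periodic:
  fixes g :: "real \<Rightarrow> complex"
  assumes g: "continuous_on {0..1} g" "g 0 = g 1"
  shows "trig_approximable g"
  unfolding trig_approximable_def
proof (intro allI impI)
  fix e :: real assume e: "e > 0"
  let ?U = "restrict_space lborel {0..1 :: real}"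
  interpret finite_measure ?U by (rule finite_measure_unit_interval)
  obtain p where p: "p \<in> trig_polys" "\<And>x. x \<in> {0..1} \<Longrightarrow> norm (g x - p x) < sqrt (e / 2)"
    using trig_polys_uniform_approx[OF g, of "sqrt (e / 2)"] e by auto
  have le: "(cmod (g x - p x))\<^sup>2 \<le> e / 2" if "x \<in> {0..1}" for x
    using power_mono[OF less_imp_le[OF p(2)[OF that]], of 2] e by simp
  have "continuous_on {0..1} (\<lambda>x. (cmod (g x - p x))\<^sup>2)"
    using g continuous_on_trig_polys[OF p(1)] by (intro continuous_intros)
  then have "(\<lambda>x. (cmod (g x - p x))\<^sup>2) \<in> borel_measurable (restrict_space borel {0..1})"
    by (rule borel_measurable_continuous_on_restrict)
  then have meas: "(\<lambda>x. (cmod (g x - p x))\<^sup>2) \<in> borel_measurable ?U"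
    by (simp cong: measurable_cong_sets restrict_space_sets_cong)
  have int: "integrable ?U (\<lambda>x. (cmod (g x - p x))\<^sup>2)"
    using le by (intro integrable_const_bound[OF _ meas, where B = "e / 2"]) (auto simp: AE_restrict_space_iff)
  have "(\<integral>x. (cmod (g x - p x))\<^sup>2 \<partial>?U) \<le> (\<integral>x. e / 2 \<partial>?U)"
    using int le by (intro integral_mono) (auto simp: space_restrict_space)
  also have "\<dots> < e" using e by (simp only: integral_const_unit_interval)
  finally show "\<exists>p\<in>trig_polys. integrable ?U (\<lambda>x. (cmod (g x - p x))\<^sup>2) \<and> (\<integral>x. (cmod (g x - p x))\<^sup>2 \<partial>?U) < e"
    using p(1) int by blast
qed

lemma trig_approximable_continuous:
  fixes g :: "real \<Rightarrow> complex"
  assumes g: "continuous_on UNIV g"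
  shows "trig_approximable g"
proof -
  let ?U = "restrict_space lborel {0..1 :: real}"
  interpret finite_measure ?U by (rule finite_measure_unit_interval)
  \<comment> \<open>A cutoff that vanishes at 0 and 1, which makes the product with \<open>g\<close>
    periodic, and tends to 1 in between.\<close>
  define c where "c n x = min 1 (real n * x) * min 1 (real n * (1 - x))" for n x
  have c: "0 \<le> c n x \<and> c n x \<le> 1" if "x \<in> {0..1}" for n x
    using that by (auto simp: c_def intro!: mult_le_one mult_nonneg_nonneg)
  have meas [measurable]: "g \<in> borel_measurable borel" using g by (rule borel_measurable_continuous_onI)
  have contc: "continuous_on UNIV (c n)" for n unfolding c_def by (intro continuous_intros)
  have [measurable]: "c n \<in> borel_measurable borel" for n using contc by (rule borel_measurable_continuous_onI)
  have "bounded (g ` {0..1})"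
    using continuous_on_subset[OF g] by (intro compact_imp_bounded compact_continuous_image) auto
  then obtain B where "\<forall>y\<in>g ` {0..1}. cmod y \<le> B" unfolding bounded_iff by blast
  then have B: "cmod (g x) \<le> B" if "x \<in> {0..1}" for x using that by blast
  show ?thesis
  proof (rule trig_approximable_limit[where fn = "\<lambda>n x. of_real (c n x) * g x" and w = "\<lambda>_. B\<^sup>2"])
    show "trig_approximable (\<lambda>x. of_real (c n x) * g x)" for n
      using continuous_on_subset[OF g, of "{0..1}"] continuous_on_subset[OF contc, of "{0..1}"]
      by (intro trig_approximable_continuous_periodic) (auto intro!: continuous_intros simp: c_def)
    have lim: "(\<lambda>n. of_real (c n x) * g x) \<longlonglongrightarrow> g x" if "0 < x" "x < 1" for x
    proof (rule tendsto_eventually)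
      have ev: "\<forall>\<^sub>F n in sequentially. 1 \<le> real n * y" if "y > 0" for y :: real
      proof -
        obtain n0 :: nat where "1 / y \<le> real n0" using real_arch_simple by blast
        then have "1 \<le> real n * y" if "n \<ge> n0" for n
          using that \<open>y > 0\<close> by (simp add: field_simps) (meson mult_left_mono of_nat_le_iff order_trans less_imp_le)
        then show ?thesis by (auto simp: eventually_sequentially)
      qed
      show "\<forall>\<^sub>F n in sequentially. of_real (c n x) * g x = g x"
        using that(2)
        by (intro eventually_mono[OF eventually_conj[OF ev[OF that(1)] ev[of "1 - x"]]]) (auto simp: c_def)
    qed
    have "AE x in lborel. x \<noteq> 0 \<and> x \<noteq> (1 :: real)"
      using AE_lborel_singleton[of "0 :: real"] AE_lborel_singleton[of "1 :: real"] by eventually_elim auto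
    then have "AE x in lborel. x \<in> {0..1} \<longrightarrow> (\<lambda>n. of_real (c n x) * g x) \<longlonglongrightarrow> g x"
      by eventually_elim (auto intro: lim)
    then show "AE x in ?U. (\<lambda>n. of_real (c n x) * g x) \<longlonglongrightarrow> g x"
      by (simp add: AE_restrict_space_iff)
    show "AE x in ?U. (cmod (g x - of_real (c n x) * g x))\<^sup>2 \<le> B\<^sup>2" for n
    proof -
      have "(cmod (g x - of_real (c n x) * g x))\<^sup>2 \<le> B\<^sup>2" if x: "x \<in> {0..1}" for x
      proof (rule power_mono)
        have "g x - of_real (c n x) * g x = of_real (1 - c n x) * g x" by (simp add: algebra_simps)
        then have "cmod (g x - of_real (c n x) * g x) = (1 - c n x) * cmod (g x)"
          using c[OF x] by (simp add: norm_mult del: of_real_diff)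
        also have "\<dots> \<le> 1 * cmod (g x)" using c[OF x] by (intro mult_right_mono) auto
        finally show "cmod (g x - of_real (c n x) * g x) \<le> B" using B[OF x] by simp
      qed simp
      then show ?thesis by (simp add: AE_restrict_space_iff)
    qed
  qed (auto intro!: measurable_restrict_space1)
qed

lemma trig_approximable_bounded:
  fixes f :: "real \<Rightarrow> complex"
  assumes f [measurable]: "f \<in> borel_measurable borel" and B: "\<And>x. cmod (f x) \<le> B" "B > 0"
  shows "trig_approximable f"
proof -
  let ?U = "restrict_space lborel {0..1 :: real}"
  interpret finite_measure ?U by (rule finite_measure_unit_interval)
  have "f \<in> borel_measurable lebesgue" using f by (simp add: measurable_completion)
  then have "f measurable_on UNIV" by (rule lebesgue_measurable_imp_measurable_on) simp
  then obtain M g where M: "negligible M" "\<And>n. continuous_on UNIV (g n)"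
    "\<And>x. x \<notin> M \<Longrightarrow> (\<lambda>n. g n x) \<longlonglongrightarrow> f x"
    unfolding measurable_on_def by auto
  \<comment> \<open>Radial retraction onto the disc of radius \<open>B\<close>: it bounds the
    continuous approximants and fixes the values of \<open>f\<close>.\<close>
  define r where "r z = z * of_real (B / max B (cmod z))" for z
  have r: "cmod (r z) \<le> B" for z
  proof -
    have "cmod (r z) = cmod z * B / max B (cmod z)" using B by (simp add: r_def norm_mult norm_divide)
    also have "\<dots> \<le> B" using B by (simp add: divide_le_eq mult.commute mult_left_mono)
    finally show ?thesis .
  qed
  have r_id: "r (f x) = f x" for x using B by (simp add: r_def max_absorb1)
  have contr: "continuous_on UNIV r" unfolding r_def using B by (intro continuous_intros) auto
  have contrg: "continuous_on UNIV (\<lambda>x. r (g n x))" for n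
    using continuous_on_compose2[OF contr M(2)] by simp
  have [measurable]: "(\<lambda>x. r (g n x)) \<in> borel_measurable borel" for n
    using contrg by (rule borel_measurable_continuous_onI)
  show ?thesis
  proof (rule trig_approximable_limit[where fn = "\<lambda>n x. r (g n x)" and w = "\<lambda>_. (2 * B)\<^sup>2"])
    show "trig_approximable (\<lambda>x. r (g n x))" for n by (rule trig_approximable_continuous[OF contrg])
    have "AE x in lebesgue. x \<notin> M" using M(1) by (auto simp: negligible_iff_null_sets intro: AE_not_in)
    then have "AE x in lborel. x \<notin> M" by (simp add: AE_completion_iff)
    then have "AE x in lborel. (\<lambda>n. r (g n x)) \<longlonglongrightarrow> f x"
    proof eventually_elim
      case (elim x)
      have "(\<lambda>n. r (g n x)) \<longlonglongrightarrow> r (f x)"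
        using M(3)[OF elim] by (intro continuous_on_tendsto_compose[OF contr]) auto
      then show ?case by (simp add: r_id)
    qed
    then show "AE x in ?U. (\<lambda>n. r (g n x)) \<longlonglongrightarrow> f x"
      by (auto simp: AE_restrict_space_iff)
    show "AE x in ?U. (cmod (f x - r (g n x)))\<^sup>2 \<le> (2 * B)\<^sup>2" for n
    proof (intro AE_I2 power_mono)
      fix x
      show "cmod (f x - r (g n x)) \<le> 2 * B"
        using norm_triangle_ineq4[of "f x" "r (g n x)"] B(1)[of x] r[of "g n x"] by simp
    qed simp
  qed (auto intro!: measurable_restrict_space1)
qed

lemma trig_approximable_square_integrable:
  fixes f :: "real \<Rightarrow> complex"
  assumes f [measurable]: "f \<in> borel_measurable borel"
    and int: "integrable (restrict_space lborel {0..1}) (\<lambda>x. (cmod (f x))\<^sup>2)"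
  shows "trig_approximable f"
proof (rule trig_approximable_limit[where fn = "\<lambda>n x. if cmod (f x) \<le> real n then f x else 0" and w = "\<lambda>x. (cmod (f x))\<^sup>2"])
  show "trig_approximable (\<lambda>x. if cmod (f x) \<le> real n then f x else 0)" for n
    by (rule trig_approximable_bounded[where B = "real n + 1"]) auto
  show "AE x in restrict_space lborel {0..1}. (\<lambda>n. if cmod (f x) \<le> real n then f x else 0) \<longlonglongrightarrow> f x"
  proof (intro AE_I2 tendsto_eventually)
    fix x
    obtain n0 :: nat where "cmod (f x) \<le> real n0" using real_arch_simple by blast
    then show "\<forall>\<^sub>F n in sequentially. (if cmod (f x) \<le> real n then f x else 0) = f x"
      unfolding eventually_sequentially by (intro exI[of _ n0]) auto
  qed
qed (use int in \<open>auto intro!: measurable_restrict_space1\<close>)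

section \<open>A criterion for spectral sets\<close>

lemma norm_sum_squared_le:
  fixes f :: "'a \<Rightarrow> complex"
  shows "(cmod (\<Sum>i\<in>I. f i))\<^sup>2 \<le> (\<Sum>i\<in>I. (cmod (f i))\<^sup>2) * card I"
proof -
  have "(cmod (\<Sum>i\<in>I. f i))\<^sup>2 \<le> (\<Sum>i\<in>I. cmod (f i))\<^sup>2"
    by (intro power_mono norm_sum) simp
  also have "\<dots> \<le> (\<Sum>i\<in>I. (cmod (f i))\<^sup>2) * card I" by (rule sum_squared_le_sum_of_squares)
  finally show ?thesis .
qed

lemma integrable_unit_interval_iff:
  fixes f :: "real \<Rightarrow> real"
  shows "integrable (restrict_space lborel {0..1}) f \<longleftrightarrow> integrable lborel (\<lambda>x. indicator {0..1} x * f x)"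
  by (subst integrable_restrict_space) auto

lemma integral_unit_interval:
  fixes f :: "real \<Rightarrow> real"
  shows "(\<integral>x. f x \<partial>restrict_space lborel {0..1}) = (\<integral>x. indicator {0..1} x * f x \<partial>lborel)"
  by (subst integral_restrict_space) auto

text \<open>A point \<open>y + j\<close> of \<open>\<Omega>\<close> with \<open>y \<in> [0, 1]\<close> is separated from the other points of
  \<open>\<Omega>\<close> in \<open>y + \<int>\<close> by the frequencies \<open>B\<close>, so \<open>h\<close> is a combination of the exponentials in \<open>B\<close>
  with \<open>1\<close>-periodic coefficients \<open>\<phi>\<close>; these are approximated by trigonometric polynomials.\<close>

lemma exponentials_approx:
  fixes h :: "real \<Rightarrow> complex"
  assumes comp: "compact \<Omega>" and B: "finite B" "B \<noteq> {}"
    and null: "\<And>k. k \<noteq> 0 \<Longrightarrow> (\<Sum>\<beta>\<in>B. unit_exp (\<beta> * of_int k)) = 0 \<or> \<Omega> \<inter> (+) (of_int k) ` \<Omega> \<in> null_sets lborel"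
    and h [measurable]: "h \<in> borel_measurable borel" and h0: "\<And>x. x \<notin> \<Omega> \<Longrightarrow> h x = 0"
    and int: "integrable lborel (\<lambda>x. (cmod (h x))\<^sup>2)" and e: "e > 0"
  obtains p where "\<And>\<beta>. \<beta> \<in> B \<Longrightarrow> p \<beta> \<in> trig_polys"
    "(\<integral>x. indicat_real \<Omega> x * (cmod (h x - (\<Sum>\<beta>\<in>B. unit_exp (\<beta> * x) * p \<beta> x)))\<^sup>2 \<partial>lborel) < e"
proof -
  note [measurable] = borel_compact[OF comp]
  let ?U = "restrict_space lborel {0..1 :: real}"
  obtain R where R: "\<And>x. x \<in> \<Omega> \<Longrightarrow> \<bar>x\<bar> \<le> R"
    using compact_imp_bounded[OF comp] unfolding bounded_iff by auto
  define K where "K = \<lceil>\<bar>R\<bar>\<rceil> + 1"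
  have K: "K > 0" "\<bar>R\<bar> + 1 \<le> of_int K" unfolding K_def by linarith+
  define q where "q = card B"
  have q: "q > 0" using B by (simp add: q_def card_gt_0_iff)
  \<comment> \<open>The Fourier coefficient of \<open>h\<close> on the fibre
    \<open>y + \<int>\<close>. For \<open>y\<close> in the unit interval, \<open>K\<close> is large
    enough that the sum loses no point of \<open>\<Omega>\<close> there.\<close>
  define \<phi> where "\<phi> \<beta> y = (\<Sum>k\<in>{-K..K}. h (of_int k + 1 * y) * unit_exp (- \<beta> * (of_int k + 1 * y))) / of_nat q" for \<beta> y
  have [measurable]: "\<phi> \<beta> \<in> borel_measurable borel" for \<beta> unfolding \<phi>_def by measurable
  have int_shift: "integrable lborel (\<lambda>y. (cmod (h (of_int k + 1 * y)))\<^sup>2)" for k :: int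
    using lborel_integrable_real_affine[OF int, of 1 "of_int k"] by simp
  have "integrable ?U (\<lambda>y. (cmod (\<phi> \<beta> y))\<^sup>2)" for \<beta>
    unfolding integrable_unit_interval_iff
  proof (rule Bochner_Integration.integrable_bound)
    show "integrable lborel (\<lambda>y. (\<Sum>k\<in>{-K..K}. (cmod (h (of_int k + 1 * y)))\<^sup>2) * card {-K..K})"
      using int_shift by (intro integrable_mult_left Bochner_Integration.integrable_sum)
    have "indicator {0..1} y * (cmod (\<phi> \<beta> y))\<^sup>2 \<le> (\<Sum>k\<in>{-K..K}. (cmod (h (of_int k + 1 * y)))\<^sup>2) * card {-K..K}" for y
    proof -
      have "(cmod (\<phi> \<beta> y))\<^sup>2 \<le> (cmod (\<Sum>k\<in>{-K..K}. h (of_int k + 1 * y) * unit_exp (- \<beta> * (of_int k + 1 * y))))\<^sup>2"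
        using q by (intro power_mono) (auto simp: \<phi>_def norm_divide divide_le_eq mult_le_cancel_left1)
      also have "\<dots> \<le> (\<Sum>k\<in>{-K..K}. (cmod (h (of_int k + 1 * y)))\<^sup>2) * card {-K..K}"
        using norm_sum_squared_le[of "\<lambda>k. h (of_int k + 1 * y) * unit_exp (- \<beta> * (of_int k + 1 * y))" "{-K..K}"]
        by (simp add: norm_mult)
      finally show ?thesis by (auto simp: indicator_def sum_nonneg)
    qed
    then show "AE y in lborel. norm (indicator {0..1} y * (cmod (\<phi> \<beta> y))\<^sup>2)
       \<le> norm ((\<Sum>k\<in>{-K..K}. (cmod (h (of_int k + 1 * y)))\<^sup>2) * card {-K..K})"
      by (intro AE_I2) (simp add: abs_mult sum_nonneg)
  qed measurable
  then have approx: "trig_approximable (\<phi> \<beta>)" for \<beta>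
    by (intro trig_approximable_square_integrable) auto
  \<comment> \<open>One factor \<open>q\<close> pays for the Cauchy-Schwarz inequality, the other
    for the sum over \<open>B\<close>, and the cardinality for the unit cells that meet
    \<open>\<Omega>\<close>.\<close>
  define e' where "e' = e / (real (card {-K..K}) * real q * real q)"
  have cK: "card {-K..K} > 0" using K by (simp add: card_gt_0_iff)
  have e': "e' > 0" unfolding e'_def using cK q e by (intro divide_pos_pos mult_pos_pos) auto
  have "\<exists>p\<in>trig_polys. integrable ?U (\<lambda>x. (cmod (\<phi> \<beta> x - p x))\<^sup>2) \<and> (\<integral>x. (cmod (\<phi> \<beta> x - p x))\<^sup>2 \<partial>?U) < e'" for \<beta>
    using approx e' unfolding trig_approximable_def by blast
  then have "\<forall>\<beta>. \<exists>p. p \<in> trig_polys \<and> integrable ?U (\<lambda>x. (cmod (\<phi> \<beta> x - p x))\<^sup>2) \<and> (\<integral>x. (cmod (\<phi> \<beta> x - p x))\<^sup>2 \<partial>?U) < e'"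
    by blast
  from choice[OF this] obtain p where p: "\<And>\<beta>. p \<beta> \<in> trig_polys" "\<And>\<beta>. integrable ?U (\<lambda>x. (cmod (\<phi> \<beta> x - p \<beta> x))\<^sup>2)"
    "\<And>\<beta>. (\<integral>x. (cmod (\<phi> \<beta> x - p \<beta> x))\<^sup>2 \<partial>?U) < e'" by blast
  have [measurable]: "p \<beta> \<in> borel_measurable borel" for \<beta>
    using continuous_on_trig_polys[OF p(1)] by (rule borel_measurable_continuous_onI)
  let ?P = "\<lambda>x. \<Sum>\<beta>\<in>B. unit_exp (\<beta> * x) * p \<beta> x"
  let ?d = "\<lambda>\<beta> y. indicat_real {0..1} y * (cmod (\<phi> \<beta> y - p \<beta> y))\<^sup>2"
  \<comment> \<open>A majorant of the error on \<open>\<Omega>\<close>; the summand \<open>j\<close>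
    takes care of the points between \<open>j\<close> and \<open>j + 1\<close>.\<close>
  let ?G = "\<lambda>x. \<Sum>j\<in>{-K..K}. real q * (\<Sum>\<beta>\<in>B. ?d \<beta> (- of_int j + 1 * x))"
  have "AE x in lborel. \<forall>k. k \<noteq> 0 \<longrightarrow> (\<Sum>\<beta>\<in>B. unit_exp (\<beta> * of_int k)) = 0 \<or> x \<notin> \<Omega> \<inter> (+) (of_int k) ` \<Omega>"
    unfolding AE_all_countable
  proof
    fix k :: int
    show "AE x in lborel. k \<noteq> 0 \<longrightarrow> (\<Sum>\<beta>\<in>B. unit_exp (\<beta> * of_int k)) = 0 \<or> x \<notin> \<Omega> \<inter> (+) (of_int k) ` \<Omega>"
    proof (cases "k \<noteq> 0 \<and> (\<Sum>\<beta>\<in>B. unit_exp (\<beta> * of_int k)) \<noteq> 0")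
      case True
      then have "\<Omega> \<inter> (+) (of_int k) ` \<Omega> \<in> null_sets lborel" using null by blast
      from AE_not_in[OF this] show ?thesis by eventually_elim simp
    qed auto
  qed
  then have bound: "AE x in lborel. indicat_real \<Omega> x * (cmod (h x - ?P x))\<^sup>2 \<le> ?G x"
  proof eventually_elim
    case (elim x)
    have G0: "?G x \<ge> 0" by (intro sum_nonneg mult_nonneg_nonneg) auto
    show ?case
    proof (cases "x \<in> \<Omega>")
      case True
      define j where "j = \<lfloor>x\<rfloor>"
      define y where "y = frac x"
      have x: "x = of_int j + 1 * y" by (simp add: j_def y_def frac_def)
      have y: "0 \<le> y" "y < 1" by (simp_all add: y_def frac_lt_1)
      have j: "j \<in> {-K..K}" using R[OF True] K y x by (simp add: abs_le_iff)
      have orth: "h (of_int k + 1 * y) * (\<Sum>\<beta>\<in>B. unit_exp (\<beta> * of_int (j - k))) = (if k = j then h x * of_nat q else 0)" for k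
      proof (cases "k = j")
        case True
        then show ?thesis by (simp add: q_def x)
      next
        case False
        have "x \<in> \<Omega> \<inter> (+) (of_int (j - k)) ` \<Omega>" if "of_int k + 1 * y \<in> \<Omega>"
          using \<open>x \<in> \<Omega>\<close> that by (auto simp: x intro!: image_eqI[of _ _ "of_int k + 1 * y"])
        then have "of_int k + 1 * y \<notin> \<Omega> \<or> (\<Sum>\<beta>\<in>B. unit_exp (\<beta> * of_int (j - k))) = 0"
          using elim[rule_format, of "j - k"] False by auto
        then show ?thesis using False h0 by auto
      qed
      have "(\<Sum>\<beta>\<in>B. unit_exp (\<beta> * x) * \<phi> \<beta> y)
         = (\<Sum>\<beta>\<in>B. \<Sum>k\<in>{-K..K}. h (of_int k + 1 * y) * unit_exp (\<beta> * of_int (j - k))) / of_nat q"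
        unfolding \<phi>_def sum_divide_distrib times_divide_eq_right sum_distrib_left
      proof (intro sum.cong refl arg_cong2[where f = "(/)"])
        fix \<beta> k
        have "\<beta> * of_int (j - k) = \<beta> * x + - \<beta> * (of_int k + 1 * y)" by (simp add: x algebra_simps)
        then show "unit_exp (\<beta> * x) * (h (of_int k + 1 * y) * unit_exp (- \<beta> * (of_int k + 1 * y)))
          = h (of_int k + 1 * y) * unit_exp (\<beta> * of_int (j - k))"
          by (simp only: unit_exp_add mult_ac)
      qed
      also have "(\<Sum>\<beta>\<in>B. \<Sum>k\<in>{-K..K}. h (of_int k + 1 * y) * unit_exp (\<beta> * of_int (j - k)))
         = (\<Sum>k\<in>{-K..K}. h (of_int k + 1 * y) * (\<Sum>\<beta>\<in>B. unit_exp (\<beta> * of_int (j - k))))"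
        by (subst sum.swap) (simp only: sum_distrib_left)
      also have "\<dots> = h x * of_nat q" unfolding orth using j by simp
      finally have hx: "h x = (\<Sum>\<beta>\<in>B. unit_exp (\<beta> * x) * \<phi> \<beta> y)" using q by simp
      have "p \<beta> x = p \<beta> y" for \<beta> using trig_polys_add_int[OF p(1), of \<beta> y j] by (simp add: x add.commute)
      then have "h x - ?P x = (\<Sum>\<beta>\<in>B. unit_exp (\<beta> * x) * (\<phi> \<beta> y - p \<beta> y))"
        unfolding hx by (simp add: right_diff_distrib sum_subtractf)
      then have "(cmod (h x - ?P x))\<^sup>2 \<le> (\<Sum>\<beta>\<in>B. (cmod (\<phi> \<beta> y - p \<beta> y))\<^sup>2) * real q"
        using norm_sum_squared_le[of "\<lambda>\<beta>. unit_exp (\<beta> * x) * (\<phi> \<beta> y - p \<beta> y)" B]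
        by (simp add: norm_mult q_def)
      also have "\<dots> = real q * (\<Sum>\<beta>\<in>B. ?d \<beta> (- of_int j + 1 * x))"
        using y by (simp add: x)
      also have "\<dots> \<le> ?G x"
        by (rule member_le_sum[OF j]) (auto intro!: sum_nonneg mult_nonneg_nonneg)
      finally show ?thesis using True by simp
    qed (use G0 in simp)
  qed
  have d: "integrable lborel (?d \<beta>)" "integral\<^sup>L lborel (?d \<beta>) < e'" for \<beta>
    using p(2,3)[of \<beta>] unfolding integrable_unit_interval_iff integral_unit_interval by auto
  have d_shift: "integrable lborel (\<lambda>x. ?d \<beta> (- of_int j + 1 * x))"
      "(\<integral>x. ?d \<beta> (- of_int j + 1 * x) \<partial>lborel) = integral\<^sup>L lborel (?d \<beta>)" for \<beta> and j :: int
    using lborel_integrable_real_affine[OF d(1), of 1 "- of_int j"]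
      lborel_integral_real_affine[of 1 "?d \<beta>" "- of_int j"] by auto
  have intG: "integrable lborel ?G"
    by (intro Bochner_Integration.integrable_sum integrable_mult_right d_shift)
  have "(\<integral>x. indicat_real \<Omega> x * (cmod (h x - ?P x))\<^sup>2 \<partial>lborel) \<le> integral\<^sup>L lborel ?G"
  proof (rule integral_mono_AE[OF _ intG bound])
    show "integrable lborel (\<lambda>x. indicat_real \<Omega> x * (cmod (h x - ?P x))\<^sup>2)"
      by (rule Bochner_Integration.integrable_bound[OF intG]) (use bound in \<open>auto elim!: eventually_mono\<close>)
  qed
  also have "integral\<^sup>L lborel ?G = (\<Sum>j\<in>{-K..K}. real q * (\<Sum>\<beta>\<in>B. integral\<^sup>L lborel (?d \<beta>)))"
    using d_shift by (simp only: Bochner_Integration.integral_sum integral_mult_right_zero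
        Bochner_Integration.integrable_sum integrable_mult_right)
  also have "\<dots> = real (card {-K..K}) * (real q * (\<Sum>\<beta>\<in>B. integral\<^sup>L lborel (?d \<beta>)))" by (simp only: sum_constant)
  also have "\<dots> < real (card {-K..K}) * (real q * (\<Sum>\<beta>\<in>B. e'))"
    using cK q B d(2) by (intro mult_strict_left_mono sum_strict_mono) auto
  also have "\<dots> = e" using cK q by (simp only: e'_def sum_constant q_def[symmetric]) simp
  finally show ?thesis using that p(1) by blast
qed

text \<open>A basis is a set of functions, not a family: coefficients of indices that yield the same
  function have to be added up.\<close>

lemma sum_as_combination:
  fixes g :: "'i \<Rightarrow> real \<Rightarrow> complex"
  assumes "finite I"
  obtains c where "\<And>x. (\<Sum>i\<in>I. a i * g i x) = (\<Sum>e\<in>g ` I. c e * e x)"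
proof -
  have "(\<Sum>i\<in>I. a i * g i x) = (\<Sum>e\<in>g ` I. (\<Sum>i\<in>{i \<in> I. g i = e}. a i) * e x)" for x
    unfolding sum.image_gen[OF assms, of _ g] sum_distrib_right
    by (intro sum.cong refl) auto
  then show ?thesis by (rule that[of "\<lambda>e. \<Sum>i\<in>{i \<in> I. g i = e}. a i"])
qed

lemma integrable_scaleR_right_iff:
  fixes f :: "'a \<Rightarrow> 'b :: {banach, second_countable_topology}"
  assumes "c \<noteq> 0"
  shows "integrable M (\<lambda>x. c *\<^sub>R f x) \<longleftrightarrow> integrable M f"
  using integrable_scaleR_right[of "1 / c" M "\<lambda>x. c *\<^sub>R f x"] assms by auto

context
  fixes \<Omega> :: "real set"
  assumes comp: "compact \<Omega>" and pos: "measure lborel \<Omega> > 0"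
begin

lemma emeasure_lebesgue_compact: "emeasure lebesgue \<Omega> = ennreal (measure lborel \<Omega>)"
  using emeasure_compact_finite[OF comp] borel_compact[OF comp]
  by (simp add: emeasure_eq_ennreal_measure)

lemma uniform_measure_eq_density:
  "uniform_measure lebesgue \<Omega> = density lebesgue (\<lambda>x. ennreal (indicat_real \<Omega> x / measure lborel \<Omega>))"
  unfolding uniform_measure_def emeasure_lebesgue_compact
  using pos by (intro arg_cong2[where f = density] refl ext) (auto simp: indicator_def divide_ennreal[symmetric])

lemma indicator_measurable_lebesgue: "(\<lambda>x. indicat_real \<Omega> x / measure lborel \<Omega>) \<in> borel_measurable lebesgue"
  using borel_compact[OF comp] by (intro borel_measurable_divide borel_measurable_indicator) auto

lemma integral_uniform_measure:
  fixes f :: "real \<Rightarrow> 'b :: {banach, second_countable_topology}"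
  assumes "f \<in> borel_measurable lebesgue"
  shows "(\<integral>x. f x \<partial>uniform_measure lebesgue \<Omega>) = (\<integral>x. indicat_real \<Omega> x *\<^sub>R f x \<partial>lebesgue) /\<^sub>R measure lborel \<Omega>"
proof -
  have "(\<integral>x. f x \<partial>uniform_measure lebesgue \<Omega>) = (\<integral>x. (indicat_real \<Omega> x / measure lborel \<Omega>) *\<^sub>R f x \<partial>lebesgue)"
    unfolding uniform_measure_eq_density using pos
    by (intro integral_density assms indicator_measurable_lebesgue) auto
  also have "\<dots> = (\<integral>x. (1 / measure lborel \<Omega>) *\<^sub>R (indicat_real \<Omega> x *\<^sub>R f x) \<partial>lebesgue)"
    by (intro Bochner_Integration.integral_cong) auto
  also have "\<dots> = (\<integral>x. indicat_real \<Omega> x *\<^sub>R f x \<partial>lebesgue) /\<^sub>R measure lborel \<Omega>"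
    unfolding Bochner_Integration.integral_scaleR_right by (simp only: inverse_eq_divide)
  finally show ?thesis .
qed

lemma integrable_uniform_measure:
  fixes f :: "real \<Rightarrow> 'b :: {banach, second_countable_topology}"
  assumes "f \<in> borel_measurable lebesgue"
  shows "integrable (uniform_measure lebesgue \<Omega>) f \<longleftrightarrow> integrable lebesgue (\<lambda>x. indicat_real \<Omega> x *\<^sub>R f x)"
proof -
  have "integrable (uniform_measure lebesgue \<Omega>) f \<longleftrightarrow> integrable lebesgue (\<lambda>x. (indicat_real \<Omega> x / measure lborel \<Omega>) *\<^sub>R f x)"
    unfolding uniform_measure_eq_density using pos
    by (intro integrable_density assms indicator_measurable_lebesgue) auto
  also have "\<dots> \<longleftrightarrow> integrable lebesgue (\<lambda>x. (1 / measure lborel \<Omega>) *\<^sub>R (indicat_real \<Omega> x *\<^sub>R f x))"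
    by (intro Bochner_Integration.integrable_cong) auto
  also have "\<dots> \<longleftrightarrow> integrable lebesgue (\<lambda>x. indicat_real \<Omega> x *\<^sub>R f x)"
    using pos by (intro integrable_scaleR_right_iff) simp
  finally show ?thesis .
qed

lemma L2_inner_unit_exp:
  "L2_inner (uniform_measure lebesgue \<Omega>) (\<lambda>x. unit_exp (l * x)) (\<lambda>x. unit_exp (l' * x))
   = fourier \<Omega> (l - l') / measure lborel \<Omega>"
proof -
  note [measurable] = borel_compact[OF comp]
  have "L2_inner (uniform_measure lebesgue \<Omega>) (\<lambda>x. unit_exp (l * x)) (\<lambda>x. unit_exp (l' * x))
    = (\<integral>x. unit_exp ((l - l') * x) \<partial>uniform_measure lebesgue \<Omega>)"
    unfolding L2_inner_def
    by (intro Bochner_Integration.integral_cong refl) (simp add: left_diff_distrib unit_exp_diff)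
  also have "\<dots> = (\<integral>x. indicat_real \<Omega> x *\<^sub>R unit_exp ((l - l') * x) \<partial>lebesgue) /\<^sub>R measure lborel \<Omega>"
    by (intro integral_uniform_measure measurable_completion) simp
  also have "(\<integral>x. indicat_real \<Omega> x *\<^sub>R unit_exp ((l - l') * x) \<partial>lebesgue) = fourier \<Omega> (l - l')"
    unfolding fourier_def by (intro integral_completion) simp
  finally show ?thesis by (simp add: scaleR_conv_of_real divide_inverse mult.commute)
qed

text \<open>The spectrum is \<open>B + \<int>\<close>. \<open>orth\<close> makes its exponentials
  orthonormal, and \<open>null\<close> makes them complete through
  \<open>exponentials_approx\<close>.\<close>

lemma spectral_setI:
  assumes B: "finite B" "B \<noteq> {}"
    and orth: "\<And>\<beta> \<beta>' n. \<beta> \<in> B \<Longrightarrow> \<beta>' \<in> B \<Longrightarrow> \<beta> - \<beta>' + of_int n \<noteq> 0 \<Longrightarrow> fourier \<Omega> (\<beta> - \<beta>' + of_int n) = 0"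
    and null: "\<And>k. k \<noteq> 0 \<Longrightarrow> (\<Sum>\<beta>\<in>B. unit_exp (\<beta> * of_int k)) = 0 \<or> \<Omega> \<inter> (+) (of_int k) ` \<Omega> \<in> null_sets lborel"
  shows "spectral_set \<Omega>"
proof -
  note [measurable] = borel_compact[OF comp]
  let ?M = "uniform_measure lebesgue \<Omega>"
  define \<Lambda> where "\<Lambda> = (\<lambda>(\<beta>, n). \<beta> + real_of_int n) ` (B \<times> UNIV)"
  define E where "E = (\<lambda>l x. unit_exp (l * x)) ` \<Lambda>"
  have E_eq: "{(\<lambda>x. exp (2 * complex_of_real pi * \<i> * complex_of_real (l * x))) | l. l \<in> \<Lambda>} = E"
    by (auto simp: E_def exp_eq_unit_exp simp del: of_real_mult)
  have meas: "(\<lambda>x. unit_exp (l * x)) \<in> borel_measurable lebesgue" for l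
    by (intro measurable_completion) simp
  have sub: "E \<subseteq> L2_functions ?M"
  proof
    fix f assume "f \<in> E"
    then obtain l where f: "f = (\<lambda>x. unit_exp (l * x))" by (auto simp: E_def)
    have "integrable lebesgue (\<lambda>x. indicat_real \<Omega> x *\<^sub>R (1 :: real))"
      using integrable_completion[of "indicat_real \<Omega>" lborel] integrable_indicator_compact[OF comp] by simp
    then have "integrable ?M (\<lambda>x. 1 :: real)" by (subst integrable_uniform_measure) auto
    then show "f \<in> L2_functions ?M" using meas
      by (simp add: L2_functions_def f measurable_cong_sets[OF sets_uniform_measure refl])
  qed
  have inner: "L2_inner ?M f g = (if f = g then 1 else 0)" if fg: "f \<in> E" "g \<in> E" for f g
  proof -
    obtain l l' where l: "l \<in> \<Lambda>" "l' \<in> \<Lambda>" "f = (\<lambda>x. unit_exp (l * x))" "g = (\<lambda>x. unit_exp (l' * x))"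
      using fg by (auto simp: E_def)
    show ?thesis
    proof (cases "f = g")
      case True
      then have "L2_inner ?M f g = L2_inner ?M f f" by simp
      also have "\<dots> = 1" unfolding l(3) L2_inner_unit_exp using pos by (simp add: fourier_0)
      finally show ?thesis using True by simp
    next
      case False
      then have "l - l' \<noteq> 0" using l by auto
      obtain \<beta> \<beta>' n n' where \<beta>: "\<beta> \<in> B" "\<beta>' \<in> B" "l = \<beta> + of_int n" "l' = \<beta>' + of_int n'"
        using l(1,2) by (auto simp: \<Lambda>_def)
      have eq: "l - l' = \<beta> - \<beta>' + of_int (n - n')" by (simp add: \<beta>)
      have "fourier \<Omega> (l - l') = 0" using orth[OF \<beta>(1,2), of "n - n'"] \<open>l - l' \<noteq> 0\<close> unfolding eq by blast
      then show ?thesis using False unfolding l(3,4) L2_inner_unit_exp by simp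
    qed
  qed
  have dense: "\<exists>F c. finite F \<and> F \<subseteq> E \<and> L2_norm ?M (\<lambda>x. f x - (\<Sum>e\<in>F. c e * e x)) < \<epsilon>"
    if f: "f \<in> L2_functions ?M" and \<epsilon>: "\<epsilon> > 0" for f \<epsilon>
  proof -
    have fm [measurable]: "f \<in> borel_measurable lebesgue"
      using f by (simp add: L2_functions_def measurable_cong_sets[OF sets_uniform_measure refl])
    have "(\<lambda>x. Re (f x)) \<in> borel_measurable lebesgue" "(\<lambda>x. Im (f x)) \<in> borel_measurable lebesgue" by simp_all
    then obtain gr gi where g [measurable]: "gr \<in> borel_measurable lborel" "gi \<in> borel_measurable lborel"
      and ae: "AE x in lborel. Re (f x) = gr x" "AE x in lborel. Im (f x) = gi x"
      using completion_ex_borel_measurable_real by blast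
    \<comment> \<open>A Borel version of the Lebesgue measurable \<open>f\<close> on
      \<open>\<Omega>\<close>, zero elsewhere, as \<open>exponentials_approx\<close>
      expects.\<close>
    define h where "h x = indicat_real \<Omega> x *\<^sub>R (of_real (gr x) + \<i> * of_real (gi x))" for x
    have h [measurable]: "h \<in> borel_measurable borel" unfolding h_def using g by simp
    have [measurable]: "h \<in> borel_measurable lebesgue" "\<Omega> \<in> sets lebesgue" using h by (simp_all add: measurable_completion)
    have "AE x in lborel. h x = indicat_real \<Omega> x *\<^sub>R f x"
      using ae by eventually_elim (simp add: h_def complex_eq_iff)
    then have hf: "AE x in lebesgue. h x = indicat_real \<Omega> x *\<^sub>R f x" by (simp add: AE_completion_iff)
    have "integrable ?M (\<lambda>x. (cmod (f x))\<^sup>2)" using f by (simp add: L2_functions_def)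
    then have "integrable lebesgue (\<lambda>x. indicat_real \<Omega> x *\<^sub>R (cmod (f x))\<^sup>2)"
      by (subst (asm) integrable_uniform_measure) auto
    also have "?this \<longleftrightarrow> integrable lebesgue (\<lambda>x. (cmod (h x))\<^sup>2)"
    proof (rule integrable_cong_AE)
      show "AE x in lebesgue. indicat_real \<Omega> x *\<^sub>R (cmod (f x))\<^sup>2 = (cmod (h x))\<^sup>2"
        using hf by eventually_elim (auto simp: indicator_def)
    qed measurable
    also have "\<dots> \<longleftrightarrow> integrable lborel (\<lambda>x. (cmod (h x))\<^sup>2)" by (rule integrable_completion) simp
    finally have int: "integrable lborel (\<lambda>x. (cmod (h x))\<^sup>2)" .
    have "\<epsilon>\<^sup>2 * measure lborel \<Omega> > 0" using \<epsilon> pos by simp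
    then obtain p where p: "\<And>\<beta>. \<beta> \<in> B \<Longrightarrow> p \<beta> \<in> trig_polys"
      "(\<integral>x. indicat_real \<Omega> x * (cmod (h x - (\<Sum>\<beta>\<in>B. unit_exp (\<beta> * x) * p \<beta> x)))\<^sup>2 \<partial>lborel) < \<epsilon>\<^sup>2 * measure lborel \<Omega>"
      using exponentials_approx[OF comp B null h _ int] by (auto simp: h_def)
    have "\<forall>\<beta>\<in>B. \<exists>A c. finite A \<and> p \<beta> = (\<lambda>x. \<Sum>n\<in>A. c n * unit_exp (of_int n * x))"
    proof
      fix \<beta> assume "\<beta> \<in> B"
      from trig_polys_sum[OF p(1)[OF this]]
      show "\<exists>A c. finite A \<and> p \<beta> = (\<lambda>x. \<Sum>n\<in>A. c n * unit_exp (of_int n * x))" by metis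
    qed
    then obtain A c where A: "\<And>\<beta>. \<beta> \<in> B \<Longrightarrow> finite (A \<beta>)"
      "\<And>\<beta>. \<beta> \<in> B \<Longrightarrow> p \<beta> = (\<lambda>x. \<Sum>n\<in>A \<beta>. c \<beta> n * unit_exp (of_int n * x))" by metis
    let ?P = "\<lambda>x. \<Sum>\<beta>\<in>B. unit_exp (\<beta> * x) * p \<beta> x"
    let ?I = "Sigma B A" and ?g = "\<lambda>(\<beta>, n) x. unit_exp ((\<beta> + real_of_int n) * x)"
    have finI: "finite ?I" using B A by auto
    obtain d where d: "\<And>x. (\<Sum>i\<in>?I. (case i of (\<beta>, n) \<Rightarrow> c \<beta> n) * ?g i x) = (\<Sum>e\<in>?g ` ?I. d e * e x)"
      using sum_as_combination[OF finI] by blast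
    have P: "?P x = (\<Sum>e\<in>?g ` ?I. d e * e x)" for x
    proof -
      have "?P x = (\<Sum>\<beta>\<in>B. \<Sum>n\<in>A \<beta>. c \<beta> n * unit_exp ((\<beta> + real_of_int n) * x))"
        using A by (intro sum.cong refl) (simp add: sum_distrib_left distrib_right unit_exp_add mult.left_commute)
      also have "\<dots> = (\<Sum>i\<in>?I. (case i of (\<beta>, n) \<Rightarrow> c \<beta> n) * ?g i x)"
        using B A by (subst sum.Sigma) (auto intro!: sum.cong)
      finally show ?thesis by (simp only: d)
    qed
    have Pm: "?P \<in> borel_measurable borel"
      using continuous_on_trig_polys[OF p(1)] by (intro borel_measurable_continuous_onI continuous_intros) auto
    have Pm' [measurable]: "?P \<in> borel_measurable lebesgue" using Pm by (simp add: measurable_completion)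
    have "(\<integral>x. (cmod (f x - ?P x))\<^sup>2 \<partial>?M)
      = (\<integral>x. indicat_real \<Omega> x *\<^sub>R (cmod (f x - ?P x))\<^sup>2 \<partial>lebesgue) /\<^sub>R measure lborel \<Omega>"
      using Pm' by (intro integral_uniform_measure) simp
    also have "(\<integral>x. indicat_real \<Omega> x *\<^sub>R (cmod (f x - ?P x))\<^sup>2 \<partial>lebesgue)
      = (\<integral>x. indicat_real \<Omega> x * (cmod (h x - ?P x))\<^sup>2 \<partial>lebesgue)"
    proof (rule integral_cong_AE)
      show "AE x in lebesgue. indicat_real \<Omega> x *\<^sub>R (cmod (f x - ?P x))\<^sup>2 = indicat_real \<Omega> x * (cmod (h x - ?P x))\<^sup>2"
        using hf by eventually_elim (auto simp: indicator_def)
    qed measurable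
    also have "\<dots> = (\<integral>x. indicat_real \<Omega> x * (cmod (h x - ?P x))\<^sup>2 \<partial>lborel)"
      using Pm by (intro integral_completion) simp
    also have "\<dots> /\<^sub>R measure lborel \<Omega> < \<epsilon>\<^sup>2"
    proof -
      have "(\<integral>x. indicat_real \<Omega> x * (cmod (h x - ?P x))\<^sup>2 \<partial>lborel) / measure lborel \<Omega> < \<epsilon>\<^sup>2"
        using p(2) pos by (simp only: pos_divide_less_eq)
      then show ?thesis by (simp only: real_scaleR_def divide_inverse mult.commute)
    qed
    finally have "sqrt (\<integral>x. (cmod (f x - ?P x))\<^sup>2 \<partial>?M) < sqrt (\<epsilon>\<^sup>2)" by (rule real_sqrt_less_mono)
    then have "L2_norm ?M (\<lambda>x. f x - ?P x) < \<epsilon>" unfolding L2_norm_def using \<epsilon> by simp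
    then have "L2_norm ?M (\<lambda>x. f x - (\<Sum>e\<in>?g ` ?I. d e * e x)) < \<epsilon>" by (simp only: P)
    moreover have "?g ` ?I \<subseteq> E" by (force simp: E_def \<Lambda>_def)
    ultimately show ?thesis using finI by blast
  qed
  have "L2_orthonormal_basis ?M E"
    unfolding L2_orthonormal_basis_def by (intro conjI ballI allI impI sub inner dense)
  moreover have "countable \<Lambda>" unfolding \<Lambda>_def using B by (intro countable_image countable_SIGMA) (auto intro: countable_finite)
  moreover have "\<Omega> \<in> sets lebesgue" by simp
  ultimately show ?thesis
    unfolding spectral_set_def using E_eq pos by (auto simp: emeasure_lebesgue_compact)
qed

end

section \<open>Scaling and the equivalence\<close>

lemma measurable_divide_lebesgue: "(\<lambda>x :: real. x / c) \<in> lebesgue \<rightarrow>\<^sub>M lebesgue"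
proof -
  have "(\<lambda>x :: real. x / c) = (*\<^sub>R) (1 / c)" by (simp add: fun_eq_iff)
  then show ?thesis by (simp only: lebesgue_measurable_scaling)
qed

lemma null_sets_lborelI: "A \<in> null_sets lebesgue \<Longrightarrow> A \<in> sets borel \<Longrightarrow> A \<in> null_sets lborel"
  by (simp add: null_sets_def)

lemma uniform_measure_divide:
  fixes S :: "real set"
  assumes S: "S \<in> sets lebesgue" "emeasure lebesgue S > 0" "emeasure lebesgue S < \<infinity>" and c: "c > 0"
  shows "(\<lambda>x. x / c) ` S \<in> sets lebesgue"
    and "emeasure lebesgue ((\<lambda>x. x / c) ` S) = ennreal (1 / c) * emeasure lebesgue S"
    and "uniform_measure lebesgue ((\<lambda>x. x / c) ` S) = distr (uniform_measure lebesgue S) lebesgue (\<lambda>x. x / c)"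
proof -
  let ?D = "\<lambda>x. x / c"
  have D [measurable]: "?D \<in> lebesgue \<rightarrow>\<^sub>M lebesgue" by (rule measurable_divide_lebesgue)
  have "(\<lambda>x. c * x) \<in> lebesgue \<rightarrow>\<^sub>M lebesgue"
    using measurable_divide_lebesgue[of "1 / c"] by (simp add: mult.commute)
  from measurable_sets[OF this S(1)] have "(\<lambda>x. c * x) -` S \<in> sets lebesgue" by simp
  also have "(\<lambda>x. c * x) -` S = ?D ` S"
    using c by (auto simp: image_iff field_simps)
  finally show A: "?D ` S \<in> sets lebesgue" .
  have em: "emeasure lebesgue (?D ` X) = ennreal (1 / c) * emeasure lebesgue X" for X
    using emeasure_lebesgue_affine[of "1 / c" 0 X] c by simp
  then show "emeasure lebesgue (?D ` S) = ennreal (1 / c) * emeasure lebesgue S" .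
  show "uniform_measure lebesgue (?D ` S) = distr (uniform_measure lebesgue S) lebesgue ?D"
  proof (rule measure_eqI)
    fix X assume "X \<in> sets (uniform_measure lebesgue (?D ` S))"
    then have X: "X \<in> sets lebesgue" by simp
    have D': "?D \<in> uniform_measure lebesgue S \<rightarrow>\<^sub>M lebesgue" using D by simp
    have X': "?D -` X \<in> sets lebesgue" using measurable_sets[OF D X] by simp
    have "emeasure (distr (uniform_measure lebesgue S) lebesgue ?D) X
      = emeasure lebesgue (S \<inter> ?D -` X) / emeasure lebesgue S"
      using emeasure_distr[OF D' X] emeasure_uniform_measure[OF S(1) X'] by simp
    moreover have "?D ` S \<inter> X = ?D ` (S \<inter> ?D -` X)" by auto
    then have "emeasure (uniform_measure lebesgue (?D ` S)) X
      = (ennreal (1 / c) * emeasure lebesgue (S \<inter> ?D -` X)) / (ennreal (1 / c) * emeasure lebesgue S)"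
      using emeasure_uniform_measure[OF A X] by (simp only: em)
    moreover have "(ennreal (1 / c) * a) / (ennreal (1 / c) * b) = a / b" for a b
      using c divide_mult_eq[of "ennreal (1 / c)" a b] by (simp add: mult.commute)
    ultimately show "emeasure (uniform_measure lebesgue (?D ` S)) X = emeasure (distr (uniform_measure lebesgue S) lebesgue ?D) X"
      by simp
  qed simp
qed

text \<open>The dilation carries one normalized measure to the other, so composition with it
  preserves inner products and norms; frequencies are multiplied by \<open>c\<close> to
  compensate.\<close>

lemma spectral_set_divide:
  assumes "spectral_set S" and c: "c > 0"
  shows "spectral_set ((\<lambda>x. x / c) ` S)"
proof -
  let ?D = "\<lambda>x :: real. x / c" and ?A = "(\<lambda>x. x / c) ` S"
  define ch where "ch l = (\<lambda>x. exp (2 * complex_of_real pi * \<i> * complex_of_real (l * x)))" for l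
  have S: "S \<in> sets lebesgue" "emeasure lebesgue S > 0" "emeasure lebesgue S < \<infinity>"
    using assms by (auto simp: spectral_set_def)
  obtain \<Lambda> where \<Lambda>: "countable \<Lambda>" "L2_orthonormal_basis (uniform_measure lebesgue S) {ch l | l. l \<in> \<Lambda>}"
    using assms(1) unfolding spectral_set_def ch_def by blast
  define \<Lambda>' where "\<Lambda>' = (\<lambda>l. c * l) ` \<Lambda>"
  let ?M = "uniform_measure lebesgue S" and ?M' = "uniform_measure lebesgue ?A"
  let ?E = "{ch l | l. l \<in> \<Lambda>}" and ?E' = "{ch l | l. l \<in> \<Lambda>'}"
  note um = uniform_measure_divide[OF S c]
  have D: "?D \<in> ?M \<rightarrow>\<^sub>M lebesgue"
    by (simp add: measurable_divide_lebesgue measurable_cong_sets[OF sets_uniform_measure refl])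
  have D_sets: "sets ?M' = sets lebesgue" by simp
  have ch: "ch (c * l) \<circ> ?D = ch l" for l using c by (auto simp: ch_def)
  have ch_meas: "ch l \<in> borel_measurable lebesgue" for l
  proof -
    have "ch l \<in> borel_measurable borel" unfolding ch_def by (intro borel_measurable_continuous_onI continuous_intros)
    then show ?thesis by (simp add: measurable_completion)
  qed
  have integrable_iff: "integrable ?M' f \<longleftrightarrow> integrable ?M (\<lambda>x. f (?D x))" if "f \<in> borel_measurable lebesgue" for f :: "real \<Rightarrow> real"
    unfolding um(3) by (rule integrable_distr_eq[OF D that])
  have integral: "(\<integral>x. f x \<partial>?M') = (\<integral>x. f (?D x) \<partial>?M)" if "f \<in> borel_measurable lebesgue"
    for f :: "real \<Rightarrow> 'b :: {banach, second_countable_topology}"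
    unfolding um(3) by (rule integral_distr[OF D that])
  have L2: "f \<circ> ?D \<in> L2_functions ?M" if "f \<in> L2_functions ?M'" for f
  proof -
    have f: "f \<in> borel_measurable lebesgue" "integrable ?M' (\<lambda>x. (cmod (f x))\<^sup>2)"
      using that by (simp_all add: L2_functions_def measurable_cong_sets[OF D_sets refl])
    have "f \<circ> ?D \<in> borel_measurable ?M" using measurable_comp[OF D f(1)] .
    moreover have "integrable ?M (\<lambda>x. (cmod (f (?D x)))\<^sup>2)" using f by (subst (asm) integrable_iff) auto
    ultimately show ?thesis by (simp add: L2_functions_def)
  qed
  have E: "?E \<subseteq> L2_functions ?M" "\<And>f g. f \<in> ?E \<Longrightarrow> g \<in> ?E \<Longrightarrow> L2_inner ?M f g = (if f = g then 1 else 0)"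
    "\<And>f \<epsilon>. f \<in> L2_functions ?M \<Longrightarrow> \<epsilon> > 0 \<Longrightarrow> \<exists>F c. finite F \<and> F \<subseteq> ?E \<and> L2_norm ?M (\<lambda>x. f x - (\<Sum>e\<in>F. c e * e x)) < \<epsilon>"
    using \<Lambda>(2) unfolding L2_orthonormal_basis_def by blast+
  have E': "f \<in> borel_measurable lebesgue \<and> f \<circ> ?D \<in> ?E" if f: "f \<in> ?E'" for f
  proof -
    obtain l where "l \<in> \<Lambda>" "f = ch (c * l)" using f unfolding \<Lambda>'_def by blast
    then show ?thesis using ch_meas ch by auto
  qed
  have inj: "f = g" if "f \<circ> ?D = g \<circ> ?D" for f g :: "real \<Rightarrow> complex"
  proof
    fix x show "f x = g x" using fun_cong[OF that, of "c * x"] c by simp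
  qed
  have sub: "?E' \<subseteq> L2_functions ?M'"
  proof
    fix f assume "f \<in> ?E'"
    from E'[OF this] have f: "f \<in> borel_measurable lebesgue" "f \<circ> ?D \<in> L2_functions ?M" using E(1) by auto
    then have "integrable ?M' (\<lambda>x. (cmod (f x))\<^sup>2)" by (subst integrable_iff) (auto simp: L2_functions_def)
    then show "f \<in> L2_functions ?M'" using f by (simp add: L2_functions_def measurable_cong_sets[OF D_sets refl])
  qed
  have inner: "L2_inner ?M' f g = (if f = g then 1 else 0)" if "f \<in> ?E'" "g \<in> ?E'" for f g
  proof -
    note fg = E'[OF that(1)] E'[OF that(2)]
    have "L2_inner ?M' f g = L2_inner ?M (f \<circ> ?D) (g \<circ> ?D)"
    proof -
      have "cnj \<in> borel_measurable borel" by (intro borel_measurable_continuous_onI continuous_intros)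
      from measurable_compose[OF _ this] have "(\<lambda>x. f x * cnj (g x)) \<in> borel_measurable lebesgue"
        using fg by (intro borel_measurable_times) auto
      then show ?thesis unfolding L2_inner_def by (subst integral) (simp_all add: o_def)
    qed
    also have "\<dots> = (if f = g then 1 else 0)" using fg E(2) inj by auto
    finally show ?thesis .
  qed
  have dense: "\<exists>F d. finite F \<and> F \<subseteq> ?E' \<and> L2_norm ?M' (\<lambda>x. f x - (\<Sum>e\<in>F. d e * e x)) < \<epsilon>"
    if f: "f \<in> L2_functions ?M'" and "\<epsilon> > 0" for f \<epsilon>
  proof -
    obtain F d where F: "finite F" "F \<subseteq> ?E" "L2_norm ?M (\<lambda>x. (f \<circ> ?D) x - (\<Sum>e\<in>F. d e * e x)) < \<epsilon>"
      using E(3)[OF L2[OF f] \<open>\<epsilon> > 0\<close>] by blast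
    let ?F = "(\<lambda>e x. e (c * x)) ` F" and ?d = "\<lambda>e. d (e \<circ> ?D)"
    have inj_F: "inj_on (\<lambda>e x. e (c * x)) F"
      by (rule inj_on_inverseI[where g = "\<lambda>e x. e (x / c)"]) (use c in simp)
    have sum: "(\<Sum>e\<in>?F. ?d e * e x) = (\<Sum>e\<in>F. d e * e (c * x))" for x
      by (subst sum.reindex[OF inj_F]) (use c in \<open>simp add: o_def\<close>)
    have subE: "?F \<subseteq> ?E'"
    proof
      fix g assume "g \<in> ?F"
      then obtain l where l: "l \<in> \<Lambda>" "g = (\<lambda>x. ch l (c * x))" using F(2) by auto
      then have "g = ch (c * l)" by (simp add: ch_def fun_eq_iff mult_ac)
      then show "g \<in> ?E'" using l unfolding \<Lambda>'_def by blast
    qed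
    have fm: "f \<in> borel_measurable lebesgue"
      using f by (simp add: L2_functions_def measurable_cong_sets[OF D_sets refl])
    have "(\<lambda>x. f x - (\<Sum>e\<in>?F. ?d e * e x)) \<in> borel_measurable lebesgue"
      using fm subE E' by (intro borel_measurable_diff borel_measurable_sum borel_measurable_times) auto
    then have meas: "(\<lambda>x. (cmod (f x - (\<Sum>e\<in>?F. ?d e * e x)))\<^sup>2) \<in> borel_measurable lebesgue" by simp
    have "L2_norm ?M' (\<lambda>x. f x - (\<Sum>e\<in>?F. ?d e * e x)) = L2_norm ?M (\<lambda>x. (f \<circ> ?D) x - (\<Sum>e\<in>F. d e * e x))"
      unfolding L2_norm_def by (subst integral[OF meas]) (use c in \<open>simp add: sum\<close>)
    then show ?thesis using F subE by (intro exI[of _ ?F] exI[of _ ?d]) auto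
  qed
  have "L2_orthonormal_basis ?M' ?E'"
    unfolding L2_orthonormal_basis_def by (intro conjI ballI allI impI sub inner dense)
  moreover have "countable \<Lambda>'" unfolding \<Lambda>'_def using \<Lambda>(1) by simp
  ultimately show ?thesis
    unfolding spectral_set_def using um(1,2) S c
    by (auto simp: ch_def ennreal_zero_less_mult_iff ennreal_mult_less_top)
qed

section \<open>The spectrum of the block union\<close>

text \<open>Distinct elements of \<open>F\<close> shift \<open>S\<close> by distinct integers, so
  the pieces are disjoint up to null sets and their indicators add up.\<close>

lemma fourier_block_union:
  assumes comp: "compact S" and N: "N > 0" and t: "t > 0"
    and null: "\<And>n. n \<noteq> 0 \<Longrightarrow> S \<inter> (+) (of_int n) ` S \<in> null_sets lborel"
  shows "fourier (block_union t N L J S) \<xi> = (\<Sum>f\<in>level_sums L (N * L) J. unit_exp (\<xi> * of_int (int t * int N * f))) * fourier S \<xi>"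
proof -
  note [measurable] = borel_compact[OF comp]
  let ?F = "level_sums L (N * L) J"
  let ?k = "\<lambda>f. int t * int N * f"
  have fin: "finite ?F" by (rule finite_level_sums)
  let ?N = "\<Union>f\<in>?F. \<Union>f'\<in>?F - {f}. (+) (of_int (?k f)) ` S \<inter> (+) (of_int (?k f')) ` S"
  have "?N \<in> null_sets lborel"
  proof (intro null_sets.finite_UN fin finite_Diff)
    fix f f' assume "f \<in> ?F" "f' \<in> ?F - {f}"
    then have "?k f' - ?k f \<noteq> 0" using N t by auto
    from null[OF this] have "S \<inter> (+) (of_int (?k f' - ?k f)) ` S \<in> null_sets lebesgue" by (rule null_sets_completionI)
    then have "(+) (of_int (?k f)) ` (S \<inter> (+) (of_int (?k f' - ?k f)) ` S) \<in> null_sets lebesgue"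
      unfolding negligible_iff_null_sets[symmetric] by (rule negligible_translation)
    also have "(+) (of_int (?k f)) ` (S \<inter> (+) (of_int (?k f' - ?k f)) ` S) = (+) (of_int (?k f)) ` S \<inter> (+) (of_int (?k f')) ` S"
      by (auto simp: image_iff algebra_simps)
    finally show "(+) (of_int (?k f)) ` S \<inter> (+) (of_int (?k f')) ` S \<in> null_sets lborel"
      by (rule null_sets_lborelI) (intro borel_compact compact_Int compact_translation comp)
  qed
  then have "AE x in lborel. x \<notin> ?N" by (rule AE_not_in)
  then have ae: "AE x in lborel. indicat_real (block_union t N L J S) x = (\<Sum>f\<in>?F. indicat_real S (x - of_int (?k f)))"
  proof eventually_elim
    case (elim x)
    show ?case
    proof (cases "x \<in> block_union t N L J S")
      case True
      then obtain f where f: "f \<in> ?F" "x \<in> (+) (of_int (?k f)) ` S" by (auto simp: block_union_def)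
      have "x - of_int (?k f') \<notin> S" if "f' \<in> ?F - {f}" for f'
        using elim f that by force
      then have "(\<Sum>f'\<in>?F - {f}. indicat_real S (x - of_int (?k f'))) = 0" by (intro sum.neutral) auto
      then have "(\<Sum>f\<in>?F. indicat_real S (x - of_int (?k f))) = indicat_real S (x - of_int (?k f))"
        using f fin by (subst sum.remove) auto
      then show ?thesis using True f(2) by auto
    next
      case False
      then have "x - of_int (?k f) \<notin> S" if "f \<in> ?F" for f
        using that by (force simp: block_union_def)
      then show ?thesis using False by simp
    qed
  qed
  have [measurable]: "block_union t N L J S \<in> sets borel" using compact_block_union[OF comp] by (rule borel_compact)
  let ?g = "\<lambda>f x. unit_exp (\<xi> * of_int (?k f)) * (indicat_real S (- of_int (?k f) + 1 * x) *\<^sub>R unit_exp (\<xi> * (- of_int (?k f) + 1 * x)))"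
  have int: "integrable lborel (?g f)" for f
    using lborel_integrable_real_affine[OF integrable_unit_exp_compact[OF comp, of \<xi>], of 1 "- of_int (?k f)"]
    by (intro integrable_mult_right) auto
  have "fourier (block_union t N L J S) \<xi> = (\<integral>x. (\<Sum>f\<in>?F. ?g f x) \<partial>lborel)"
    unfolding fourier_def
  proof (rule integral_cong_AE)
    show "AE x in lborel. indicat_real (block_union t N L J S) x *\<^sub>R unit_exp (\<xi> * x) = (\<Sum>f\<in>?F. ?g f x)"
      using ae
    proof eventually_elim
      case (elim x)
      have "indicat_real S (x - of_int (?k f)) *\<^sub>R unit_exp (\<xi> * x) = ?g f x" for f
      proof -
        have "\<xi> * x = \<xi> * of_int (?k f) + \<xi> * (- of_int (?k f) + 1 * x)" by (simp add: algebra_simps)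
        then have "unit_exp (\<xi> * x) = unit_exp (\<xi> * of_int (?k f)) * unit_exp (\<xi> * (- of_int (?k f) + 1 * x))"
          by (simp only: unit_exp_add)
        then show ?thesis by simp
      qed
      then show ?case by (simp only: elim scaleR_sum_left)
    qed
  qed measurable
  also have "\<dots> = (\<Sum>f\<in>?F. \<integral>x. ?g f x \<partial>lborel)"
    using int by (intro Bochner_Integration.integral_sum)
  also have "\<dots> = (\<Sum>f\<in>?F. unit_exp (\<xi> * of_int (?k f)) * fourier S \<xi>)"
  proof (intro sum.cong refl)
    fix f
    have "fourier S \<xi> = (\<integral>x. indicat_real S (- of_int (?k f) + 1 * x) *\<^sub>R unit_exp (\<xi> * (- of_int (?k f) + 1 * x)) \<partial>lborel)"
      unfolding fourier_def by (subst lborel_integral_real_affine[of 1 _ "- of_int (?k f)"]) auto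
    then show "(\<integral>x. ?g f x \<partial>lborel) = unit_exp (\<xi> * of_int (?k f)) * fourier S \<xi>"
      by (simp only: integral_mult_right_zero)
  qed
  finally show ?thesis by (simp only: sum_distrib_right)
qed

text \<open>The set \<open>B\<close> consists of the frequencies of \<open>F\<close> divided by
  \<open>t N\<close>, which cancels the dilation of \<open>F\<close>. Equal elements of
  \<open>B\<close> leave a nonzero integer, a zero of \<open>fourier S\<close>; for distinct ones
  the integer part drops out of the exponential sum over \<open>F\<close>, which vanishes.\<close>

lemma spectral_set_block_union:
  assumes N: "N > 0" and L: "L > 0" and t: "t > 0"
    and comp: "compact S" and pos: "measure lborel (block_union t N L J S) > 0"
    and null: "\<And>n. n \<noteq> 0 \<Longrightarrow> S \<inter> (+) (of_int n) ` S \<in> null_sets lborel"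
    and zero: "\<And>n. n \<noteq> 0 \<Longrightarrow> fourier S (of_int n) = 0"
  shows "spectral_set (block_union t N L J S)"
proof -
  define s where "s = real t * real N"
  have s: "s > 0" using N t by (simp add: s_def)
  let ?F = "level_sums L (N * L) J" and ?B0 = "level_freqs L (N * L) J"
  define B where "B = (\<lambda>\<beta>. \<beta> / s) ` ?B0"
  have injB: "inj_on (\<lambda>\<beta>. \<beta> / s) ?B0" using s by (auto simp: inj_on_def)
  have cancel: "\<beta> / s * of_int (int t * int N * f) = \<beta> * of_int f" for \<beta> f
    using N t by (simp add: s_def)
  note sums = sum_level_freqs_eq_0[OF N L refl] sum_level_sums_eq_0[OF N L refl]
  have fourier: "fourier (block_union t N L J S) \<xi>
      = (\<Sum>f\<in>?F. unit_exp (\<xi> * of_int (int t * int N * f))) * fourier S \<xi>" for \<xi>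
    by (rule fourier_block_union[OF comp N t null])
  show ?thesis
  proof (rule spectral_setI[OF compact_block_union[OF comp] pos])
    show "finite B" "B \<noteq> {}" unfolding B_def using finite_level_freqs zero_in_level_freqs[OF L, of "N * L" J] by auto
  next
    fix \<beta> \<beta>' and n :: int
    assume "\<beta> \<in> B" "\<beta>' \<in> B" and ne: "\<beta> - \<beta>' + of_int n \<noteq> 0"
    then obtain b b' where b: "b \<in> ?B0" "b' \<in> ?B0" "\<beta> = b / s" "\<beta>' = b' / s" by (auto simp: B_def)
    show "fourier (block_union t N L J S) (\<beta> - \<beta>' + of_int n) = 0"
    proof (cases "b = b'")
      case True
      then show ?thesis using ne zero[of n] b by (simp add: fourier)
    next
      case False
      have "unit_exp ((\<beta> - \<beta>' + of_int n) * of_int (int t * int N * f)) = unit_exp ((b - b') * of_int f)" for f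
      proof -
        have "(\<beta> - \<beta>' + of_int n) * of_int (int t * int N * f)
           = (b - b') * of_int f + of_int (n * (int t * int N * f))"
          unfolding b(3,4) diff_divide_distrib[symmetric] distrib_right cancel by simp
        then show ?thesis by (simp only: unit_exp_add_Ints[OF Ints_of_int])
      qed
      then show ?thesis
        using sums(2)[OF b(1,2) False] by (simp only: fourier) simp
    qed
  next
    fix k :: int assume k: "k \<noteq> 0"
    show "(\<Sum>\<beta>\<in>B. unit_exp (\<beta> * of_int k)) = 0 \<or> block_union t N L J S \<inter> (+) (of_int k) ` block_union t N L J S \<in> null_sets lborel"
    \<comment> \<open>If \<open>k\<close> is a difference of elements of \<open>t N F\<close>, the
      frequencies separate the two. Otherwise every piece of one block union differs from every
      piece of the other by a nonzero integer shift.\<close>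
    proof (cases "\<exists>f\<in>?F. \<exists>f'\<in>?F. k = int t * int N * (f - f')")
      case True
      then obtain f f' where f: "f \<in> ?F" "f' \<in> ?F" "k = int t * int N * (f - f')" by blast
      then have "f \<noteq> f'" using k by auto
      have "(\<Sum>\<beta>\<in>B. unit_exp (\<beta> * of_int k)) = (\<Sum>\<beta>\<in>?B0. unit_exp (\<beta> * of_int (f - f')))"
        unfolding B_def f(3) by (simp only: sum.reindex[OF injB] o_def cancel)
      also have "\<dots> = 0" by (rule sums(1)[OF f(1,2) \<open>f \<noteq> f'\<close>])
      finally show ?thesis by simp
    next
      case False
      let ?N = "\<Union>f\<in>?F. \<Union>f'\<in>?F. (+) (of_int (int t * int N * f)) ` (S \<inter> (+) (of_int (k + int t * int N * f' - int t * int N * f)) ` S)"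
      have "?N \<in> null_sets lebesgue"
      proof (intro null_sets.finite_UN finite_level_sums)
        fix f f' assume "f \<in> ?F" "f' \<in> ?F"
        then have "k + int t * int N * f' - int t * int N * f \<noteq> 0" using False by (auto simp: algebra_simps)
        from null[OF this] have "S \<inter> (+) (of_int (k + int t * int N * f' - int t * int N * f)) ` S \<in> null_sets lebesgue"
          by (rule null_sets_completionI)
        then show "(+) (of_int (int t * int N * f)) ` (S \<inter> (+) (of_int (k + int t * int N * f' - int t * int N * f)) ` S) \<in> null_sets lebesgue"
          unfolding negligible_iff_null_sets[symmetric] by (rule negligible_translation)
      qed
      moreover have "block_union t N L J S \<inter> (+) (of_int k) ` block_union t N L J S \<subseteq> ?N"
      proof
        fix x assume "x \<in> block_union t N L J S \<inter> (+) (of_int k) ` block_union t N L J S"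
        then obtain f f' u u' where x: "f \<in> ?F" "f' \<in> ?F" "u \<in> S" "u' \<in> S"
          "x = of_int (int t * int N * f) + u" "x = of_int k + (of_int (int t * int N * f') + u')"
          unfolding block_union_def by blast
        then have "u = of_int (k + int t * int N * f' - int t * int N * f) + u'" by simp
        then show "x \<in> ?N" using x by blast
      qed
      ultimately have "block_union t N L J S \<inter> (+) (of_int k) ` block_union t N L J S \<in> null_sets lebesgue"
        unfolding negligible_iff_null_sets[symmetric] by (rule negligible_subset)
      moreover have "block_union t N L J S \<inter> (+) (of_int k) ` block_union t N L J S \<in> sets borel"
        using compact_block_union[OF comp] by (intro borel_compact compact_Int compact_translation) auto
      ultimately show ?thesis using null_sets_lborelI by blast
    qed
  qed
qed

section \<open>From positive measure to both properties\<close>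

lemma digit_condition:
  fixes N L m n :: nat
  assumes N: "N \<ge> 2" and L: "L \<ge> 2" and m: "m \<ge> N"
    and T: "is_self_similar_set (1 / (real N * real L)) (digit_set N m L) T" and pos: "measure lborel T > 0"
    and n: "\<not> L dvd n"
  shows "\<exists>j. (N * L) ^ j * N dvd m * n \<and> \<not> (N * L) ^ Suc j dvd m * n"
proof -
  define b where "b = N * L"
  have b: "b > 1" "b > 0" "real N * real L = real b" using N L by (auto simp: b_def intro: one_less_mult)
  have D: "finite (digit_set N m L)" "card (digit_set N m L) = b" "digit_set N m L \<subseteq> \<int>"
    using card_digit_set[OF m, of L] N L card_ge_0_finite[of "digit_set N m L"]
    by (auto simp: b_def) (auto simp: digit_set_def)
  have "n \<noteq> 0" using n by (metis dvd_0_right)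
  then obtain i where i: "(\<Sum>d\<in>digit_set N m L. unit_exp (real n / real b ^ Suc i * d)) = 0"
    using ex_mask_eq_0[OF T[unfolded b(3)] b(1) D pos, of "real n"] \<open>n \<noteq> 0\<close> by auto
  define y where "y = real n / real b ^ Suc i"
  have "digit_set N m L = (\<lambda>(a, c). real a + real m * real c) ` ({..<N} \<times> {..<L})"
    by (auto simp: digit_set_def)
  then have "(\<Sum>d\<in>digit_set N m L. unit_exp (y * d)) = (\<Sum>(a, c)\<in>{..<N} \<times> {..<L}. unit_exp (y * (real a + real m * real c)))"
    using sum.reindex[OF digit_set_direct[OF m, of L]] by (simp add: case_prod_unfold)
  also have "\<dots> = (\<Sum>(a, c)\<in>{..<N} \<times> {..<L}. unit_exp (real a * y) * unit_exp (real c * (real m * y)))"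
    by (intro sum.cong refl) (auto simp: algebra_simps simp flip: unit_exp_add)
  also have "\<dots> = (\<Sum>a<N. unit_exp (real a * y)) * (\<Sum>c<L. unit_exp (real c * (real m * y)))"
    by (simp add: sum_product sum.cartesian_product)
  finally have "(\<Sum>a<N. unit_exp (real a * y)) = 0 \<or> (\<Sum>c<L. unit_exp (real c * (real m * y))) = 0"
    using i by (simp add: y_def)
  then have cases: "real N * y \<in> \<int> \<or> (real L * (real m * y) \<in> \<int> \<and> real m * y \<notin> \<int>)"
    using sum_unit_exp_eq_0_iff[of N y] sum_unit_exp_eq_0_iff[of L "real m * y"] N L by auto
  have Ints_iff: "real x / real z \<in> \<int> \<longleftrightarrow> z dvd x" if "z > 0" for x z :: nat
    using of_int_div_of_int_in_Ints_iff[of "int x" "int z", where 'a = real] that by simp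
  have y1: "real N * y \<in> \<int> \<longleftrightarrow> b ^ i * L dvd n"
  proof -
    have "real N * y = real n / real (b ^ i * L)" using N L by (simp add: y_def b_def field_simps)
    moreover have "b ^ i * L > 0" using b L by simp
    ultimately show ?thesis by (simp only: Ints_iff)
  qed
  have y2: "real m * y \<in> \<int> \<longleftrightarrow> b ^ Suc i dvd m * n"
  proof -
    have "real m * y = real (m * n) / real (b ^ Suc i)" by (simp add: y_def)
    moreover have "b ^ Suc i > 0" using b by simp
    ultimately show ?thesis by (simp only: Ints_iff)
  qed
  have y3: "real L * (real m * y) \<in> \<int> \<longleftrightarrow> b ^ i * N dvd m * n"
  proof -
    have "real L * (real m * y) = real (m * n) / real (b ^ i * N)" using N L by (simp add: y_def b_def field_simps)
    moreover have "b ^ i * N > 0" using b N by simp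
    ultimately show ?thesis by (simp only: Ints_iff)
  qed
  have "\<not> b ^ i * L dvd n" using n dvd_mult_right by blast
  then have "b ^ i * N dvd m * n \<and> \<not> b ^ Suc i dvd m * n" using cases y1 y2 y3 by auto
  then show ?thesis unfolding b_def by blast
qed

lemma spectral_and_tile:
  fixes N L m :: nat
  assumes N: "N \<ge> 2" and L: "L \<ge> 2" and m: "m \<ge> N"
    and T: "is_self_similar_set (1 / (real N * real L)) (digit_set N m L) T" and pos: "measure lborel T > 0"
  shows "spectral_set T \<and> translation_tile T"
proof -
  define b where "b = N * L"
  have b: "b > 1" "b > 0" "real N * real L = real b" using N L by (auto simp: b_def intro: one_less_mult)
  have "m > 0" using N m by simp
  from digit_factorization[OF N L this digit_condition[OF N L m T pos]]
  obtain J t h where *: "m * h = N * (N * L) ^ J * t" "h > 0" "t > 0" "coprime t L" "coprime h N" "coprime h t"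
    by blast
  let ?D = "residue_digits h t N L"
  have NL: "N > 0" "L > 0" using N L by auto
  note complete = residue_digits_complete[OF NL *(4,5)]
  have D: "finite (of_int ` ?D :: real set)" "(of_int ` ?D :: real set) \<noteq> {}" "card (of_int ` ?D :: real set) = b" "(of_int ` ?D :: real set) \<subseteq> \<int>"
  proof -
    show "finite (of_int ` ?D :: real set)" using finite_residue_digits by simp
    show "(of_int ` ?D :: real set) \<noteq> {}" using zero_in_residue_digits[OF NL] by auto
    have "inj_on (of_int :: int \<Rightarrow> real) ?D" by (auto simp: inj_on_def)
    then show "card (of_int ` ?D :: real set) = b" using complete(1) by (simp add: card_image b_def)
  qed auto
  obtain S where S: "is_self_similar_set (1 / real b) (of_int ` ?D) S"
    using ex1_self_similar_set[of "1 / real b", OF _ _ D(1,2)] b by auto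
  then have comp: "compact S" by (auto simp only: is_self_similar_set_def)
  let ?U = "block_union t N L J S"
  have U: "is_self_similar_set (1 / real b) (digit_set N m L) ((\<lambda>x. x / real h) ` ?U)"
    using self_similar_block_union[OF N L *(2,1) S[folded b(3)]] unfolding b(3) .
  \<comment> \<open>Both sets are self-similar for the same digits, so uniqueness identifies
    them.\<close>
  have T_eq: "T = (\<lambda>x. x / real h) ` ?U"
    using self_similar_set_subset[OF _ _ U T[unfolded b(3)]] self_similar_set_subset[OF _ _ T[unfolded b(3)] U] b by auto
  have null: "S \<inter> (+) (of_int n) ` S \<in> null_sets lborel" if "n \<noteq> 0" for n
    using null_inter_int_translate[OF S b(2) finite_residue_digits _ _ zero_in_residue_digits[OF NL]
        residue_digits_coprime[OF N L *(5,6)] that] complete(1,2) by (simp add: b_def)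
  have cover: "\<exists>s\<in>S. \<exists>n. x = s + of_int n" for x
    using int_translates_cover[OF S b(1)] complete(3) unfolding b_def by metis
  have zero: "fourier S (of_int n) = 0" if "n \<noteq> 0" for n
    using fourier_integer_eq_0[OF S b(1) D(1,3,4)] that by simp
  \<comment> \<open>Positivity passes from \<open>T\<close> back to the block union, since dilations
    preserve null sets.\<close>
  have "measure lborel ?U > 0"
  proof (rule ccontr)
    have compU: "compact ?U" using compact_block_union[OF comp] .
    assume "\<not> ?thesis"
    then have "measure lborel ?U = 0" by (simp add: zero_less_measure_iff)
    then have "?U \<in> null_sets lborel"
      using emeasure_compact_finite[OF compU] borel_compact[OF compU]
      by (auto simp: null_sets_def emeasure_eq_ennreal_measure)
    then have "?U \<in> null_sets lebesgue" by (rule null_sets_completionI)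
    then have "T \<in> null_sets lebesgue"
      unfolding T_eq negligible_iff_null_sets[symmetric]
      by (intro negligible_differentiable_image_negligible)
         (auto simp: divide_inverse intro!: bounded_linear_imp_differentiable_on bounded_linear_mult_left)
    then have "measure lborel T = 0"
      using T by (simp add: null_sets_def measure_def is_self_similar_set_def borel_compact)
    then show False using pos by simp
  qed
  then have "spectral_set ?U"
    by (rule spectral_set_block_union[OF NL *(3) comp _ null zero])
  then have "spectral_set T" unfolding T_eq using *(2) by (intro spectral_set_divide) auto
  moreover have "translation_tile T"
    unfolding T_eq by (rule translation_tile_block_union[OF NL *(2,4) cover null])
  ultimately show ?thesis by blast
qed

text \<open>Choosing for each point a basic open set that isolates it gives an injection into a
  countable basis.\<close>

lemma discrete_imp_countable:
  fixes G :: "'a :: second_countable_topology set"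
  assumes "discrete G"
  shows "countable G"
proof -
  obtain B :: "'a set set" where B: "countable B" "topological_basis B" using ex_countable_basis by blast
  have "\<exists>V\<in>B. V \<inter> G = {x}" if x: "x \<in> G" for x
  proof -
    obtain U where U: "open U" "U \<inter> G = {x}"
      using assms x unfolding discrete_def isolated_in_def by blast
    then obtain V where "V \<in> B" "x \<in> V" "V \<subseteq> U" using topological_basisE[OF B(2) U(1), of x] by blast
    then show ?thesis using U x by (intro bexI[of _ V]) auto
  qed
  then obtain V where V: "\<And>x. x \<in> G \<Longrightarrow> V x \<in> B" "\<And>x. x \<in> G \<Longrightarrow> V x \<inter> G = {x}" by metis
  have "inj_on V G" by (rule inj_onI) (metis V(2) singleton_inject)
  moreover have "V ` G \<subseteq> B" using V(1) by blast
  ultimately show ?thesis using B(1) by (meson countable_image_inj_on countable_subset)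
qed

text \<open>A discrete set of translations is countable, and countably many null sets cannot cover
  almost all of the line.\<close>

lemma measure_pos_if_translation_tile:
  assumes comp: "compact T" and tile: "translation_tile T"
  shows "measure lborel T > 0"
proof (rule ccontr)
  assume "\<not> ?thesis"
  then have "measure lborel T = 0" by (simp add: zero_less_measure_iff)
  then have "T \<in> null_sets lborel"
    using emeasure_compact_finite[OF comp] borel_compact[OF comp]
    by (auto simp: null_sets_def emeasure_eq_ennreal_measure)
  then have T: "T \<in> null_sets lebesgue" by (rule null_sets_completionI)
  obtain \<Gamma> where \<Gamma>: "discrete \<Gamma>" "UNIV - (\<Union>\<gamma>\<in>\<Gamma>. (\<lambda>x. x + \<gamma>) ` T) \<in> null_sets lebesgue"
    using tile unfolding translation_tile_def by blast
  have "countable \<Gamma>" using \<Gamma>(1) by (rule discrete_imp_countable)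
  have "(\<Union>\<gamma>\<in>\<Gamma>. (\<lambda>x. x + \<gamma>) ` T) \<in> null_sets lebesgue"
  proof (rule null_sets_UN'[OF \<open>countable \<Gamma>\<close>])
    fix \<gamma>
    show "(\<lambda>x. x + \<gamma>) ` T \<in> null_sets lebesgue"
      using T negligible_translation[of T \<gamma>] unfolding negligible_iff_null_sets[symmetric] by (simp add: add.commute)
  qed
  from null_sets.Un[OF this \<Gamma>(2)] have "(UNIV :: real set) \<in> null_sets lebesgue" by simp
  then show False by (simp add: null_sets_def)
qed

theorem theorem1p6:
  fixes N m L :: nat
  assumes "N \<ge> 2" and "L \<ge> 2" and "m \<ge> N"
  shows "spectral_set (self_similar_set (1 / (real N * real L)) (digit_set N m L)) \<longleftrightarrow>
         translation_tile (self_similar_set (1 / (real N * real L)) (digit_set N m L))"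
proof -
  let ?T = "self_similar_set (1 / (real N * real L)) (digit_set N m L)"
  have NL: "1 < N * L" "1 < real N * real L"
    using assms by (auto intro: one_less_mult simp flip: of_nat_mult)
  have D: "finite (digit_set N m L)" "digit_set N m L \<noteq> {}"
  proof -
    have "card (digit_set N m L) > 0" using card_digit_set[OF assms(3), of L] NL(1) by linarith
    then show "finite (digit_set N m L)" "digit_set N m L \<noteq> {}" by (rule card_ge_0_finite, auto)
  qed
  have T: "is_self_similar_set (1 / (real N * real L)) (digit_set N m L) ?T"
    using NL by (intro is_self_similar_set_self_similar_set D) auto
  then have comp: "compact ?T" by (auto simp only: is_self_similar_set_def)
  note both = spectral_and_tile[OF assms T]
  show ?thesis
  proof
    assume "spectral_set ?T"
    then have "emeasure lebesgue ?T > 0" unfolding spectral_set_def by blast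
    then have "measure lborel ?T > 0"
      using emeasure_compact_finite[OF comp] borel_compact[OF comp]
      by (simp add: measure_def enn2real_positive_iff)
    then show "translation_tile ?T" using both by blast
  next
    assume "translation_tile ?T"
    then show "spectral_set ?T" using measure_pos_if_translation_tile[OF comp] both by blast
  qed
qed

end
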